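(* Let $\mathbf R^{(1)}$ be the reference measure of Scenario (1), let $\Phi:\Omega^{(1)}\to\Omega^{(2)}$ be the map which replaces the spatial position of a path by $\mathfrak c$ whenever it is in the dead regime (leaving everything else, including the recorded killing time, unchanged), and let $\mathbf R^{(2)}=\Phi_\#\mathbf R^{(1)}$. Consider the unbalanced Schr\"odinger bridge problems for $\mathbf R^{(1)}$ (Scenario (1)) and $\mathbf R^{(2)}$ (Scenario (2)) with target distributions satisfying $\rho_0^{(1)}=\rho_0^{(2)}$, $\rho_T^{(1)}(\cdot,\mathsf a)=\rho_T^{(2)}(\cdot,\mathsf a)$ and $\int_{\mathbb R^d}\rho_T^{(1)}((x,\tau),\mathsf d)\,dx=\rho_T^{(2)}((\mathfrak c,\tau),\mathsf d)$ for all $\tau\in[0,T]$. Assume (A), (B), (C) hold in both Scenarios. Suppose that the respective solutions $\widehat{\mathbf P}^{(1)},\widehat{\mathbf P}^{(2)}$ exist and satisfy $$\widehat{\mathbf P}^{(k)}=\mathfrak f^{(k)}\big((X_0,\tau_0),\Lambda_0\big)\,\mathfrak g^{(k)}\big((X_T,\tau_T),\Lambda_T\big)\,\mathbf R^{(k)},\qquad k=1,2,$$ where $(\mathfrak f^{(1)},\mathfrak g^{(1)})$ and $(\mathfrak f^{(2)},\mathfrak g^{(2)})$ are the unique (up to scaling) solutions of their respective static Schr\"odinger systems. Then $$\mathrm{KL}(\widehat{\mathbf P}^{(1)}\|\mathbf R^{(1)})\ge\mathrm{KL}(\widehat{\mathbf P}^{(2)}\|\mathbf R^{(2)}),$$ and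 the following are equivalent: (i) $\mathrm{KL}(\widehat{\mathbf P}^{(1)}\|\mathbf R^{(1)})=\mathrm{KL}(\widehat{\mathbf P}^{(2)}\|\mathbf R^{(2)})$. (ii) $\Phi_\#\widehat{\mathbf P}^{(1)}=\widehat{\mathbf P}^{(2)}$. (iii) For $\mathbf R_T^{(1)}(\cdot,\mathsf d)$-a.e. $(x,\tau)$, $\mathfrak g^{(1)}((x,\tau),\mathsf d)$ does not depend on $x$ (i.e. it agrees $\mathbf R_T^{(1)}(\cdot,\mathsf d)$-a.e. with a function of $\tau$ only). (iv) For $\mathbf R_T^{(1)}(\cdot,\mathsf d)$-a.e. $(x,\tau)$, $$\frac{d\rho_T^{(1)}}{d\mathbf R_T^{(1)}}((x,\tau),\mathsf d)=\mathfrak g^{(2)}((\mathfrak c,\tau),\mathsf d)\cdot\mathbf E_{\mathbf R^{(1)}}\Big[\mathfrak f^{(2)}\big((X_0,\tau_0),\Lambda_0\big)\,\Big|\,\big((X_T,\tau_T),\Lambda_T\big)=((x,\tau),\mathsf d)\Big].$$ If any of (i)--(iv) holds, then the active-regime SDE and the killing rate of the Schr\"odinger bridge are identical for $\widehat{\mathbf P}^{(1)}$ and $\widehat{\mathbf P}^{(2)}$; that is, the drifts $b+a\nabla\log\varphi^{(1)}(\cdot,\mathsf a)$ and $b+a\nabla\log\varphi^{(2)}(\cdot,\mathsf a)$ coincide, and so do the killing rates $\frac{\varphi^{(1)}(t,(x,t),\mathsf d)}{\varphi^{(1)}(t,x,\mathsf a)}V(t,x)$ and $\frac{\varphi^{(2)}(t,(\mathfrak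 c,t),\mathsf d)}{\varphi^{(2)}(t,x,\mathsf a)}V(t,x)$.
   Context: Fix $d\ge1$, $T>0$, a point $\mathfrak c\in\mathbb R^d$, and two regimes $\mathsf a$ (active), $\mathsf d$ (dead). Function classes: $C_b$, $C_u$ are the bounded continuous, resp. uniformly continuous, functions on $[0,T]\times\mathbb R^d$; $\mathcal H^\alpha_u$ is the class of $g$ with $|g(t,x)-g(t,y)|\le C|x-y|^\alpha$ for all $t,x,y$. Assumption (C): for some $\alpha>0$: $b:[0,T]\times\mathbb R^d\to\mathbb R^d$ has $b_m,\nabla b_m\in C_b\cap\mathcal H^\alpha_u$; $\sigma:[0,T]\times\mathbb R^d\to\mathbb R^{d\times d}$ is such that $a=(a_{mn}):=\sigma\sigma^\top$ satisfies $a_{mn}\in C_b\cap C_u$, $\nabla a_{mn},\nabla^2a_{mn}\in C_b\cap\mathcal H^\alpha_u$, and is uniformly elliptic; $V:[0,T]\times\mathbb R^d\to[0,\infty)$ is in $C_b\cap\mathcal H^\alpha_u$ and not identically $0$. (The remaining requirement, $\psi$ measurable and locally bounded, holds for the $\psi$'s below.) Path spaces. Let $\psi^{(1)}(t,x)=(x,t)$ and $\psi^{(2)}(t,x)=(\mathfrak c,t)$. $\Omega^{(k)}$ ($k=1,2$) is the set of c\`adl\`ag paths $((X_t,\tau_t),\Lambda_t)_{t\in[0,T]}$ in $(\mathbb R^d\times[0,T])\times\{\mathsf a,\mathsf d\}$ (with the Skorokhod metric) such that either $\Lambda\equiv\mathsf a$, $\tau\equiv0$ and $X$ is continuous on $[0,T]$,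 or there is a killing time $\mathfrak K\in[0,T]$ such that on $[0,\mathfrak K)$ $\Lambda=\mathsf a$, $\tau=0$, $X$ is continuous, and on $[\mathfrak K,T]$ $\Lambda=\mathsf d$ and $(X,\tau)\equiv\psi^{(k)}(\mathfrak K,X_{\mathfrak K-})$. (Under all measures considered $\Lambda_0=\mathsf a$ a.s.; the trivial coordinate $\tau=0$ is omitted from notation in the active regime.) For a path measure $\mathbf P$, $\mathbf P_t$ is the law at time $t$, $\mathbf P_t(\cdot,i)$ its part in regime $i$, $\mathbf P_{0T}$ the joint law at times $0,T$. Explicitly, $\Phi(\omega)(t)=((X_t,\tau_t),\Lambda_t)$ if $\Lambda_t=\mathsf a$ and $\Phi(\omega)(t)=((\mathfrak c,\tau_t),\Lambda_t)$ if $\Lambda_t=\mathsf d$. $\Phi_\#\mu(B)=\mu(\Phi^{-1}(B))$ is the pushforward. Reference measure $\mathbf R^{(1)}$: the strong Markov probability measure on $\Omega^{(1)}$ with active initial law $\mu_0$ (a probability measure on $\mathbb R^d$, $\mathbf R^{(1)}_0=\mu_0\times\delta_{\mathsf a}$), under which $dX_t=b(t,X_t)dt+\sigma(t,X_t)dB_t$ for $0\le t<\mathfrak K\wedge T$, killing ($\mathsf a\to\mathsf d$) occurs at rate $V(t,X_t)$, i.e. $\lim_{\varepsilon\downarrow0}\varepsilon^{-1}\mathbf R^{(1)}(\Lambda_{t+\varepsilon}=\mathsf d\mid\Lambda_t=\mathsf a,X_t=x)=V(t,x)$, and the dead regime is absorbing. It has an everywhere positive active transition density $q$: $\mathbf R^{(1)}(X_s\in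 B,\Lambda_s=\mathsf a\mid(X_t,\Lambda_t)=(x,\mathsf a))=\int_Bq(t,x,s,y)dy$, $0\le t<s\le T$. $\mathbf R^{(2)}=\Phi_\#\mathbf R^{(1)}$ is then the reference measure of Scenario (2) with the same $b,\sigma,V,\mu_0$. Problem in Scenario $(k)$: $\widehat{\mathbf P}^{(k)}=\arg\min\{\mathrm{KL}(\mathbf P\|\mathbf R^{(k)}):\mathbf P_0=\rho_0^{(k)},\ \mathbf P_T=\rho_T^{(k)}\}$ over probability measures on $\Omega^{(k)}$, where $\mathrm{KL}(\mathbf Q\|\mathbf P)=\mathbf E_{\mathbf Q}[\log\frac{d\mathbf Q}{d\mathbf P}]$ if $\mathbf Q\ll\mathbf P$, $+\infty$ otherwise; $\rho_0^{(k)}$ is a probability measure on $\mathbb R^d$ placed in regime $\mathsf a$; $\rho_T^{(k)}$ is a probability measure consisting of a density $\rho_T^{(k)}(\cdot,\mathsf a)$ on $\mathbb R^d$ and a dead-regime density: $\rho_T^{(1)}((x,\tau),\mathsf d)$ on $\mathbb R^d\times[0,T]$, resp. $\tau\mapsto\rho_T^{(2)}((\mathfrak c,\tau),\mathsf d)$ on $[0,T]$. Static Schr\"odinger system (for $(\mathbf R,\rho_0,\rho_T)$), for measurable $\mathfrak f,\mathfrak g\ge0$; write $Y_t$ for the spatial component, here $(X_t,\tau_t)$: $\mathfrak f(x,\mathsf a)\mathbf E_{\mathbf R}[\mathfrak g(Y_T,\Lambda_T)\mid(Y_0,\Lambda_0)=(x,\mathsf a)]=\frac{d\rho_0}{d\mathbf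 R_0}(x,\mathsf a)$ for $\mathbf R_0$-a.e. $(x,\mathsf a)$, and $\mathfrak g(y,i)\mathbf E_{\mathbf R}[\mathfrak f(Y_0,\Lambda_0)\mid(Y_T,\Lambda_T)=(y,i)]=\frac{d\rho_T}{d\mathbf R_T}(y,i)$ for $\mathbf R_T$-a.e. $(y,i)$, $i\in\{\mathsf a,\mathsf d\}$. Solutions are unique up to scaling and null sets; equalities of functions built from them are understood accordingly. Assumption (A): $\mathrm{KL}(\rho_0\otimes\rho_T\|\mathbf R_{0T})<\infty$. Assumption (B): $\int\mathfrak f(x,\mathsf a)\mu_0(dx)<\infty$ and $\mathfrak g$ is bounded on the support of $\mathbf R_T$. $\varphi^{(k)}(t,x,\mathsf a)=\int q(t,x,T,z)\mathfrak g^{(k)}(z,\mathsf a)dz+\int_{\mathbb R^d}\int_t^Tq(t,x,r,z)V(r,z)\mathfrak g^{(k)}(\psi^{(k)}(r,z),\mathsf d)\,dr\,dz$ for $t<T$ and $\varphi^{(k)}(t,y,\mathsf d)=\mathfrak g^{(k)}(y,\mathsf d)$. It is known that under $\widehat{\mathbf P}^{(k)}$ the process is a diffusion with killing with active SDE $dX_t=(b+a\nabla\log\varphi^{(k)}(\cdot,\mathsf a))(t,X_t)dt+\sigma(t,X_t)dB_t$, $X_0\sim\rho_0^{(k)}$, and killing rate $\frac{\varphi^{(k)}(t,\psi^{(k)}(t,x),\mathsf d)}{\varphi^{(k)}(t,x,\mathsf a)}V(t,x)$. *)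

theory Defs
  imports "HOL-Probability.Probability"
begin

section \<open>States and paths\<close>

datatype regime = Active | Dead

text \<open>
  A state is \<open>((x, \<tau>), i)\<close>: spatial position, recorded killing time, regime.
  A path is a function on \<open>{0..T}\<close>, extended by \<^const>\<open>undefined\<close> outside of it.
\<close>

type_synonym 'n state = "((real^'n) \<times> real) \<times> regime"
type_synonym 'n path = "real \<Rightarrow> 'n state"

abbreviation pos :: "'n state \<Rightarrow> real^'n" where "pos y \<equiv> fst (fst y)"
abbreviation ktime :: "'n state \<Rightarrow> real" where "ktime y \<equiv> snd (fst y)"
abbreviation regime_of :: "'n state \<Rightarrow> regime" where "regime_of y \<equiv> snd y"

definition state_space :: "('n::finite) state measure" where
  "state_space = borel \<Otimes>\<^sub>M count_space UNIV"

definition psi1 :: "real \<Rightarrow> real^'n \<Rightarrow> (real^'n) \<times> real" where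
  "psi1 t x = (x, t)"

definition psi2 :: "real^'n \<Rightarrow> real \<Rightarrow> real^'n \<Rightarrow> (real^'n) \<times> real" where
  "psi2 c t x = (c, t)"

text \<open>
  The left limit \<open>X\<^bsub>K-\<^esub>\<close> is the limit along \<open>at K within {0..<K}\<close>. For \<open>K = 0\<close> this filter
  is trivial, so that a path which starts dead may start from any \<open>\<psi>(0, x)\<close>.
\<close>

definition path_set ::
    "real \<Rightarrow> (real \<Rightarrow> real^'n \<Rightarrow> (real^'n) \<times> real) \<Rightarrow> ('n::finite) path set" where
  "path_set T \<psi> = {\<omega> \<in> extensional {0..T}.
     ((\<forall>t\<in>{0..T}. regime_of (\<omega> t) = Active \<and> ktime (\<omega> t) = 0)
        \<and> continuous_on {0..T} (\<lambda>t. pos (\<omega> t)))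
   \<or> (\<exists>K\<in>{0..T}.
        (\<forall>t\<in>{0..<K}. regime_of (\<omega> t) = Active \<and> ktime (\<omega> t) = 0)
        \<and> continuous_on {0..<K} (\<lambda>t. pos (\<omega> t))
        \<and> (\<exists>x. ((\<lambda>t. pos (\<omega> t)) \<longlongrightarrow> x) (at K within {0..<K})
               \<and> (\<forall>t\<in>{K..T}. \<omega> t = (\<psi> K x, Dead))))}"

text \<open>
  The Borel sets of the Skorokhod topology on a space of cadlag paths are the sets generated by
  the coordinate maps; the latter description is used here.
\<close>

definition path_space ::
    "real \<Rightarrow> (real \<Rightarrow> real^'n \<Rightarrow> (real^'n) \<times> real) \<Rightarrow> ('n::finite) path measure" where
  "path_space T \<psi> = restrict_space (\<Pi>\<^sub>M t\<in>{0..T}. state_space) (path_set T \<psi>)"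

definition Phi :: "real \<Rightarrow> real^'n \<Rightarrow> ('n::finite) path \<Rightarrow> 'n path" where
  "Phi T c \<omega> = (\<lambda>t\<in>{0..T}. if regime_of (\<omega> t) = Active then \<omega> t else ((c, ktime (\<omega> t)), Dead))"

definition law_at :: "('n::finite) path measure \<Rightarrow> real \<Rightarrow> 'n state measure" where
  "law_at P t = distr P state_space (\<lambda>\<omega>. \<omega> t)"

definition law_endpoints :: "('n::finite) path measure \<Rightarrow> real \<Rightarrow> ('n state \<times> 'n state) measure" where
  "law_endpoints P T = distr P (state_space \<Otimes>\<^sub>M state_space) (\<lambda>\<omega>. (\<omega> 0, \<omega> T))"

definition embed_active :: "(real^'n) measure \<Rightarrow> ('n::finite) state measure" where
  "embed_active \<mu> = distr \<mu> state_space (\<lambda>x. ((x, 0), Active))"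


section \<open>Relative entropy and conditional expectations given a value\<close>

text \<open>
  The library's \<^const>\<open>KL_divergence\<close> takes the reference measure first and is a Bochner integral,
  hence \<open>0\<close> if the integrand is not integrable. The negative part of \<open>ln (dQ/dP)\<close> is always
  \<open>Q\<close>-integrable for probability measures, so the expectation is \<open>\<infinity>\<close> in that case.
\<close>

definition KL :: "'a measure \<Rightarrow> 'a measure \<Rightarrow> ereal" where
  "KL Q P = (if absolutely_continuous P Q \<and> integrable Q (entropy_density (exp 1) P Q)
             then ereal (KL_divergence (exp 1) P Q) else \<infinity>)"

text \<open>
  \<open>cond_exp_given M N Z F y\<close> is (a version of) \<open>E[F | Z = y]\<close> for \<open>F \<ge> 0\<close>, in the same way as
  \<^const>\<open>nn_cond_exp\<close> is defined: the density of \<open>A \<mapsto> E[F; Z \<in> A]\<close> with respect to the law of \<open>Z\<close>.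
\<close>

definition cond_exp_given ::
    "'a measure \<Rightarrow> 'b measure \<Rightarrow> ('a \<Rightarrow> 'b) \<Rightarrow> ('a \<Rightarrow> ennreal) \<Rightarrow> 'b \<Rightarrow> ennreal" where
  "cond_exp_given M N Z F = RN_deriv (distr M N Z) (distr (density M F) N Z)"


section \<open>Coefficients\<close>

definition C_bounded :: "real \<Rightarrow> (real \<Rightarrow> real^'n::finite \<Rightarrow> real) \<Rightarrow> bool" where
  "C_bounded T g \<longleftrightarrow> continuous_on ({0..T} \<times> UNIV) (\<lambda>(t, x). g t x)
     \<and> (\<exists>C. \<forall>t\<in>{0..T}. \<forall>x. \<bar>g t x\<bar> \<le> C)"

definition C_uniform :: "real \<Rightarrow> (real \<Rightarrow> real^'n::finite \<Rightarrow> real) \<Rightarrow> bool" where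
  "C_uniform T g \<longleftrightarrow> uniformly_continuous_on ({0..T} \<times> UNIV) (\<lambda>(t, x). g t x)"

definition Holder :: "real \<Rightarrow> real \<Rightarrow> (real \<Rightarrow> real^'n::finite \<Rightarrow> real) \<Rightarrow> bool" where
  "Holder \<alpha> T g \<longleftrightarrow> (\<exists>C. \<forall>t\<in>{0..T}. \<forall>x y. \<bar>g t x - g t y\<bar> \<le> C * norm (x - y) powr \<alpha>)"

definition x_differentiable :: "real \<Rightarrow> (real \<Rightarrow> real^'n::finite \<Rightarrow> real) \<Rightarrow> bool" where
  "x_differentiable T g \<longleftrightarrow> (\<forall>t\<in>{0..T}. \<forall>x. g t differentiable (at x))"

definition partial :: "'n \<Rightarrow> (real^'n::finite \<Rightarrow> real) \<Rightarrow> real^'n \<Rightarrow> real" where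
  "partial i h x = frechet_derivative h (at x) (axis i 1)"

definition grad :: "(real^'n::finite \<Rightarrow> real) \<Rightarrow> real^'n \<Rightarrow> real^'n" where
  "grad h x = (\<chi> i. partial i h x)"

definition diffusion_matrix ::
    "(real \<Rightarrow> real^'n \<Rightarrow> real^'n^'n) \<Rightarrow> real \<Rightarrow> real^'n::finite \<Rightarrow> real^'n^'n" where
  "diffusion_matrix \<sigma> t x = \<sigma> t x ** transpose (\<sigma> t x)"

definition uniformly_elliptic ::
    "real \<Rightarrow> (real \<Rightarrow> real^'n::finite \<Rightarrow> real^'n^'n) \<Rightarrow> bool" where
  "uniformly_elliptic T a \<longleftrightarrow>
     (\<exists>\<kappa>>0. \<forall>t\<in>{0..T}. \<forall>x \<xi>. \<xi> \<bullet> (a t x *v \<xi>) \<ge> \<kappa> * (norm \<xi>)\<^sup>2)"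

definition assumption_C ::
    "real \<Rightarrow> (real \<Rightarrow> real^'n \<Rightarrow> real^'n) \<Rightarrow> (real \<Rightarrow> real^'n \<Rightarrow> real^'n^'n)
      \<Rightarrow> (real \<Rightarrow> real^'n::finite \<Rightarrow> real) \<Rightarrow> bool" where
  "assumption_C T b \<sigma> V \<longleftrightarrow> (\<exists>\<alpha>>0.
     (\<forall>m. let b\<^sub>m = (\<lambda>t x. b t x $ m) in
        C_bounded T b\<^sub>m \<and> Holder \<alpha> T b\<^sub>m \<and> x_differentiable T b\<^sub>m
        \<and> (\<forall>i. C_bounded T (\<lambda>t. partial i (b\<^sub>m t)) \<and> Holder \<alpha> T (\<lambda>t. partial i (b\<^sub>m t))))
   \<and> (\<forall>m n. let a\<^sub>m\<^sub>n = (\<lambda>t x. diffusion_matrix \<sigma> t x $ m $ n) in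
        C_bounded T a\<^sub>m\<^sub>n \<and> C_uniform T a\<^sub>m\<^sub>n \<and> x_differentiable T a\<^sub>m\<^sub>n
        \<and> (\<forall>i. C_bounded T (\<lambda>t. partial i (a\<^sub>m\<^sub>n t)) \<and> Holder \<alpha> T (\<lambda>t. partial i (a\<^sub>m\<^sub>n t))
             \<and> x_differentiable T (\<lambda>t. partial i (a\<^sub>m\<^sub>n t))
             \<and> (\<forall>j. C_bounded T (\<lambda>t. partial j (partial i (a\<^sub>m\<^sub>n t)))
                  \<and> Holder \<alpha> T (\<lambda>t. partial j (partial i (a\<^sub>m\<^sub>n t))))))
   \<and> uniformly_elliptic T (diffusion_matrix \<sigma>)
   \<and> C_bounded T V \<and> Holder \<alpha> T V
   \<and> (\<forall>t\<in>{0..T}. \<forall>x. 0 \<le> V t x) \<and> (\<exists>t\<in>{0..T}. \<exists>x. V t x \<noteq> 0))"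


section \<open>Brownian motion and the Ito integral\<close>

definition brownian_motion ::
    "'w measure \<Rightarrow> (real \<Rightarrow> 'w measure) \<Rightarrow> real \<Rightarrow> (real \<Rightarrow> 'w \<Rightarrow> real^'n::finite) \<Rightarrow> bool" where
  "brownian_motion M F T B \<longleftrightarrow>
     (AE z in M. B 0 z = 0) \<and> (AE z in M. continuous_on {0..T} (\<lambda>t. B t z))
   \<and> (\<forall>t\<in>{0..T}. B t \<in> borel_measurable (F t))
   \<and> (\<forall>s t. 0 \<le> s \<and> s < t \<and> t \<le> T \<longrightarrow>
        distributed M lborel (\<lambda>z. B t z - B s z)
          (\<lambda>x. ennreal (\<Prod>i\<in>UNIV. normal_density 0 (sqrt (t - s)) (x $ i)))
      \<and> prob_space.indep_set M (sets (F s))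
          (sets (vimage_algebra (space M) (\<lambda>z. B t z - B s z) borel)))"

text \<open>
  A simple process \<open>\<Sum>i<N. \<xi> i * indicator {p i<..p (Suc i)}\<close> with \<open>\<xi> i\<close> bounded and
  \<open>F (p i)\<close>-measurable, its integral, and the Ito integral of \<open>H\<close> as a continuous process which
  is the \<open>L\<^sup>2\<close>-limit of integrals of simple processes approximating \<open>H\<close>.
\<close>

definition simple_integrand ::
    "(real \<Rightarrow> 'w measure) \<Rightarrow> 'w measure \<Rightarrow> real \<Rightarrow> nat \<Rightarrow> (nat \<Rightarrow> real)
      \<Rightarrow> (nat \<Rightarrow> 'w \<Rightarrow> real^'n^'n::finite) \<Rightarrow> bool" where
  "simple_integrand F M T N p \<xi> \<longleftrightarrow> p 0 = 0 \<and> p N = T \<and> (\<forall>i<N. p i \<le> p (Suc i))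
     \<and> (\<forall>i<N. \<xi> i \<in> borel_measurable (F (p i)) \<and> (\<exists>C. \<forall>z\<in>space M. norm (\<xi> i z) \<le> C))"

definition simple_value ::
    "nat \<Rightarrow> (nat \<Rightarrow> real) \<Rightarrow> (nat \<Rightarrow> 'w \<Rightarrow> real^'n^'n::finite) \<Rightarrow> real \<Rightarrow> 'w \<Rightarrow> real^'n^'n" where
  "simple_value N p \<xi> t z = (\<Sum>i<N. indicat_real {p i<..p (Suc i)} t *\<^sub>R \<xi> i z)"

definition simple_integral ::
    "(real \<Rightarrow> 'w \<Rightarrow> real^'n) \<Rightarrow> nat \<Rightarrow> (nat \<Rightarrow> real) \<Rightarrow> (nat \<Rightarrow> 'w \<Rightarrow> real^'n^'n::finite)
      \<Rightarrow> real \<Rightarrow> 'w \<Rightarrow> real^'n" where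
  "simple_integral B N p \<xi> t z =
     (\<Sum>i<N. \<xi> i z *v (B (min (p (Suc i)) t) z - B (min (p i) t) z))"

definition ito_integral ::
    "'w measure \<Rightarrow> (real \<Rightarrow> 'w measure) \<Rightarrow> real \<Rightarrow> (real \<Rightarrow> 'w \<Rightarrow> real^'n)
      \<Rightarrow> (real \<Rightarrow> 'w \<Rightarrow> real^'n^'n) \<Rightarrow> (real \<Rightarrow> 'w \<Rightarrow> real^'n::finite) \<Rightarrow> bool" where
  "ito_integral M F T B H I \<longleftrightarrow>
     (AE z in M. continuous_on {0..T} (\<lambda>t. I t z)) \<and> (\<forall>t\<in>{0..T}. I t \<in> borel_measurable M)
   \<and> (\<exists>N p \<xi>. (\<forall>k. simple_integrand F M T (N k) (p k) (\<xi> k))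
        \<and> ((\<lambda>k. \<integral>\<^sup>+ z. (\<integral>\<^sup>+ t. ennreal ((norm (H t z - simple_value (N k) (p k) (\<xi> k) t z))\<^sup>2)
              * indicator {0..T} t \<partial>lborel) \<partial>M) \<longlonglongrightarrow> 0)
        \<and> (\<forall>t\<in>{0..T}. (\<lambda>k. \<integral>\<^sup>+ z.
              ennreal ((norm (I t z - simple_integral B (N k) (p k) (\<xi> k) t z))\<^sup>2) \<partial>M) \<longlonglongrightarrow> 0))"


section \<open>The reference measure\<close>

definition path_filtration ::
    "real \<Rightarrow> (real \<Rightarrow> real^'n \<Rightarrow> (real^'n) \<times> real) \<Rightarrow> real \<Rightarrow> ('n::finite) path measure" where
  "path_filtration T \<psi> t =
     vimage_algebra (path_set T \<psi>) (\<lambda>\<omega>. restrict \<omega> ({0..T} \<inter> {..t}))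
       (\<Pi>\<^sub>M s\<in>{0..T} \<inter> {..t}. state_space)"

definition strong_markov ::
    "real \<Rightarrow> (real \<Rightarrow> real^'n \<Rightarrow> (real^'n) \<times> real) \<Rightarrow> ('n::finite) path measure \<Rightarrow> bool" where
  "strong_markov T \<psi> R \<longleftrightarrow>
     (\<forall>S. stopping_time (path_filtration T \<psi>) S \<and> (\<forall>\<omega>\<in>path_set T \<psi>. 0 \<le> S \<omega> \<and> S \<omega> \<le> T) \<longrightarrow>
       (\<forall>u\<ge>0. \<forall>A\<in>sets state_space.
          AE \<omega> in R.
            real_cond_exp R (filtration.pre_sigma (path_set T \<psi>) (path_filtration T \<psi>) S)
              (\<lambda>\<omega>. indicat_real A (\<omega> (min (S \<omega> + u) T))) \<omega>
          = real_cond_exp R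
              (vimage_algebra (path_set T \<psi>) (\<lambda>\<omega>. (S \<omega>, \<omega> (S \<omega>))) (borel \<Otimes>\<^sub>M state_space))
              (\<lambda>\<omega>. indicat_real A (\<omega> (min (S \<omega> + u) T))) \<omega>))"

definition wiener_space :: "real \<Rightarrow> (real \<Rightarrow> real^'n::finite) measure" where
  "wiener_space T = restrict_space (\<Pi>\<^sub>M t\<in>{0..T}. borel) {w. continuous_on {0..T} w}"

definition joint_filtration ::
    "real \<Rightarrow> (('n::finite) path \<times> (real \<Rightarrow> real^'n)) measure \<Rightarrow> real
      \<Rightarrow> ('n path \<times> (real \<Rightarrow> real^'n)) measure" where
  "joint_filtration T M t =
     vimage_algebra (space M)
       (\<lambda>(\<omega>, w). (restrict \<omega> ({0..T} \<inter> {..t}), restrict w ({0..T} \<inter> {..t})))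
       ((\<Pi>\<^sub>M s\<in>{0..T} \<inter> {..t}. state_space) \<Otimes>\<^sub>M (\<Pi>\<^sub>M s\<in>{0..T} \<inter> {..t}. borel))"

text \<open>
  \<open>R\<close> is the law of a weak solution of the SDE with killing: a joint law \<open>M\<close> of the path and of a
  driving Brownian motion, both with respect to the filtration generated by the pair, such that
  the SDE holds in integrated form while the path is active (the integrand of the stochastic
  integral is set to \<open>0\<close> after killing), and such that the killing time has intensity \<open>V\<close>, i.e. the
  killing indicator minus its integrated rate is a martingale.
\<close>

definition sde_with_killing ::
    "real \<Rightarrow> (real \<Rightarrow> real^'n \<Rightarrow> real^'n) \<Rightarrow> (real \<Rightarrow> real^'n \<Rightarrow> real^'n^'n)
      \<Rightarrow> (real \<Rightarrow> real^'n \<Rightarrow> real) \<Rightarrow> (real \<Rightarrow> real^'n \<Rightarrow> (real^'n) \<times> real)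
      \<Rightarrow> ('n::finite) path measure \<Rightarrow> bool" where
  "sde_with_killing T b \<sigma> V \<psi> R \<longleftrightarrow>
     (\<lambda>(t, x). \<sigma> t x) \<in> borel_measurable (restrict_space borel ({0..T} \<times> UNIV)) \<and>
     (\<exists>(M :: ('n path \<times> (real \<Rightarrow> real^'n)) measure) I.
        prob_space M \<and> sets M = sets (path_space T \<psi> \<Otimes>\<^sub>M wiener_space T)
      \<and> distr M (path_space T \<psi>) fst = R
      \<and> brownian_motion M (joint_filtration T M) T (\<lambda>t z. snd z t)
      \<and> ito_integral M (joint_filtration T M) T (\<lambda>t z. snd z t)
          (\<lambda>t z. if regime_of (fst z t) = Active then \<sigma> t (pos (fst z t)) else 0) I
      \<and> (AE z in M. \<forall>t\<in>{0..T}. regime_of (fst z t) = Active \<longrightarrow>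
           pos (fst z t) = pos (fst z 0) + (LBINT s:{0..t}. b s (pos (fst z s))) + I t z)
      \<and> (let Q = (\<lambda>t z. (if regime_of (fst z t) = Dead then 1 else 0)
                   - (LBINT s:{0..t}. if regime_of (fst z s) = Active
                                      then V s (pos (fst z s)) else 0)) in
         \<forall>s t. 0 \<le> s \<and> s \<le> t \<and> t \<le> T \<longrightarrow>
           (AE z in M. real_cond_exp M (joint_filtration T M s) (Q t) z = Q s z)))"

text \<open>
  Conditional probabilities determine \<open>q t x s\<close> only for almost every \<open>x\<close>; the version is
  positive and sub-Markovian for every \<open>x\<close>.
\<close>

definition active_transition_density ::
    "real \<Rightarrow> ('n::finite) path measure \<Rightarrow> (real \<Rightarrow> real^'n \<Rightarrow> real \<Rightarrow> real^'n \<Rightarrow> real) \<Rightarrow> bool" where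
  "active_transition_density T R q \<longleftrightarrow>
     (\<lambda>(t, x, s, y). q t x s y)
        \<in> borel_measurable (restrict_space borel {(t, x, s, y). 0 \<le> t \<and> t < s \<and> s \<le> T})
   \<and> (\<forall>t s. 0 \<le> t \<and> t < s \<and> s \<le> T \<longrightarrow> (\<forall>x y. 0 < q t x s y)
        \<and> (\<forall>x. (\<integral>\<^sup>+ y. ennreal (q t x s y) \<partial>lborel) \<le> 1))
   \<and> (\<forall>t s. 0 \<le> t \<and> t < s \<and> s \<le> T \<longrightarrow> (\<forall>A\<in>sets borel.
        AE y in law_at R t. regime_of y = Active \<longrightarrow>
          cond_exp_given R state_space (\<lambda>\<omega>. \<omega> t)
            (indicator {\<omega>. regime_of (\<omega> s) = Active \<and> pos (\<omega> s) \<in> A}) y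
          = (\<integral>\<^sup>+ z. ennreal (q t (pos y) s z) * indicator A z \<partial>lborel)))"

text \<open>
  The conditional probability of being dead at time \<open>t + \<epsilon>\<close>, given the active state \<open>x\<close> at
  time \<open>t\<close>, is expressed through the transition density. By itself the limit would not exclude
  killing with positive probability at a fixed time; cf. the intensity in \<open>sde_with_killing\<close>.
\<close>

definition infinitesimal_killing_rate ::
    "real \<Rightarrow> (real \<Rightarrow> real^'n \<Rightarrow> real) \<Rightarrow> ('n::finite) path measure
      \<Rightarrow> (real \<Rightarrow> real^'n \<Rightarrow> real \<Rightarrow> real^'n \<Rightarrow> real) \<Rightarrow> bool" where
  "infinitesimal_killing_rate T V R q \<longleftrightarrow>
     (\<forall>t\<in>{0..<T}. AE y in law_at R t. regime_of y = Active \<longrightarrow>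
        ((\<lambda>\<epsilon>. (1 - (\<integral>z. q t (pos y) (t + \<epsilon>) z \<partial>lborel)) / \<epsilon>) \<longlongrightarrow> V t (pos y)) (at_right 0))"

definition reference_measure1 ::
    "real \<Rightarrow> (real \<Rightarrow> real^'n \<Rightarrow> real^'n) \<Rightarrow> (real \<Rightarrow> real^'n \<Rightarrow> real^'n^'n)
      \<Rightarrow> (real \<Rightarrow> real^'n \<Rightarrow> real) \<Rightarrow> (real^'n) measure
      \<Rightarrow> (real \<Rightarrow> real^'n \<Rightarrow> real \<Rightarrow> real^'n \<Rightarrow> real) \<Rightarrow> ('n::finite) path measure \<Rightarrow> bool" where
  "reference_measure1 T b \<sigma> V \<mu>\<^sub>0 q R \<longleftrightarrow>
     prob_space R \<and> sets R = sets (path_space T psi1)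
   \<and> law_at R 0 = embed_active \<mu>\<^sub>0
   \<and> strong_markov T psi1 R
   \<and> sde_with_killing T b \<sigma> V psi1 R
   \<and> active_transition_density T R q
   \<and> infinitesimal_killing_rate T V R q"


section \<open>The Schroedinger bridge problem\<close>

text \<open>
  The terminal law has density \<open>ra\<close> in the active regime (where \<open>\<tau> = 0\<close>) and, in the dead regime,
  density \<open>rd\<close> on \<open>\<real>\<^sup>d \<times> [0,T]\<close>, respectively on \<open>{c} \<times> [0,T]\<close>.
\<close>

definition terminal_law1 ::
    "real \<Rightarrow> ('n::finite) state measure \<Rightarrow> (real^'n \<Rightarrow> real) \<Rightarrow> ((real^'n) \<times> real \<Rightarrow> real) \<Rightarrow> bool"
  where
  "terminal_law1 T \<rho> ra rd \<longleftrightarrow>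
     prob_space \<rho> \<and> sets \<rho> = sets state_space
   \<and> ra \<in> borel_measurable borel \<and> (\<forall>x. 0 \<le> ra x)
   \<and> rd \<in> borel_measurable borel \<and> (\<forall>y. 0 \<le> rd y)
   \<and> (\<forall>A\<in>sets state_space. emeasure \<rho> A =
        (\<integral>\<^sup>+ x. ennreal (ra x) * indicator A ((x, 0), Active) \<partial>lborel)
      + (\<integral>\<^sup>+ y. ennreal (rd y) * indicator (UNIV \<times> {0..T}) y * indicator A (y, Dead) \<partial>lborel))"

definition terminal_law2 ::
    "real \<Rightarrow> real^'n \<Rightarrow> ('n::finite) state measure \<Rightarrow> (real^'n \<Rightarrow> real) \<Rightarrow> (real \<Rightarrow> real) \<Rightarrow> bool"
  where
  "terminal_law2 T c \<rho> ra rd \<longleftrightarrow>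
     prob_space \<rho> \<and> sets \<rho> = sets state_space
   \<and> ra \<in> borel_measurable borel \<and> (\<forall>x. 0 \<le> ra x)
   \<and> rd \<in> borel_measurable borel \<and> (\<forall>\<tau>. 0 \<le> rd \<tau>)
   \<and> (\<forall>A\<in>sets state_space. emeasure \<rho> A =
        (\<integral>\<^sup>+ x. ennreal (ra x) * indicator A ((x, 0), Active) \<partial>lborel)
      + (\<integral>\<^sup>+ \<tau>. ennreal (rd \<tau>) * indicator {0..T} \<tau> * indicator A ((c, \<tau>), Dead) \<partial>lborel))"

definition admissible ::
    "real \<Rightarrow> (real \<Rightarrow> real^'n \<Rightarrow> (real^'n) \<times> real) \<Rightarrow> (real^'n) measure \<Rightarrow> ('n::finite) state measure
      \<Rightarrow> 'n path measure \<Rightarrow> bool" where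
  "admissible T \<psi> \<rho>\<^sub>0 \<rho>\<^sub>T P \<longleftrightarrow>
     prob_space P \<and> sets P = sets (path_space T \<psi>)
   \<and> law_at P 0 = embed_active \<rho>\<^sub>0 \<and> law_at P T = \<rho>\<^sub>T"

definition schroedinger_bridge ::
    "real \<Rightarrow> (real \<Rightarrow> real^'n \<Rightarrow> (real^'n) \<times> real) \<Rightarrow> ('n::finite) path measure
      \<Rightarrow> (real^'n) measure \<Rightarrow> 'n state measure \<Rightarrow> 'n path measure \<Rightarrow> bool" where
  "schroedinger_bridge T \<psi> R \<rho>\<^sub>0 \<rho>\<^sub>T P \<longleftrightarrow>
     is_arg_min (\<lambda>Q. KL Q R) (admissible T \<psi> \<rho>\<^sub>0 \<rho>\<^sub>T) P"

definition static_system ::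
    "real \<Rightarrow> ('n::finite) path measure \<Rightarrow> (real^'n) measure \<Rightarrow> 'n state measure
      \<Rightarrow> ('n state \<Rightarrow> real) \<Rightarrow> ('n state \<Rightarrow> real) \<Rightarrow> bool" where
  "static_system T R \<rho>\<^sub>0 \<rho>\<^sub>T f g \<longleftrightarrow>
     f \<in> borel_measurable state_space \<and> g \<in> borel_measurable state_space
   \<and> (\<forall>y. 0 \<le> f y) \<and> (\<forall>y. 0 \<le> g y)
   \<and> (AE y in law_at R 0. regime_of y = Active \<longrightarrow>
        ennreal (f y) * cond_exp_given R state_space (\<lambda>\<omega>. \<omega> 0) (\<lambda>\<omega>. ennreal (g (\<omega> T))) y
        = RN_deriv (law_at R 0) (embed_active \<rho>\<^sub>0) y)
   \<and> (AE y in law_at R T.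
        ennreal (g y) * cond_exp_given R state_space (\<lambda>\<omega>. \<omega> T) (\<lambda>\<omega>. ennreal (f (\<omega> 0))) y
        = RN_deriv (law_at R T) \<rho>\<^sub>T y)"

definition unique_static_solution ::
    "real \<Rightarrow> ('n::finite) path measure \<Rightarrow> (real^'n) measure \<Rightarrow> 'n state measure
      \<Rightarrow> ('n state \<Rightarrow> real) \<Rightarrow> ('n state \<Rightarrow> real) \<Rightarrow> bool" where
  "unique_static_solution T R \<rho>\<^sub>0 \<rho>\<^sub>T f g \<longleftrightarrow>
     static_system T R \<rho>\<^sub>0 \<rho>\<^sub>T f g
   \<and> (\<forall>f' g'. static_system T R \<rho>\<^sub>0 \<rho>\<^sub>T f' g' \<longrightarrow>
        (\<exists>k>0. (AE y in law_at R 0. f' y = k * f y) \<and> (AE y in law_at R T. g' y = g y / k)))"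

definition assumption_A ::
    "real \<Rightarrow> ('n::finite) path measure \<Rightarrow> (real^'n) measure \<Rightarrow> 'n state measure \<Rightarrow> bool" where
  "assumption_A T R \<rho>\<^sub>0 \<rho>\<^sub>T \<longleftrightarrow> KL (embed_active \<rho>\<^sub>0 \<Otimes>\<^sub>M \<rho>\<^sub>T) (law_endpoints R T) < \<infinity>"

text \<open>Topological support, the set of regimes being discrete.\<close>

definition state_support :: "('n::finite) state measure \<Rightarrow> 'n state set" where
  "state_support N = {(y, i). \<forall>U. open U \<and> y \<in> U \<longrightarrow> emeasure N (U \<times> {i}) > 0}"

definition assumption_B ::
    "real \<Rightarrow> ('n::finite) path measure \<Rightarrow> (real^'n) measure
      \<Rightarrow> ('n state \<Rightarrow> real) \<Rightarrow> ('n state \<Rightarrow> real) \<Rightarrow> bool" where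
  "assumption_B T R \<mu>\<^sub>0 f g \<longleftrightarrow>
     (\<integral>\<^sup>+ x. ennreal (f ((x, 0), Active)) \<partial>\<mu>\<^sub>0) < \<infinity>
   \<and> (\<exists>C. \<forall>y\<in>state_support (law_at R T). g y \<le> C)"

text \<open>
  \<open>phi_active\<close> is \<open>\<phi>(t, x, Active)\<close> for \<open>t < T\<close>; all integrands are nonnegative, and the values are
  finite under boundedness of \<open>g\<close>.
\<close>

definition phi_active ::
    "real \<Rightarrow> (real \<Rightarrow> real^'n \<Rightarrow> real \<Rightarrow> real^'n \<Rightarrow> real) \<Rightarrow> (real \<Rightarrow> real^'n \<Rightarrow> real)
      \<Rightarrow> (real \<Rightarrow> real^'n \<Rightarrow> (real^'n) \<times> real) \<Rightarrow> (('n::finite) state \<Rightarrow> real)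
      \<Rightarrow> real \<Rightarrow> real^'n \<Rightarrow> real" where
  "phi_active T q V \<psi> g t x = enn2real (
     (\<integral>\<^sup>+ z. ennreal (q t x T z * g ((z, 0), Active)) \<partial>lborel)
   + (\<integral>\<^sup>+ z. (\<integral>\<^sup>+ r. ennreal (q t x r z * V r z * g (\<psi> r z, Dead)) * indicator {t<..T} r \<partial>lborel)
       \<partial>lborel))"

definition phi_dead :: "(('n::finite) state \<Rightarrow> real) \<Rightarrow> real \<Rightarrow> (real^'n) \<times> real \<Rightarrow> real" where
  "phi_dead g t y = g (y, Dead)"

definition bridge_drift ::
    "real \<Rightarrow> (real \<Rightarrow> real^'n \<Rightarrow> real^'n) \<Rightarrow> (real \<Rightarrow> real^'n \<Rightarrow> real^'n^'n)
      \<Rightarrow> (real \<Rightarrow> real^'n \<Rightarrow> real \<Rightarrow> real^'n \<Rightarrow> real) \<Rightarrow> (real \<Rightarrow> real^'n \<Rightarrow> real)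
      \<Rightarrow> (real \<Rightarrow> real^'n \<Rightarrow> (real^'n) \<times> real) \<Rightarrow> (('n::finite) state \<Rightarrow> real)
      \<Rightarrow> real \<Rightarrow> real^'n \<Rightarrow> real^'n" where
  "bridge_drift T b \<sigma> q V \<psi> g t x =
     b t x + diffusion_matrix \<sigma> t x *v grad (\<lambda>x. ln (phi_active T q V \<psi> g t x)) x"

definition bridge_killing_rate ::
    "real \<Rightarrow> (real \<Rightarrow> real^'n \<Rightarrow> real \<Rightarrow> real^'n \<Rightarrow> real) \<Rightarrow> (real \<Rightarrow> real^'n \<Rightarrow> real)
      \<Rightarrow> (real \<Rightarrow> real^'n \<Rightarrow> (real^'n) \<times> real) \<Rightarrow> (('n::finite) state \<Rightarrow> real)
      \<Rightarrow> real \<Rightarrow> real^'n \<Rightarrow> real" where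
  "bridge_killing_rate T q V \<psi> g t x =
     phi_dead g t (\<psi> t x) / phi_active T q V \<psi> g t x * V t x"


section \<open>Basic facts\<close>

lemma space_path_space: "space (path_space T \<psi>) = path_set T \<psi>"
  by (auto simp: path_space_def space_restrict_space space_PiM state_space_def space_pair_measure
      path_set_def PiE_def)

lemma filtration_path_filtration:
  fixes T :: real and \<psi> :: "real \<Rightarrow> real^'n::finite \<Rightarrow> (real^'n) \<times> real"
  shows "filtration (path_set T \<psi>) (path_filtration T \<psi>)"
proof
  show "space (path_filtration T \<psi> t) = path_set T \<psi>" for t
    by (simp add: path_filtration_def)
  fix s t :: real assume st: "s \<le> t"
  let ?I = "\<lambda>t. {0..T} \<inter> {..t}"
  have eq: "restrict \<omega> (?I s) = restrict (restrict \<omega> (?I t)) (?I s)" for \<omega> :: "'n path"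
    using st by (auto simp: restrict_def fun_eq_iff)
  have m1: "(\<lambda>\<omega>. restrict \<omega> (?I t)) \<in> path_filtration T \<psi> t \<rightarrow>\<^sub>M (\<Pi>\<^sub>M s\<in>?I t. state_space)"
    unfolding path_filtration_def
    by (rule measurable_vimage_algebra1)
       (auto simp: space_PiM state_space_def space_pair_measure)
  have m2: "(\<lambda>f. restrict f (?I s)) \<in> (\<Pi>\<^sub>M s\<in>?I t. state_space) \<rightarrow>\<^sub>M (\<Pi>\<^sub>M s\<in>?I s. state_space)"
    using st by (intro measurable_restrict_subset) auto
  have "(\<lambda>\<omega>. restrict \<omega> (?I s)) \<in> path_filtration T \<psi> t \<rightarrow>\<^sub>M (\<Pi>\<^sub>M s\<in>?I s. state_space)"
    by (subst eq) (rule measurable_compose[OF m1 m2])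
  then show "sets (path_filtration T \<psi> s) \<le> sets (path_filtration T \<psi> t)"
    unfolding path_filtration_def[of T \<psi> s]
    by (intro sets_image_in_sets) (simp_all add: path_filtration_def)
qed

lemma Phi_in_path_set:
  assumes "\<omega> \<in> path_set T psi1"
  shows "Phi T c \<omega> \<in> path_set T (psi2 c)"
proof -
  have ext: "Phi T c \<omega> \<in> extensional {0..T}" by (simp add: Phi_def)
  consider (alive) "\<forall>t\<in>{0..T}. regime_of (\<omega> t) = Active \<and> ktime (\<omega> t) = 0"
      "continuous_on {0..T} (\<lambda>t. pos (\<omega> t))"
    | (dead) K x where "K \<in> {0..T}" "\<forall>t\<in>{0..<K}. regime_of (\<omega> t) = Active \<and> ktime (\<omega> t) = 0"
      "continuous_on {0..<K} (\<lambda>t. pos (\<omega> t))"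
      "((\<lambda>t. pos (\<omega> t)) \<longlongrightarrow> x) (at K within {0..<K})" "\<forall>t\<in>{K..T}. \<omega> t = (psi1 K x, Dead)"
    using assms unfolding path_set_def by blast
  then show ?thesis
  proof cases
    case alive
    then have "continuous_on {0..T} (\<lambda>t. pos (Phi T c \<omega> t))"
      by (subst continuous_on_cong[OF refl, where g = "\<lambda>t. pos (\<omega> t)"]) (auto simp: Phi_def)
    then show ?thesis using alive ext by (auto simp: path_set_def Phi_def)
  next
    case dead
    have eq: "Phi T c \<omega> t = \<omega> t" if "t \<in> {0..<K}" for t
      using dead that by (auto simp: Phi_def)
    have "continuous_on {0..<K} (\<lambda>t. pos (Phi T c \<omega> t))"
      using dead(3) by (subst continuous_on_cong[OF refl, where g = "\<lambda>t. pos (\<omega> t)"]) (auto simp: eq)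
    moreover have "((\<lambda>t. pos (Phi T c \<omega> t)) \<longlongrightarrow> x) (at K within {0..<K})"
      using dead(4)
      by (rule Lim_transform_eventually) (auto simp: eventually_at_filter eq)
    moreover have "\<forall>t\<in>{K..T}. Phi T c \<omega> t = (psi2 c K x, Dead)"
      using dead by (auto simp: Phi_def psi1_def psi2_def)
    moreover have "\<forall>t\<in>{0..<K}. regime_of (Phi T c \<omega> t) = Active \<and> ktime (Phi T c \<omega> t) = 0"
      using dead(2) eq by simp
    ultimately show ?thesis
      using ext dead(1) unfolding path_set_def by blast
  qed
qed

lemma measurable_Phi: "Phi T c \<in> path_space T psi1 \<rightarrow>\<^sub>M path_space T (psi2 c)"
proof -
  have comp: "(\<lambda>\<omega>. \<omega> t) \<in> path_space T psi1 \<rightarrow>\<^sub>M state_space" if "t \<in> {0..T}" for t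
    unfolding path_space_def using that
    by (intro measurable_restrict_space1 measurable_component_singleton)
  have st: "(\<lambda>y. if regime_of y = Active then y else ((c, ktime y), Dead))
      \<in> state_space \<rightarrow>\<^sub>M state_space"
    unfolding state_space_def borel_prod[symmetric] by measurable
  have "(\<lambda>\<omega>. if regime_of (\<omega> t) = Active then \<omega> t else ((c, ktime (\<omega> t)), Dead))
      \<in> path_space T psi1 \<rightarrow>\<^sub>M state_space" if "t \<in> {0..T}" for t
    using measurable_compose[OF comp[OF that] st] .
  then have "Phi T c \<in> path_space T psi1 \<rightarrow>\<^sub>M (\<Pi>\<^sub>M t\<in>{0..T}. state_space)"
    unfolding Phi_def[abs_def] by (intro measurable_restrict)
  then show ?thesis
    unfolding path_space_def[of T "psi2 c"]
    by (intro measurable_restrict_space2) (auto simp: space_path_space intro: Phi_in_path_set)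
qed

end

theory Submission
  imports Defs
begin

text \<open>
  A path of Scenario (1) that starts active dies at the left limit of its active part, so it can be
  recovered from its collapsed version. Hence pushing \<open>P1\<close> forward along \<open>\<Phi>\<close> preserves the relative
  entropy, and the push-forward competes with \<open>P2\<close>. This gives the inequality, and strict
  convexity gives (i) \<open>\<longleftrightarrow>\<close> (ii).

  Each of (ii), (iii), (iv) says that \<open>(f2, g2 \<circ> collapse)\<close>, where \<open>collapse\<close> replaces the position of
  a dead state by \<open>c\<close>, represents \<open>P1\<close>, because a product density with the right marginals solves the static
  system and solutions are unique up to scaling. Then \<open>g1 = k * (g2 \<circ> collapse)\<close> almost everywhere
  for the terminal law. To compare the coefficients, this has to hold Lebesgue-almost everywhere on
  the active part and \<open>V\<close>-almost everywhere on the dead part. The former holds since \<open>q > 0\<close>;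
  the latter since the killing indicator minus its compensator is a martingale, so that the joint law
  of killing position and time is the mean of \<open>V(s, X\<^sub>s) ds\<close> along the active path.
\<close>

section \<open>Relative entropy and static systems\<close>

text \<open>Three obstacles shape the proof. Strict convexity says nothing when the minimal entropy
  is infinite; (A) removes this case, because the product of the two target marginals can be lifted
  to a path measure of the same entropy. Next, the position at death is a path evaluated at a random
  time, while the martingale hypothesis only speaks about fixed times. Both are handled with grids
  of countably many times: from the left to reach the position at death, from the right for joint
  measurability in time and path. The law of killing position and time then appears as a limit of
  sums of increments, tested against continuous functions with values in [0,1]. Finally,
  \<open>g1\<close> and \<open>g2\<close> are known only up to null sets of the terminal law. The
  drift contains them under integrals against \<open>q\<close>, which gives equality at every point;
  the killing rate contains a point value of the dead part, hence equality almost everywhere. (B) is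
  used for the drift: \<open>phi_active\<close> sends infinity to 0, and only for finite positive
  values do proportional functions have logarithms that differ by a constant.\<close>

lemma xlnx_tangent:
  fixes u m :: real
  assumes "0 \<le> u" "0 < m"
  shows "u * ln m + u - m \<le> u * ln u"
    and "u * ln m + u - m = u * ln u \<Longrightarrow> u = m"
proof -
  have *: "u * ln m + u - m \<le> u * ln u \<and> (u * ln m + u - m = u * ln u \<longrightarrow> u = m)"
  proof (cases "u = 0")
    \<comment> \<open>For \<open>u = 0\<close> the product \<open>u * ln u\<close> is 0, as the
      usual convention wants, and the tangent value \<open>- m\<close> is strictly below it.\<close>
    case True then show ?thesis using assms by auto
  next
    case False
    then have u: "0 < u" using assms by simp
    have l: "ln (m / u) = ln m - ln u" using u assms by (simp add: ln_div)
    have "ln (m / u) \<le> m / u - 1" using u assms by (intro ln_le_minus_one) simp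
    then have "u * ln (m / u) \<le> u * (m / u - 1)" using u by (intro mult_left_mono) auto
    then have le: "u * ln m - u * ln u \<le> m - u" using u l by (simp add: right_diff_distrib)
    have "u = m" if "u * ln m + u - m = u * ln u"
    proof -
      have "u * ln (m / u) = u * (m / u - 1)" using that l u by (simp add: right_diff_distrib)
      then have "ln (m / u) = m / u - 1" using u by simp
      then have "m / u = 1" using u assms by (intro ln_eq_minus_one) auto
      then show ?thesis using u by simp
    qed
    then show ?thesis using le by auto
  qed
  then show "u * ln m + u - m \<le> u * ln u" "u * ln m + u - m = u * ln u \<Longrightarrow> u = m" by auto
qed

text \<open>The tangent of \<open>x * ln x\<close> at the midpoint, evaluated at \<open>u\<close>
  and at \<open>v\<close>, sums to twice the midpoint value. So convexity is the sum of two tangent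
  bounds, and equality makes both of them tight, which puts \<open>u\<close> and \<open>v\<close> at
  the midpoint.\<close>

lemma xlnx_midpoint:
  fixes u v :: real
  assumes "0 \<le> u" "0 \<le> v"
  shows "2 * ((u + v) / 2 * ln ((u + v) / 2)) \<le> u * ln u + v * ln v"
    and "2 * ((u + v) / 2 * ln ((u + v) / 2)) = u * ln u + v * ln v \<Longrightarrow> u = v"
proof -
  define m where "m = (u + v) / 2"
  have uv: "u + v = 2 * m" by (simp add: m_def)
  have *: "2 * (m * ln m) \<le> u * ln u + v * ln v
    \<and> (2 * (m * ln m) = u * ln u + v * ln v \<longrightarrow> u = v)"
  proof (cases "m = 0")
    case True
    then have "u = 0" "v = 0" using assms uv by linarith+
    then show ?thesis using True by simp
  next
    case False
    then have m: "0 < m" using assms by (simp add: m_def)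
    have e: "(u * ln m + u - m) + (v * ln m + v - m) = 2 * (m * ln m)"
    proof -
      have "(u * ln m + u - m) + (v * ln m + v - m) = (u + v) * ln m + (u + v) - 2 * m"
        by (simp add: algebra_simps)
      then show ?thesis using uv by simp
    qed
    note a = xlnx_tangent[OF assms(1) m] and b = xlnx_tangent[OF assms(2) m]
    have "u = v" if "2 * (m * ln m) = u * ln u + v * ln v"
    proof -
      have "u * ln m + u - m = u * ln u" "v * ln m + v - m = v * ln v"
        using that e a(1) b(1) by linarith+
      then show ?thesis using a(2) b(2) by simp
    qed
    then show ?thesis using e a(1) b(1) by linarith
  qed
  then show "2 * ((u + v) / 2 * ln ((u + v) / 2)) \<le> u * ln u + v * ln v"
    "2 * ((u + v) / 2 * ln ((u + v) / 2)) = u * ln u + v * ln v \<Longrightarrow> u = v"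
    unfolding m_def by auto
qed

text \<open>Turns entropy into an integral over the reference measure, where densities can be
  compared pointwise. Points with \<open>f x = 0\<close> are null for the density measure and
  contribute 0 to the integral. \<open>f\<close> is not assumed to be normalised, so the formula
  also serves for midpoints before their mass is known.\<close>

lemma KL_real_density:
  fixes f :: "'a \<Rightarrow> real"
  assumes "prob_space M" and f[measurable]: "f \<in> borel_measurable M" and f0: "\<And>x. 0 \<le> f x"
  shows "KL (density M (\<lambda>x. ennreal (f x))) M
    = (if integrable M (\<lambda>x. f x * ln (f x)) then ereal (\<integral>x. f x * ln (f x) \<partial>M) else \<infinity>)"
proof -
  interpret prob_space M by fact
  let ?N = "density M (\<lambda>x. ennreal (f x))"
  have ac: "absolutely_continuous M ?N"
    by (intro absolutely_continuousI_density) simp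
  have RN: "AE x in M. ennreal (f x) = RN_deriv M ?N x"
    by (rule RN_deriv_unique) simp_all
  then have ed: "AE x in ?N. entropy_density (exp 1) M ?N x = ln (f x)"
    using f0 by (subst AE_density)
      (auto simp: entropy_density_def log_def elim!: eventually_mono dest: sym)
  have m: "entropy_density (exp 1) M ?N \<in> borel_measurable ?N"
    by simp
  have "integrable ?N (entropy_density (exp 1) M ?N) \<longleftrightarrow> integrable ?N (\<lambda>x. ln (f x))"
    using m ed by (intro integrable_cong_AE) auto
  also have "\<dots> \<longleftrightarrow> integrable M (\<lambda>x. f x * ln (f x))"
    using f0 by (subst integrable_density) auto
  finally have i: "integrable ?N (entropy_density (exp 1) M ?N)
    \<longleftrightarrow> integrable M (\<lambda>x. f x * ln (f x))" .
  have "KL_divergence (exp 1) M ?N = (\<integral>x. ln (f x) \<partial>?N)"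
    unfolding KL_divergence_def using m ed by (intro integral_cong_AE) auto
  also have "\<dots> = (\<integral>x. f x * ln (f x) \<partial>M)"
    using f0 by (subst integral_density) auto
  finally show ?thesis using ac i by (simp add: KL_def)
qed

text \<open>If the density factors through \<open>Z\<close>, both entropies are the integral of
  \<open>F * ln F\<close> over the law of \<open>Z\<close>. Applied with \<open>Z\<close> the
  collapsing map, and with \<open>Z\<close> the pair of endpoints.\<close>

lemma KL_density_comp:
  fixes F :: "'b \<Rightarrow> real"
  assumes M: "prob_space M" and Z[measurable]: "Z \<in> M \<rightarrow>\<^sub>M N"
    and F[measurable]: "F \<in> borel_measurable N" and F0: "\<And>y. 0 \<le> F y"
  shows "KL (density M (\<lambda>x. ennreal (F (Z x)))) M
    = KL (density (distr M N Z) (\<lambda>y. ennreal (F y))) (distr M N Z)"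
proof -
  have D: "prob_space (distr M N Z)" using M Z by (rule prob_space.prob_space_distr)
  show ?thesis
    using F0 by (subst KL_real_density[OF M], simp, simp, subst KL_real_density[OF D], simp, simp,
        subst integrable_distr_eq[OF Z], simp, subst integral_distr[OF Z], simp, simp)
qed

text \<open>The convexity gap of \<open>u * ln u\<close> at the midpoint is nonnegative, and
  minimality makes its integral nonpositive. It therefore vanishes almost everywhere, and strict
  convexity gives \<open>f = g\<close>. Finite entropy is what allows the three integrals to be
  subtracted.\<close>

lemma KL_midpoint_unique:
  fixes f g :: "'a \<Rightarrow> real"
  assumes M: "prob_space M"
    and f[measurable]: "f \<in> borel_measurable M" and f0: "\<And>x. 0 \<le> f x"
    and g[measurable]: "g \<in> borel_measurable M" and g0: "\<And>x. 0 \<le> g x"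
    and eq: "KL (density M (\<lambda>x. ennreal (f x))) M = KL (density M (\<lambda>x. ennreal (g x))) M"
    and fin: "KL (density M (\<lambda>x. ennreal (g x))) M < \<infinity>"
    and min: "KL (density M (\<lambda>x. ennreal (g x))) M
      \<le> KL (density M (\<lambda>x. ennreal ((f x + g x) / 2))) M"
  shows "AE x in M. f x = g x"
proof -
  interpret prob_space M by fact
  define \<phi> where "\<phi> u = u * ln u" for u :: real
  have h0: "0 \<le> (f x + g x) / 2" for x using f0[of x] g0[of x] by simp
  have \<phi>_meas[measurable]: "\<phi> \<in> borel_measurable borel" unfolding \<phi>_def by measurable
  have ig: "integrable M (\<lambda>x. \<phi> (g x))"
    using fin KL_real_density[OF M g g0] by (auto simp: \<phi>_def split: if_splits)
  have "KL (density M (\<lambda>x. ennreal (f x))) M < \<infinity>" using fin eq by simp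
  then have "integrable M (\<lambda>x. \<phi> (f x))"
    using KL_real_density[OF M f f0] by (auto simp: \<phi>_def split: if_splits)
  note if' = this
  have low: "-1 \<le> \<phi> u" if "0 \<le> u" for u
    using xlnx_tangent(1)[of u 1] that by (simp add: \<phi>_def)
  have mid: "2 * \<phi> ((f x + g x) / 2) \<le> \<phi> (f x) + \<phi> (g x)" for x
    using xlnx_midpoint(1)[OF f0 g0] by (simp add: \<phi>_def)
  \<comment> \<open>The midpoint value lies between the lower bound -1 and half the sum of the two
    endpoint values, so it inherits integrability.\<close>
  have ih: "integrable M (\<lambda>x. \<phi> ((f x + g x) / 2))"
  proof (rule Bochner_Integration.integrable_bound)
    show "integrable M (\<lambda>x. \<bar>\<phi> (f x)\<bar> + \<bar>\<phi> (g x)\<bar> + 1)" using ig if' by auto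
    show "AE x in M. norm (\<phi> ((f x + g x) / 2)) \<le> norm (\<bar>\<phi> (f x)\<bar> + \<bar>\<phi> (g x)\<bar> + 1)"
    proof (rule AE_I2)
      fix x
      show "norm (\<phi> ((f x + g x) / 2)) \<le> norm (\<bar>\<phi> (f x)\<bar> + \<bar>\<phi> (g x)\<bar> + 1)"
        using low[OF h0[of x]] mid[of x] unfolding real_norm_def by arith
    qed
  qed simp
  have e1: "(\<integral>x. \<phi> (f x) \<partial>M) = (\<integral>x. \<phi> (g x) \<partial>M)"
    using eq if' ig KL_real_density[OF M f f0] KL_real_density[OF M g g0] by (simp add: \<phi>_def)
  have e2: "(\<integral>x. \<phi> (g x) \<partial>M) \<le> (\<integral>x. \<phi> ((f x + g x) / 2) \<partial>M)"
    using min ih ig KL_real_density[OF M g g0] KL_real_density[OF M _ h0] by (simp add: \<phi>_def)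
  let ?d = "\<lambda>x. \<phi> (f x) + \<phi> (g x) - 2 * \<phi> ((f x + g x) / 2)"
  have di: "integrable M ?d" using ih ig if' by auto
  have "(\<integral>x. ?d x \<partial>M) \<le> 0" using e1 e2 ih ig if' by simp
  moreover have "0 \<le> (\<integral>x. ?d x \<partial>M)" using mid by (intro integral_nonneg_AE) (auto simp: )
  ultimately have "(\<integral>x. ?d x \<partial>M) = 0" by simp
  then have "AE x in M. ?d x = 0"
    using mid di by (subst (asm) integral_nonneg_eq_0_iff_AE) auto
  then show ?thesis
    using xlnx_midpoint(2)[OF f0 g0] by (auto simp: \<phi>_def elim!: eventually_mono)
qed

text \<open>"Taking out what is known", for measures: the image under \<open>Y\<close> of the
  measure with density \<open>G\<close> has \<open>cond_exp_given\<close> as its density relative to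
  the law of \<open>Y\<close>, and a factor \<open>f (Y \<omega>)\<close> is unaffected by passing
  to the image.\<close>

lemma distr_density_comp_mult:
  assumes R: "prob_space R" and Y[measurable]: "Y \<in> R \<rightarrow>\<^sub>M S"
    and f[measurable]: "f \<in> borel_measurable S" and G[measurable]: "G \<in> borel_measurable R"
  shows "distr (density R (\<lambda>\<omega>. f (Y \<omega>) * G \<omega>)) S Y
    = density (distr R S Y) (\<lambda>y. f y * cond_exp_given R S Y G y)"
proof -
  interpret D: prob_space "distr R S Y" using R Y by (rule prob_space.prob_space_distr)
  \<comment> \<open>\<open>RN_deriv\<close> is a genuine density only under absolute continuity; a
    null set of the law of \<open>Y\<close> pulls back to a null set of \<open>R\<close>, hence of
    any density over \<open>R\<close>.\<close>
  have ac: "absolutely_continuous (distr R S Y) (distr (density R G) S Y)"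
    unfolding absolutely_continuous_def
  proof
    fix A assume "A \<in> null_sets (distr R S Y)"
    then have A: "A \<in> sets S" and z: "Y -` A \<inter> space R \<in> null_sets R"
      by (auto simp: null_sets_def emeasure_distr)
    have "Y -` A \<inter> space R \<in> null_sets (density R G)"
      using z by (metis G absolutely_continuousI_density absolutely_continuous_def subsetD)
    then show "A \<in> null_sets (distr (density R G) S Y)"
      using A by (auto simp: null_sets_def emeasure_distr)
  qed
  have c[measurable]: "cond_exp_given R S Y G \<in> borel_measurable S"
    unfolding cond_exp_given_def by simp
  have e: "density (distr R S Y) (cond_exp_given R S Y G) = distr (density R G) S Y"
    unfolding cond_exp_given_def by (rule D.density_RN_deriv[OF ac]) simp
  have "density (distr R S Y) (\<lambda>y. f y * cond_exp_given R S Y G y)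
      = density (distr (density R G) S Y) f"
    unfolding e[symmetric] by (subst density_density_eq) (auto simp: mult.commute)
  also have "\<dots> = distr (density (density R G) (\<lambda>\<omega>. f (Y \<omega>))) S Y"
    by (subst density_distr) auto
  also have "density (density R G) (\<lambda>\<omega>. f (Y \<omega>)) = density R (\<lambda>\<omega>. f (Y \<omega>) * G \<omega>)"
    by (subst density_density_eq) (auto simp: mult.commute)
  finally show ?thesis ..
qed

text \<open>Uniqueness of the Radon-Nikodym derivative turns the preceding identity of measures into
  the almost sure equation that occurs in the static system.\<close>

lemma AE_distr_density_comp_mult:
  assumes R: "prob_space R" and Y[measurable]: "Y \<in> R \<rightarrow>\<^sub>M S"
    and f[measurable]: "f \<in> borel_measurable S" and G[measurable]: "G \<in> borel_measurable R"
    and \<nu>: "distr (density R (\<lambda>\<omega>. f (Y \<omega>) * G \<omega>)) S Y = \<nu>"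
  shows "AE y in distr R S Y. f y * cond_exp_given R S Y G y = RN_deriv (distr R S Y) \<nu> y"
proof -
  interpret D: prob_space "distr R S Y" using R Y by (rule prob_space.prob_space_distr)
  have c[measurable]: "cond_exp_given R S Y G \<in> borel_measurable S"
    unfolding cond_exp_given_def by simp
  show ?thesis
    by (rule D.RN_deriv_unique)
      (auto simp: distr_density_comp_mult[OF R Y f G, symmetric] \<nu>)
qed

section \<open>Product densities with prescribed marginals\<close>

lemma measurable_coordinate:
  "t \<in> {0..T} \<Longrightarrow> (\<lambda>\<omega>. \<omega> t) \<in> path_space T \<psi> \<rightarrow>\<^sub>M state_space"
  unfolding path_space_def by (intro measurable_restrict_space1 measurable_component_singleton)

text \<open>Each equation of the system encodes one marginal: conditioning on one endpoint takes its
  own factor out and integrates the other factor.\<close>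

lemma static_system_of_marginals:
  fixes R :: "('n::finite) path measure"
  assumes R: "prob_space R" and sR: "sets R = sets (path_space T \<psi>)" and T: "0 < T"
    and f[measurable]: "f \<in> borel_measurable state_space" and f0: "\<And>y. 0 \<le> f y"
    and g[measurable]: "g \<in> borel_measurable state_space" and g0: "\<And>y. 0 \<le> g y"
    and m0: "law_at (density R (\<lambda>\<omega>. ennreal (f (\<omega> 0) * g (\<omega> T)))) 0 = embed_active \<rho>\<^sub>0"
    and mT: "law_at (density R (\<lambda>\<omega>. ennreal (f (\<omega> 0) * g (\<omega> T)))) T = \<rho>\<^sub>T"
  shows "static_system T R \<rho>\<^sub>0 \<rho>\<^sub>T f g"
proof -
  have c0[measurable]: "(\<lambda>\<omega>. \<omega> 0) \<in> R \<rightarrow>\<^sub>M state_space"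
    using T by (subst measurable_cong_sets[OF sR refl]) (auto intro: measurable_coordinate)
  have cT[measurable]: "(\<lambda>\<omega>. \<omega> T) \<in> R \<rightarrow>\<^sub>M state_space"
    using T by (subst measurable_cong_sets[OF sR refl]) (auto intro: measurable_coordinate)
  have "AE y in law_at R 0. ennreal (f y)
      * cond_exp_given R state_space (\<lambda>\<omega>. \<omega> 0) (\<lambda>\<omega>. ennreal (g (\<omega> T))) y
      = RN_deriv (law_at R 0) (embed_active \<rho>\<^sub>0) y"
    unfolding law_at_def using m0 f0 g0
    by (intro AE_distr_density_comp_mult[OF R c0]) (auto simp: law_at_def ennreal_mult)
  moreover have "AE y in law_at R T. ennreal (g y)
      * cond_exp_given R state_space (\<lambda>\<omega>. \<omega> T) (\<lambda>\<omega>. ennreal (f (\<omega> 0))) y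
      = RN_deriv (law_at R T) \<rho>\<^sub>T y"
    unfolding law_at_def using mT f0 g0
    by (intro AE_distr_density_comp_mult[OF R cT]) (auto simp: law_at_def ennreal_mult mult.commute)
  ultimately show ?thesis
    using f g f0 g0 by (auto simp: static_system_def)
qed

section \<open>Recovering a path from its collapsed version\<close>

lemma measurable_pos [measurable]: "(\<lambda>y. pos y) \<in> state_space \<rightarrow>\<^sub>M borel"
  unfolding state_space_def borel_prod[symmetric] by measurable

lemma measurable_ktime [measurable]: "(\<lambda>y. ktime y) \<in> state_space \<rightarrow>\<^sub>M borel"
  unfolding state_space_def borel_prod[symmetric] by measurable

lemma measurable_regime_of [measurable]: "(\<lambda>y. regime_of y) \<in> state_space \<rightarrow>\<^sub>M count_space UNIV"
  unfolding state_space_def by measurable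

lemma measurable_stateI:
  assumes "f \<in> M \<rightarrow>\<^sub>M borel" "g \<in> M \<rightarrow>\<^sub>M borel" "h \<in> M \<rightarrow>\<^sub>M count_space UNIV"
  shows "(\<lambda>x. ((f x, g x), h x)) \<in> M \<rightarrow>\<^sub>M state_space"
  using assms unfolding state_space_def borel_prod[symmetric] by measurable

lemma space_state_space [simp]: "space state_space = UNIV"
  by (simp add: state_space_def space_pair_measure)

lemma sets_regime_of [measurable]: "{y. regime_of y = r} \<in> sets state_space"
  using measurable_sets[OF measurable_regime_of, of "{r}"] by (simp add: vimage_def)

definition collapse :: "real^'n \<Rightarrow> ('n::finite) state \<Rightarrow> 'n state" where
  "collapse c y = (if regime_of y = Active then y else ((c, ktime y), Dead))"

lemma measurable_collapse [measurable]: "collapse c \<in> state_space \<rightarrow>\<^sub>M state_space"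
  unfolding collapse_def[abs_def]
  by (intro measurable_If measurable_ident_sets measurable_stateI) simp_all

lemma Phi_apply: "t \<in> {0..T} \<Longrightarrow> Phi T c \<omega> t = collapse c (\<omega> t)"
  by (cases "regime_of (\<omega> t)") (auto simp: Phi_def collapse_def)

lemma regime_of_collapse [simp]: "regime_of (collapse c y) = regime_of y"
  by (cases "regime_of y") (auto simp: collapse_def)

lemma ktime_collapse [simp]: "ktime (collapse c y) = ktime y"
  by (auto simp: collapse_def)

lemma law_at_distr_Phi:
  assumes sP: "sets P = sets (path_space T psi1)" and t: "t \<in> {0..T}"
  shows "law_at (distr P (path_space T (psi2 c)) (Phi T c)) t
    = distr (law_at P t) state_space (collapse c)"
proof -
  have 1: "Phi T c \<in> P \<rightarrow>\<^sub>M path_space T (psi2 c)"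
    by (subst measurable_cong_sets[OF sP refl]) (rule measurable_Phi)
  have 2: "(\<lambda>\<omega>. \<omega> t) \<in> P \<rightarrow>\<^sub>M state_space"
    by (subst measurable_cong_sets[OF sP refl]) (rule measurable_coordinate[OF t])
  show ?thesis
    unfolding law_at_def using t
    by (subst distr_distr[OF measurable_coordinate[OF t] 1], subst distr_distr[OF measurable_collapse 2])
      (simp add: comp_def Phi_apply)
qed

lemma AE_embed_active:
  assumes "sets \<mu> = sets borel"
  shows "AE y in embed_active \<mu>. regime_of y = Active"
proof -
  have "(\<lambda>x. ((x, 0), Active)) \<in> \<mu> \<rightarrow>\<^sub>M state_space"
    by (intro measurable_stateI) (simp_all add: measurable_cong_sets[OF assms refl])
  then show ?thesis unfolding embed_active_def by (subst AE_distr_iff) simp_all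
qed

lemma AE_start_active:
  fixes R :: "('n::finite) path measure"
  assumes sR: "sets R = sets (path_space T \<psi>)" and T: "0 < T"
    and l: "law_at R 0 = embed_active \<mu>" and s: "sets \<mu> = sets borel"
  shows "AE \<omega> in R. regime_of (\<omega> 0) = Active"
proof -
  have c0[measurable]: "(\<lambda>\<omega>. \<omega> 0) \<in> R \<rightarrow>\<^sub>M state_space"
    using T by (subst measurable_cong_sets[OF sR refl]) (auto intro: measurable_coordinate)
  have "AE y in law_at R 0. regime_of y = Active" unfolding l by (rule AE_embed_active[OF s])
  then show ?thesis unfolding law_at_def by (rule AE_distrD[OF c0])
qed

lemma distr_embed_active_collapse:
  assumes s: "sets \<mu> = sets borel"
  shows "distr (embed_active \<mu>) state_space (collapse c) = embed_active \<mu>"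
proof -
  have "(\<lambda>x. ((x, 0), Active)) \<in> \<mu> \<rightarrow>\<^sub>M state_space"
    by (intro measurable_stateI) (simp_all add: measurable_cong_sets[OF assms refl])
  then show ?thesis
    unfolding embed_active_def by (simp add: distr_distr comp_def collapse_def)
qed

text \<open>Collapsing keeps the active part and integrates the position out of the dead part, which
  is exactly how the two targets are related. Hence a push-forward from Scenario (1) meets the
  terminal constraint of Scenario (2).\<close>

lemma distr_terminal_law_collapse:
  fixes c :: "real^'n::finite"
  assumes t1: "terminal_law1 T \<rho>1 ra1 rd1" and t2: "terminal_law2 T c \<rho>2 ra2 rd2"
    and ra: "\<forall>x. ra1 x = ra2 x"
    and rd: "\<forall>\<tau>\<in>{0..T}. (\<integral>\<^sup>+ x. ennreal (rd1 (x, \<tau>)) \<partial>lborel) = ennreal (rd2 \<tau>)"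
  shows "distr \<rho>1 state_space (collapse c) = \<rho>2"
proof (rule measure_eqI)
  show "sets (distr \<rho>1 state_space (collapse c)) = sets \<rho>2"
    using t2 by (simp add: terminal_law2_def)
  fix A assume "A \<in> sets (distr \<rho>1 state_space (collapse c))"
  then have A[measurable]: "A \<in> sets state_space" by simp
  have s1: "sets \<rho>1 = sets state_space" using t1 by (simp add: terminal_law1_def)
  have mc: "collapse c \<in> \<rho>1 \<rightarrow>\<^sub>M state_space"
    by (subst measurable_cong_sets[OF s1 refl]) simp
  let ?B = "collapse c -` A"
  have B: "?B \<in> sets state_space"
    using measurable_sets[OF measurable_collapse A] by simp
  have "emeasure (distr \<rho>1 state_space (collapse c)) A = emeasure \<rho>1 ?B"
    using mc by (subst emeasure_distr) (simp_all add: sets_eq_imp_space_eq[OF s1])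
  also have "\<dots> = (\<integral>\<^sup>+ x. ennreal (ra1 x) * indicator ?B ((x, 0), Active) \<partial>lborel)
      + (\<integral>\<^sup>+ y. ennreal (rd1 y) * indicator (UNIV \<times> {0..T}) y * indicator ?B (y, Dead) \<partial>lborel)"
    using t1 B unfolding terminal_law1_def by blast
  also have "(\<integral>\<^sup>+ x. ennreal (ra1 x) * indicator ?B ((x, 0), Active) \<partial>lborel)
      = (\<integral>\<^sup>+ x. ennreal (ra2 x) * indicator A ((x, 0), Active) \<partial>lborel)"
    using ra by (intro nn_integral_cong) (auto simp: indicator_def collapse_def)
  also have "(\<integral>\<^sup>+ y. ennreal (rd1 y) * indicator (UNIV \<times> {0..T}) y * indicator ?B (y, Dead) \<partial>lborel)
      = (\<integral>\<^sup>+ \<tau>. ennreal (rd2 \<tau>) * indicator {0..T} \<tau> * indicator A ((c, \<tau>), Dead) \<partial>lborel)"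
  proof -
    have [measurable]: "rd1 \<in> borel_measurable borel" using t1 by (simp add: terminal_law1_def)
    have [measurable]: "(\<lambda>\<tau>. ((c, \<tau>), Dead)) \<in> borel \<rightarrow>\<^sub>M state_space"
      by (intro measurable_stateI) simp_all
    have [measurable]: "(\<lambda>\<tau>. indicator A ((c, \<tau>), Dead) :: ennreal) \<in> borel_measurable borel"
      by measurable
    have [measurable]: "(\<lambda>y. indicator A ((c, snd y), Dead) :: ennreal) \<in> borel_measurable (borel :: ((real^'n) \<times> real) measure)"
      unfolding borel_prod[symmetric] by measurable
    have [measurable]: "rd1 \<in> borel_measurable (borel \<Otimes>\<^sub>M borel)"
      unfolding borel_prod by simp
    have "(\<integral>\<^sup>+ y. ennreal (rd1 y) * indicator (UNIV \<times> {0..T}) y * indicator ?B (y, Dead) \<partial>lborel)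
      = (\<integral>\<^sup>+ y. ennreal (rd1 y) * (indicator {0..T} (snd y) * indicator A ((c, snd y), Dead))
          \<partial>(lborel \<Otimes>\<^sub>M lborel))"
      unfolding lborel_prod
      by (intro nn_integral_cong) (auto simp: indicator_def collapse_def)
    \<comment> \<open>Tonelli with the killing time outside, so that the inner integral over
      positions is the one in the hypothesis \<open>rd\<close>.\<close>
    also have "\<dots> = (\<integral>\<^sup>+ \<tau>. (\<integral>\<^sup>+ x. ennreal (rd1 (x, \<tau>))
        * (indicator {0..T} \<tau> * indicator A ((c, \<tau>), Dead)) \<partial>lborel) \<partial>lborel)"
      by (subst lborel_pair.nn_integral_snd[symmetric]) simp_all
    also have "\<dots> = (\<integral>\<^sup>+ \<tau>. (\<integral>\<^sup>+ x. ennreal (rd1 (x, \<tau>)) \<partial>lborel)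
        * (indicator {0..T} \<tau> * indicator A ((c, \<tau>), Dead)) \<partial>lborel)"
      by (intro nn_integral_cong nn_integral_multc) simp
    also have "\<dots> = (\<integral>\<^sup>+ \<tau>. ennreal (rd2 \<tau>) * indicator {0..T} \<tau>
        * indicator A ((c, \<tau>), Dead) \<partial>lborel)"
      using rd by (intro nn_integral_cong) (auto simp: indicator_def)
    finally show ?thesis .
  qed
  also have "(\<integral>\<^sup>+ x. ennreal (ra2 x) * indicator A ((x, 0), Active) \<partial>lborel)
      + (\<integral>\<^sup>+ \<tau>. ennreal (rd2 \<tau>) * indicator {0..T} \<tau> * indicator A ((c, \<tau>), Dead) \<partial>lborel)
      = emeasure \<rho>2 A"
    using t2 A unfolding terminal_law2_def by simp
  finally show "emeasure (distr \<rho>1 state_space (collapse c)) A = emeasure \<rho>2 A" .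
qed

section \<open>A time grid from the left, and the recovered terminal state\<close>

text \<open>The last multiple of \<open>T / (n + 1)\<close> strictly before \<open>s\<close>, clipped to \<open>{0..T}\<close>.\<close>

definition grid :: "real \<Rightarrow> nat \<Rightarrow> real \<Rightarrow> real" where
  "grid T n s = max 0 (min T (T * (real_of_int \<lceil>s * real (Suc n) / T\<rceil> - 1) / real (Suc n)))"

text \<open>Ceiling minus one, instead of the floor, keeps the grid point strictly below
  \<open>s\<close> even when \<open>s\<close> is itself a multiple of the mesh: a path killed at
  \<open>s\<close> is still active there.\<close>

lemma grid_bounds:
  assumes "0 < s" "s \<le> T"
  shows "0 \<le> grid T n s" "grid T n s < s" "s - T / real (Suc n) \<le> grid T n s"
proof -
  have T: "0 < T" using assms by simp
  define N where "N = real (Suc n)"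
  have N: "0 < N" by (simp add: N_def)
  define j where "j = real_of_int \<lceil>s * N / T\<rceil>"
  have "s * N / T \<le> j" unfolding j_def by (rule le_of_int_ceiling)
  then have "s * N \<le> j * T" using T by (simp add: pos_divide_le_eq)
  then have "s * N - T \<le> T * (j - 1)" by (simp add: right_diff_distrib mult.commute)
  then have "(s * N - T) / N \<le> T * (j - 1) / N" using N by (intro divide_right_mono) auto
  then have d: "s - T / N \<le> T * (j - 1) / N" using N by (simp add: diff_divide_distrib)
  have "j < s * N / T + 1" unfolding j_def by linarith
  then have "j - 1 < s * N / T" by simp
  then have "(j - 1) * T < s * N" using T by (simp add: pos_less_divide_eq)
  then have b: "T * (j - 1) / N < s" using N by (simp add: pos_divide_less_eq mult.commute)
  have g: "grid T n s = max 0 (min T (T * (j - 1) / N))" by (simp add: grid_def N_def j_def)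
  show "0 \<le> grid T n s" "grid T n s < s" "s - T / real (Suc n) \<le> grid T n s"
    using assms T b d divide_pos_pos[OF T N] unfolding g N_def[symmetric] by linarith+
qed

text \<open>The target is the filter through which \<open>path_set\<close> expresses the left limit
  at the killing time.\<close>

lemma filterlim_grid:
  assumes "0 < s" "s \<le> T"
  shows "filterlim (\<lambda>n. grid T n s) (at s within {0..<s}) sequentially"
proof -
  have "(\<lambda>n. s - T * inverse (real (Suc n))) \<longlonglongrightarrow> s - T * 0"
    by (intro tendsto_intros LIMSEQ_inverse_real_of_nat)
  then have l: "(\<lambda>n. s - T / real (Suc n)) \<longlonglongrightarrow> s"
    by (simp only: divide_inverse mult_zero_right diff_zero)
  have "(\<lambda>n. grid T n s) \<longlonglongrightarrow> s"
  proof (rule tendsto_sandwich[OF _ _ l tendsto_const])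
    show "\<forall>\<^sub>F n in sequentially. s - T / real (Suc n) \<le> grid T n s"
      using grid_bounds(3)[OF assms] by (intro always_eventually allI)
    show "\<forall>\<^sub>F n in sequentially. grid T n s \<le> s"
      using grid_bounds(2)[OF assms] by (intro always_eventually allI less_imp_le)
  qed
  moreover have "grid T n s \<in> {0..<s} \<and> grid T n s \<noteq> s" for n
    using grid_bounds(1,2)[OF assms, of n] by auto
  ultimately show ?thesis
    unfolding filterlim_at by (intro conjI always_eventually allI) blast+
qed

text \<open>An active start excludes \<open>K = 0\<close>, the case in which the left-limit
  condition is vacuous and the position at death cannot be read off from the earlier path.\<close>

lemma path_cases:
  assumes \<omega>: "\<omega> \<in> path_set T psi1" and T: "0 < T" and act: "regime_of (\<omega> 0) = Active"
  obtains (alive) "\<And>t. t \<in> {0..T} \<Longrightarrow> regime_of (\<omega> t) = Active"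
      "continuous_on {0..T} (\<lambda>t. pos (\<omega> t))"
  | (killed) K x where "0 < K" "K \<le> T" "\<And>t. t \<in> {0..<K} \<Longrightarrow> regime_of (\<omega> t) = Active"
      "continuous_on {0..<K} (\<lambda>t. pos (\<omega> t))"
      "((\<lambda>t. pos (\<omega> t)) \<longlongrightarrow> x) (at K within {0..<K})"
      "\<And>t. t \<in> {K..T} \<Longrightarrow> \<omega> t = ((x, K), Dead)"
proof -
  consider (al) "\<forall>t\<in>{0..T}. regime_of (\<omega> t) = Active" "continuous_on {0..T} (\<lambda>t. pos (\<omega> t))"
    | (de) K x where "K \<in> {0..T}" "\<forall>t\<in>{0..<K}. regime_of (\<omega> t) = Active"
      "continuous_on {0..<K} (\<lambda>t. pos (\<omega> t))"
      "((\<lambda>t. pos (\<omega> t)) \<longlongrightarrow> x) (at K within {0..<K})"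
      "\<forall>t\<in>{K..T}. \<omega> t = ((x, K), Dead)"
    using \<omega> unfolding path_set_def psi1_def by blast
  then show ?thesis
  proof cases
    case al then show ?thesis using alive by blast
  next
    case de
    have "0 < K"
    proof (rule ccontr)
      assume "\<not> 0 < K"
      then have "\<omega> 0 = ((x, K), Dead)" using de(1,5) T by auto
      then show False using act by simp
    qed
    then show ?thesis using de by (intro killed) auto
  qed
qed

text \<open>
  The killed process stops at the left limit of its active part, which \<^const>\<open>Phi\<close> does not
  destroy. Hence the terminal state is a measurable function of the collapsed path.
\<close>

definition recover_terminal :: "real \<Rightarrow> ('n::finite) path \<Rightarrow> 'n state" where
  "recover_terminal T \<omega> = (if regime_of (\<omega> T) = Active then \<omega> T
     else ((lim (\<lambda>n. pos (\<omega> (grid T n (ktime (\<omega> T))))), ktime (\<omega> T)), Dead))"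

text \<open>Evaluation at a random time becomes measurable because the grid point depends on the
  path only through an integer: for each integer it is a fixed coordinate, and there are countably
  many. The clip inside \<open>grid\<close> keeps every such coordinate within
  \<open>{0..T}\<close>.\<close>

lemma measurable_recover_terminal:
  assumes T: "0 < T"
  shows "recover_terminal T \<in> path_space T \<psi> \<rightarrow>\<^sub>M (state_space :: ('n::finite) state measure)"
proof -
  let ?M = "path_space T \<psi> :: 'n path measure"
  have cT[measurable]: "(\<lambda>\<omega>. \<omega> T) \<in> ?M \<rightarrow>\<^sub>M state_space"
    using T by (intro measurable_coordinate) simp
  have g: "(\<lambda>\<omega>. pos (\<omega> (grid T n (ktime (\<omega> T))))) \<in> borel_measurable ?M" for n
    unfolding grid_def
  proof (rule measurable_compose_countable[where
        g = "\<lambda>\<omega>. \<lceil>ktime (\<omega> T) * real (Suc n) / T\<rceil>" and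
        f = "\<lambda>j \<omega>. pos (\<omega> (max 0 (min T (T * (real_of_int j - 1) / real (Suc n)))))"])
    fix j
    have [measurable]: "(\<lambda>\<omega>. \<omega> (max 0 (min T (T * (real_of_int j - 1) / real (Suc n)))))
        \<in> ?M \<rightarrow>\<^sub>M state_space"
      using T by (intro measurable_coordinate) auto
    show "(\<lambda>\<omega>. pos (\<omega> (max 0 (min T (T * (real_of_int j - 1) / real (Suc n))))))
        \<in> borel_measurable ?M"
      by measurable
  next
    show "(\<lambda>\<omega>. \<lceil>ktime (\<omega> T) * real (Suc n) / T\<rceil>) \<in> ?M \<rightarrow>\<^sub>M count_space UNIV"
      by measurable
  qed
  then have [measurable]: "(\<lambda>\<omega>. lim (\<lambda>n. pos (\<omega> (grid T n (ktime (\<omega> T)))))) \<in> borel_measurable ?M"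
    by (rule borel_measurable_lim_metric)
  show ?thesis
    unfolding recover_terminal_def[abs_def]
    by (intro measurable_If measurable_stateI) simp_all
qed

lemma recover_terminal_Phi:
  assumes \<omega>: "\<omega> \<in> path_set T psi1" and T: "0 < T" and act: "regime_of (\<omega> 0) = Active"
  shows "recover_terminal T (Phi T c \<omega>) = \<omega> T"
  using \<omega> T act
proof (cases rule: path_cases)
  case alive
  then show ?thesis using T by (simp add: recover_terminal_def Phi_apply collapse_def)
next
  case (killed K x)
  have \<omega>T: "\<omega> T = ((x, K), Dead)" using killed by simp
  \<comment> \<open>\<open>Phi\<close> retains \<open>K\<close> as the recorded killing time, and
    all grid points precede \<open>K\<close>, where \<open>Phi\<close> changes nothing.\<close>
  have e: "pos (Phi T c \<omega> (grid T n K)) = pos (\<omega> (grid T n K))" for n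
  proof -
    have "grid T n K \<in> {0..<K}" using grid_bounds[of K T n] killed by simp
    then have "regime_of (\<omega> (grid T n K)) = Active" "grid T n K \<in> {0..T}"
      using killed by auto
    then show ?thesis by (simp add: Phi_apply collapse_def)
  qed
  have "(\<lambda>n. pos (\<omega> (grid T n K))) \<longlonglongrightarrow> x"
    by (rule filterlim_compose[OF killed(5) filterlim_grid]) (use killed in auto)
  then show ?thesis
    using T \<omega>T by (simp add: recover_terminal_def Phi_apply collapse_def e[unfolded Phi_apply] limI)
qed

section \<open>Right continuity and joint measurability\<close>

text \<open>For a nonempty closed set the functions \<open>max 0 (1 - n * infdist x A)\<close> tend
  to its indicator, boundedly. So the measures agree on closed sets, which are stable under
  intersection and generate the Borel sets.\<close>

lemma finite_measure_eqI_continuous: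
  fixes \<mu> \<nu> :: "'a::metric_space measure"
  assumes fin: "finite_measure \<mu>" "finite_measure \<nu>"
    and sets: "sets \<mu> = sets borel" "sets \<nu> = sets borel"
    and eq: "\<And>h. continuous_on UNIV h \<Longrightarrow> (\<And>x. 0 \<le> h x \<and> h x \<le> (1::real)) \<Longrightarrow>
      (\<integral>x. h x \<partial>\<mu>) = (\<integral>x. h x \<partial>\<nu>)"
  shows "\<mu> = \<nu>"
proof -
  have lim: "(\<lambda>n. \<integral>x. max 0 (1 - real n * infdist x A) \<partial>M) \<longlonglongrightarrow> measure M A"
    if A: "closed A" "A \<noteq> {}" and M: "finite_measure M" "sets M = sets borel" for A and M :: "'a measure"
  proof -
    interpret M: finite_measure M by fact
    have [measurable]: "(\<lambda>x. infdist x A) \<in> borel_measurable M"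
      unfolding measurable_cong_sets[OF M(2) refl]
      by (intro borel_measurable_continuous_onI continuous_intros)
    have AM[measurable]: "A \<in> sets M" using A M by simp
    have "(\<lambda>n. \<integral>x. max 0 (1 - real n * infdist x A) \<partial>M) \<longlonglongrightarrow> (\<integral>x. indicat_real A x \<partial>M)"
    proof (rule integral_dominated_convergence[where w = "\<lambda>_. 1"])
      show "AE x in M. (\<lambda>n. max 0 (1 - real n * infdist x A)) \<longlonglongrightarrow> indicat_real A x"
      proof (intro AE_I2)
        fix x
        show "(\<lambda>n. max 0 (1 - real n * infdist x A)) \<longlonglongrightarrow> indicat_real A x"
        proof (cases "x \<in> A")
          case True then show ?thesis by simp
        next
          case False
          then have pos: "0 < infdist x A"
            using in_closed_iff_infdist_zero[OF A] infdist_nonneg[of x A] by (simp add: less_le)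
          then obtain n0 where n0: "1 < real n0 * infdist x A"
            using reals_Archimedean3 by blast
          have "1 - real n * infdist x A \<le> 0" if "n0 \<le> n" for n
          proof -
            have "real n0 * infdist x A \<le> real n * infdist x A"
              using that pos by (intro mult_right_mono) auto
            then show ?thesis using n0 by simp
          qed
          then have "\<forall>\<^sub>F n in sequentially. max 0 (1 - real n * infdist x A) = indicat_real A x"
            using False unfolding eventually_sequentially by (intro exI[of _ n0]) simp
          then show ?thesis by (rule tendsto_eventually)
        qed
      qed
      show "AE x in M. norm (max 0 (1 - real n * infdist x A)) \<le> 1" for n
      proof (intro AE_I2)
        fix x
        have "0 \<le> real n * infdist x A" by (simp add: infdist_nonneg)
        then show "norm (max 0 (1 - real n * infdist x A)) \<le> 1" unfolding real_norm_def by linarith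
      qed
    qed simp_all
    then show ?thesis by simp
  qed
  have closed_eq: "measure \<mu> A = measure \<nu> A" if A: "closed A" for A
  \<comment> \<open>The empty set is treated apart: \<open>infdist\<close> to it is 0 by convention,
    which would make the approximations constantly 1.\<close>
  proof (cases "A = {}")
    case False
    have "(\<integral>x. max 0 (1 - real n * infdist x A) \<partial>\<mu>) = (\<integral>x. max 0 (1 - real n * infdist x A) \<partial>\<nu>)"
      for n
    proof (rule eq)
      show "continuous_on UNIV (\<lambda>x. max 0 (1 - real n * infdist x A))" by (intro continuous_intros)
      fix x
      have "0 \<le> real n * infdist x A" by (simp add: infdist_nonneg)
      then show "0 \<le> max 0 (1 - real n * infdist x A) \<and> max 0 (1 - real n * infdist x A) \<le> 1"
        by linarith
    qed
    then show ?thesis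
      using lim[OF A False fin(1) sets(1)] lim[OF A False fin(2) sets(2)]
      by (simp add: LIMSEQ_unique)
  qed simp
  show ?thesis
  proof (rule measure_eqI_generator_eq[where E = "Collect closed" and \<Omega> = UNIV and A = "\<lambda>_. UNIV"])
    show "Int_stable (Collect closed :: 'a set set)" by (auto simp: Int_stable_def)
    show "sets \<mu> = sigma_sets UNIV (Collect closed)"
      unfolding sets borel_eq_closed by simp
    show "sets \<nu> = sigma_sets UNIV (Collect closed)"
      unfolding sets borel_eq_closed by simp
    show "emeasure \<mu> X = emeasure \<nu> X" if "X \<in> Collect closed" for X
      using closed_eq that fin by (simp add: finite_measure.emeasure_eq_measure)
    show "emeasure \<mu> UNIV \<noteq> \<infinity>" using fin by (simp add: finite_measure.emeasure_eq_measure)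
  qed auto
qed

text \<open>A discretisation from the right, since paths are right continuous but may jump. The
  \<open>+ 1\<close> keeps the value at or above \<open>s\<close>, and the clip turns the value at
  \<open>s = T\<close> into \<open>T\<close> itself.\<close>

definition upper_grid :: "real \<Rightarrow> nat \<Rightarrow> real \<Rightarrow> real" where
  "upper_grid T n s = max 0 (min T ((real_of_int \<lfloor>s * real (Suc n)\<rfloor> + 1) / real (Suc n)))"

lemma upper_grid:
  assumes "0 \<le> s" "s \<le> T"
  shows "s \<le> upper_grid T n s" "upper_grid T n s \<le> T" "(\<lambda>n. upper_grid T n s) \<longlonglongrightarrow> s"
proof -
  have b: "s \<le> upper_grid T n s \<and> upper_grid T n s \<le> T
      \<and> upper_grid T n s \<le> s + inverse (real (Suc n))" for n
  proof -
    define N where "N = real (Suc n)"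
    have N: "0 < N" by (simp add: N_def)
    define j where "j = real_of_int \<lfloor>s * N\<rfloor>"
    have "s * N \<le> j + 1" unfolding j_def by linarith
    then have "s \<le> (j + 1) / N" using N by (simp add: pos_le_divide_eq)
    moreover have "j + 1 \<le> s * N + 1" unfolding j_def by linarith
    then have "(j + 1) / N \<le> (s * N + 1) / N" using N by (intro divide_right_mono) auto
    then have "(j + 1) / N \<le> s + inverse N" using N by (simp add: add_divide_distrib inverse_eq_divide)
    moreover have "upper_grid T n s = max 0 (min T ((j + 1) / N))"
      by (simp add: upper_grid_def j_def N_def)
    ultimately show ?thesis using assms unfolding N_def[symmetric] by linarith
  qed
  have "(\<lambda>n. s + inverse (real (Suc n))) \<longlonglongrightarrow> s + 0"
    by (intro tendsto_intros LIMSEQ_inverse_real_of_nat)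
  then have l: "(\<lambda>n. s + inverse (real (Suc n))) \<longlonglongrightarrow> s" by (simp only: add_0_right)
  show "(\<lambda>n. upper_grid T n s) \<longlonglongrightarrow> s"
  proof (rule tendsto_sandwich[OF _ _ tendsto_const l])
    show "\<forall>\<^sub>F n in sequentially. s \<le> upper_grid T n s"
      using b by (intro always_eventually allI) blast
    show "\<forall>\<^sub>F n in sequentially. upper_grid T n s \<le> s + inverse (real (Suc n))"
      using b by (intro always_eventually allI) blast
  qed
  show "s \<le> upper_grid T n s" "upper_grid T n s \<le> T" using b[of n] by blast+
qed

text \<open>Before \<open>K\<close> the approximating times are eventually below \<open>K\<close>,
  where the position is continuous; from \<open>K\<close> on the path is constant. The regime is
  tested through a real indicator so that convergence makes sense.\<close>

lemma path_right_continuous: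
  assumes \<omega>: "\<omega> \<in> path_set T psi1" and s: "0 \<le> s" "s \<le> T"
  shows "(\<lambda>n. pos (\<omega> (upper_grid T n s))) \<longlonglongrightarrow> pos (\<omega> s)"
    and "(\<lambda>n. of_bool (regime_of (\<omega> (upper_grid T n s)) = Active) :: real)
      \<longlonglongrightarrow> of_bool (regime_of (\<omega> s) = Active)"
proof -
  let ?u = "\<lambda>n. upper_grid T n s"
  note u = upper_grid[OF s]
  consider (al) "\<forall>t\<in>{0..T}. regime_of (\<omega> t) = Active" "continuous_on {0..T} (\<lambda>t. pos (\<omega> t))"
    | (de) K x where "K \<in> {0..T}" "\<forall>t\<in>{0..<K}. regime_of (\<omega> t) = Active"
      "continuous_on {0..<K} (\<lambda>t. pos (\<omega> t))"
      "\<forall>t\<in>{K..T}. \<omega> t = ((x, K), Dead)"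
    using \<omega> unfolding path_set_def psi1_def by blast
  then have "(\<lambda>n. pos (\<omega> (?u n))) \<longlonglongrightarrow> pos (\<omega> s)
    \<and> (\<lambda>n. of_bool (regime_of (\<omega> (?u n)) = Active) :: real) \<longlonglongrightarrow> of_bool (regime_of (\<omega> s) = Active)"
  proof cases
    case al
    have r: "?u n \<in> {0..T}" for n using u(1,2)[of n] s by simp
    have "(\<lambda>n. pos (\<omega> (?u n))) \<longlonglongrightarrow> pos (\<omega> s)"
      using s by (intro continuous_on_tendsto_compose[OF al(2) u(3)] always_eventually allI r) simp
    moreover have "regime_of (\<omega> (?u n)) = Active" for n using al(1) r by blast
    moreover have "regime_of (\<omega> s) = Active" using al(1) s by simp
    ultimately show ?thesis by simp
  next
    case de
    show ?thesis
    proof (cases "s < K")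
      case True
      have e: "\<forall>\<^sub>F n in sequentially. ?u n \<in> {0..<K}"
        using order_tendstoD(2)[OF u(3) True]
      proof (rule eventually_mono)
        fix n assume "?u n < K"
        then show "?u n \<in> {0..<K}" using s u(1)[of n] by simp
      qed
      have "(\<lambda>n. pos (\<omega> (?u n))) \<longlonglongrightarrow> pos (\<omega> s)"
        using e s True by (intro continuous_on_tendsto_compose[OF de(3) u(3)]) auto
      moreover have "(\<lambda>n. of_bool (regime_of (\<omega> (?u n)) = Active) :: real)
          \<longlonglongrightarrow> of_bool (regime_of (\<omega> s) = Active)"
      proof (rule tendsto_eventually, rule eventually_mono[OF e])
        fix n assume "?u n \<in> {0..<K}"
        then have "regime_of (\<omega> (?u n)) = Active" using de(2) by blast
        moreover have "regime_of (\<omega> s) = Active" using de(2) s True by simp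
        ultimately show "(of_bool (regime_of (\<omega> (?u n)) = Active) :: real) = of_bool (regime_of (\<omega> s) = Active)"
          by simp
      qed
      ultimately show ?thesis by blast
    next
      case False
      then have "\<omega> (?u n) = \<omega> s" for n using u(1,2)[of n] s de(4) by simp
      then show ?thesis by simp
    qed
  qed
  then show "(\<lambda>n. pos (\<omega> (?u n))) \<longlonglongrightarrow> pos (\<omega> s)"
    "(\<lambda>n. of_bool (regime_of (\<omega> (?u n)) = Active) :: real) \<longlonglongrightarrow> of_bool (regime_of (\<omega> s) = Active)"
    by auto
qed

text \<open>Path coordinates are random variables only for times in \<open>{0..T}\<close>; clipping
  makes functions of time and path total on the product with the real line.\<close>

definition clip :: "real \<Rightarrow> real \<Rightarrow> real" where
  "clip T s = max 0 (min T s)"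

lemma clip [simp]: "s \<in> {0..T} \<Longrightarrow> clip T s = s" "0 \<le> T \<Longrightarrow> clip T s \<in> {0..T}"
  by (auto simp: clip_def)

text \<open>A right continuous process is jointly measurable: at the times of
  \<open>upper_grid\<close> only countably many coordinates occur, and the functions so obtained
  converge pointwise.\<close>

lemma measurable_path_joint:
  fixes f :: "'n::finite state \<Rightarrow> 'b::{metric_space}"
  assumes T: "0 \<le> T" and f[measurable]: "f \<in> borel_measurable state_space"
    and lim: "\<And>\<omega> s. \<omega> \<in> path_set T psi1 \<Longrightarrow> s \<in> {0..T} \<Longrightarrow>
      (\<lambda>n. f (\<omega> (upper_grid T n s))) \<longlonglongrightarrow> f (\<omega> s)"
  shows "(\<lambda>(s, \<omega>). f (\<omega> (clip T s))) \<in> borel_measurable (borel \<Otimes>\<^sub>M path_space T psi1)"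
proof -
  let ?M = "borel \<Otimes>\<^sub>M path_space T psi1 :: (real \<times> 'n path) measure"
  have m: "(\<lambda>p. f (snd p (upper_grid T n (clip T (fst p))))) \<in> borel_measurable ?M" for n
    unfolding upper_grid_def
  proof (rule measurable_compose_countable[where g = "\<lambda>p. \<lfloor>clip T (fst p) * real (Suc n)\<rfloor>" and
        f = "\<lambda>j p. f (snd p (max 0 (min T ((real_of_int j + 1) / real (Suc n)))))"])
    fix j
    have "(\<lambda>\<omega>. \<omega> (max 0 (min T ((real_of_int j + 1) / real (Suc n)))))
        \<in> path_space T psi1 \<rightarrow>\<^sub>M (state_space :: 'n state measure)"
      using T by (intro measurable_coordinate) auto
    from measurable_compose[OF measurable_snd this]
    show "(\<lambda>p. f (snd p (max 0 (min T ((real_of_int j + 1) / real (Suc n))))))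
        \<in> borel_measurable ?M"
      by measurable
  next
    show "(\<lambda>p. \<lfloor>clip T (fst p) * real (Suc n)\<rfloor>) \<in> ?M \<rightarrow>\<^sub>M count_space UNIV"
      unfolding clip_def by measurable
  qed
  have "(\<lambda>p. f (snd p (clip T (fst p)))) \<in> borel_measurable ?M"
  proof (rule borel_measurable_LIMSEQ_metric[OF m])
    fix p assume "p \<in> space ?M"
    then have "snd p \<in> path_set T psi1" by (simp add: space_pair_measure space_path_space mem_Times_iff)
    then show "(\<lambda>n. f (snd p (upper_grid T n (clip T (fst p))))) \<longlonglongrightarrow> f (snd p (clip T (fst p)))"
      using clip(2)[OF T] by (intro lim)
  qed
  then show ?thesis by (simp add: case_prod_beta')
qed

lemma measurable_path_joint_pos:
  assumes "0 \<le> T"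
  shows "(\<lambda>(s, \<omega>). pos (\<omega> (clip T s)))
    \<in> borel_measurable (borel \<Otimes>\<^sub>M (path_space T psi1 :: ('n::finite) path measure))"
  using assms by (intro measurable_path_joint path_right_continuous) auto

lemma measurable_path_joint_active:
  assumes "0 \<le> T"
  shows "(\<lambda>(s, \<omega>). of_bool (regime_of (\<omega> (clip T s)) = Active) :: real)
    \<in> borel_measurable (borel \<Otimes>\<^sub>M (path_space T psi1 :: ('n::finite) path measure))"
proof (rule measurable_path_joint[where f = "\<lambda>y. of_bool (regime_of y = Active)"])
  show "(\<lambda>y. of_bool (regime_of y = Active) :: real) \<in> borel_measurable (state_space :: 'n state measure)"
  proof -
    have "(\<lambda>y. of_bool (regime_of y = Active) :: real) = indicator {y :: 'n state. regime_of y = Active}"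
      by (auto simp: fun_eq_iff)
    then show ?thesis by simp
  qed
next
  fix \<omega> :: "'n path" and s assume "\<omega> \<in> path_set T psi1" "s \<in> {0..T}"
  then show "(\<lambda>n. of_bool (regime_of (\<omega> (upper_grid T n s)) = Active) :: real)
      \<longlonglongrightarrow> of_bool (regime_of (\<omega> s) = Active)"
    by (intro path_right_continuous(2)) simp_all
qed (rule assms)

text \<open>The rate of the compensator of the killing indicator. The cut-off outside
  \<open>{0..T}\<close> allows integration over the whole line.\<close>

definition intensity :: "real \<Rightarrow> (real \<Rightarrow> real^'n \<Rightarrow> real) \<Rightarrow> real \<Rightarrow> ('n::finite) path \<Rightarrow> real" where
  "intensity T V s \<omega> = (if s \<in> {0..T} \<and> regime_of (\<omega> s) = Active then V s (pos (\<omega> s)) else 0)"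

lemma measurable_cutoff:
  fixes V :: "real \<Rightarrow> real^'n::finite \<Rightarrow> real"
  assumes V: "C_bounded T V"
  shows "(\<lambda>p. if fst p \<in> {0..T} then V (fst p) (snd p) else 0) \<in> borel_measurable (borel \<Otimes>\<^sub>M borel)"
proof -
  have "(\<lambda>p. if p \<in> {0..T} \<times> UNIV then (\<lambda>(t, x). V t x) p else 0) \<in> borel_measurable borel"
    using V by (intro borel_measurable_continuous_on_if)
      (auto simp: C_bounded_def continuous_on_const intro!: borel_closed closed_Times)
  also have "(\<lambda>p. if p \<in> {0..T} \<times> UNIV then (\<lambda>(t, x). V t x) p else 0)
      = (\<lambda>p. if fst p \<in> {0..T} then V (fst p) (snd p) else 0)"
    by (auto simp: fun_eq_iff mem_Times_iff)
  finally show ?thesis by (simp only: borel_prod)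
qed

lemma measurable_intensity:
  fixes V :: "real \<Rightarrow> real^'n::finite \<Rightarrow> real"
  assumes T: "0 \<le> T" and V: "C_bounded T V"
  shows "(\<lambda>(s, \<omega>). intensity T V s \<omega>) \<in> borel_measurable (borel \<Otimes>\<^sub>M path_space T psi1)"
proof -
  have p: "(\<lambda>p. (fst p, pos (snd p (clip T (fst p)))))
      \<in> borel \<Otimes>\<^sub>M (path_space T psi1 :: 'n path measure) \<rightarrow>\<^sub>M borel \<Otimes>\<^sub>M borel"
    using measurable_path_joint_pos[OF T] by (intro measurable_Pair) (auto simp: case_prod_beta')
  have "(\<lambda>p. (if fst p \<in> {0..T} then V (fst p) (pos (snd p (clip T (fst p)))) else 0)
        * of_bool (regime_of (snd p (clip T (fst p))) = Active))
      \<in> borel_measurable (borel \<Otimes>\<^sub>M (path_space T psi1 :: 'n path measure))"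
    using measurable_compose[OF p measurable_cutoff[OF V]] measurable_path_joint_active[OF T]
    by (intro borel_measurable_times) (simp_all only: case_prod_beta' fst_conv snd_conv)
  also have "(\<lambda>p. (if fst p \<in> {0..T} then V (fst p) (pos (snd p (clip T (fst p)))) else 0)
        * of_bool (regime_of (snd p (clip T (fst p))) = Active))
      = (\<lambda>(s, \<omega>). intensity T V s \<omega>)"
    by (auto simp: intensity_def fun_eq_iff)
  finally show ?thesis .
qed

section \<open>The compensator of the killing indicator\<close>

lemma subalgebra_joint_filtration:
  fixes M :: "(('n::finite) path \<times> (real \<Rightarrow> real^'n)) measure"
  assumes sM: "sets M = sets (path_space T psi1 \<Otimes>\<^sub>M wiener_space T)"
  shows "subalgebra M (joint_filtration T M s)"
proof -
  let ?I = "{0..T} \<inter> {..s}"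
  have w: "(\<lambda>w. w t) \<in> wiener_space T \<rightarrow>\<^sub>M (borel :: (real^'n) measure)" if "t \<in> {0..T}" for t
    unfolding wiener_space_def using that
    by (intro measurable_restrict_space1 measurable_component_singleton)
  have r1: "(\<lambda>\<omega>. restrict \<omega> ?I) \<in> path_space T psi1 \<rightarrow>\<^sub>M (\<Pi>\<^sub>M t\<in>?I. (state_space :: 'n state measure))"
    by (intro measurable_restrict measurable_coordinate) simp
  have r2: "(\<lambda>w. restrict w ?I) \<in> wiener_space T \<rightarrow>\<^sub>M (\<Pi>\<^sub>M t\<in>?I. (borel :: (real^'n) measure))"
    by (intro measurable_restrict w) simp
  have "(\<lambda>z. (restrict (fst z) ?I, restrict (snd z) ?I)) \<in> path_space T psi1 \<Otimes>\<^sub>M wiener_space T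
      \<rightarrow>\<^sub>M (\<Pi>\<^sub>M t\<in>?I. (state_space :: 'n state measure)) \<Otimes>\<^sub>M (\<Pi>\<^sub>M t\<in>?I. (borel :: (real^'n) measure))"
    by (intro measurable_Pair measurable_compose[OF measurable_fst r1]
        measurable_compose[OF measurable_snd r2])
  then have "(\<lambda>(\<omega>, w). (restrict \<omega> ?I, restrict w ?I)) \<in> M
      \<rightarrow>\<^sub>M (\<Pi>\<^sub>M t\<in>?I. (state_space :: 'n state measure)) \<Otimes>\<^sub>M (\<Pi>\<^sub>M t\<in>?I. (borel :: (real^'n) measure))"
    by (simp add: measurable_cong_sets[OF sM refl] case_prod_beta')
  then show ?thesis
    unfolding subalgebra_def joint_filtration_def by (simp add: sets_image_in_sets)
qed

text \<open>This is what permits a function of the state at \<open>s\<close> as a multiplier inside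
  the conditional expectation given the past up to \<open>s\<close>.\<close>

lemma measurable_joint_filtration:
  fixes M :: "(('n::finite) path \<times> (real \<Rightarrow> real^'n)) measure"
  assumes \<phi>: "\<phi> \<in> borel_measurable state_space" and s: "s \<in> {0..T}"
  shows "(\<lambda>z. \<phi> (fst z s)) \<in> borel_measurable (joint_filtration T M s)"
proof -
  let ?I = "{0..T} \<inter> {..s}"
  let ?N = "(\<Pi>\<^sub>M t\<in>?I. (state_space :: 'n state measure)) \<Otimes>\<^sub>M (\<Pi>\<^sub>M t\<in>?I. (borel :: (real^'n) measure))"
  let ?r = "\<lambda>(\<omega>, w). (restrict \<omega> ?I, restrict w ?I)"
  have r: "?r \<in> joint_filtration T M s \<rightarrow>\<^sub>M ?N"
    unfolding joint_filtration_def
    by (rule measurable_vimage_algebra1) (auto simp: space_pair_measure space_PiM)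
  have "(\<lambda>y. \<phi> (fst y s)) \<in> borel_measurable ?N"
    using s by (intro measurable_compose[OF _ \<phi>]
        measurable_compose[OF measurable_fst measurable_component_singleton]) simp
  from measurable_compose[OF r this] show ?thesis
    using s by (simp add: case_prod_beta')
qed

lemma intensity_bound:
  assumes "C_bounded T V"
  obtains C where "0 \<le> C" "\<And>s \<omega>. \<bar>intensity T V s \<omega>\<bar> \<le> C"
proof -
  obtain C where C: "\<forall>t\<in>{0..T}. \<forall>x. \<bar>V t x\<bar> \<le> C" using assms by (auto simp: C_bounded_def)
  show ?thesis
  proof (rule that[of "\<bar>C\<bar>"])
    fix s and \<omega> :: "'a path"
    show "\<bar>intensity T V s \<omega>\<bar> \<le> \<bar>C\<bar>"
    proof (cases "s \<in> {0..T} \<and> regime_of (\<omega> s) = Active")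
      case True
      then have "\<bar>V s (pos (\<omega> s))\<bar> \<le> \<bar>C\<bar>" using C by (meson abs_ge_self order_trans)
      then show ?thesis using True by (simp add: intensity_def)
    next
      case False
      then have "intensity T V s \<omega> = 0" unfolding intensity_def by (rule if_not_P)
      then show ?thesis by simp
    qed
  qed simp
qed

lemma intensity_outside: "s \<notin> {0..T} \<Longrightarrow> intensity T V s \<omega> = 0"
  by (auto simp: intensity_def)

lemma integrable_bounded_interval:
  fixes f :: "real \<Rightarrow> real"
  assumes f[measurable]: "f \<in> borel_measurable borel" and B: "\<And>x. \<bar>f x\<bar> \<le> B"
    and z: "\<And>x. x \<notin> {a..b} \<Longrightarrow> f x = 0"
  shows "integrable lborel f"
proof (rule Bochner_Integration.integrable_bound)
  show "integrable lborel (\<lambda>x. B * indicat_real {a..b} x)"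
    by (intro integrable_mult_right integrable_real_indicator) (simp_all add: emeasure_lborel_Icc_eq)
  show "AE x in lborel. norm (f x) \<le> norm (B * indicat_real {a..b} x)"
  proof (intro AE_I2)
    fix x
    show "norm (f x) \<le> norm (B * indicat_real {a..b} x)"
    proof (cases "x \<in> {a..b}")
      case True then show ?thesis using B[of x] by simp
    next
      case False then show ?thesis using z by simp
    qed
  qed
qed simp

lemma intensity_section:
  fixes V :: "real \<Rightarrow> real^'n::finite \<Rightarrow> real"
  assumes T: "0 \<le> T" and V: "C_bounded T V" and \<omega>: "\<omega> \<in> path_set T psi1"
  shows "(\<lambda>r. intensity T V r \<omega>) \<in> borel_measurable borel"
proof -
  have "(\<lambda>r. (r, \<omega>)) \<in> borel \<rightarrow>\<^sub>M borel \<Otimes>\<^sub>M (path_space T psi1 :: 'n path measure)"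
    using \<omega> by (intro measurable_Pair2') (simp add: space_path_space)
  from measurable_compose[OF this measurable_intensity[OF T V]] show ?thesis by simp
qed

text \<open>The martingale property of the killing indicator minus its integrated rate, tested
  against bounded functions of the state at the left time. The two integrability claims are needed
  to sum such identities over a partition.\<close>

lemma compensator_increment:
  fixes R :: "('n::finite) path measure"
  assumes sde: "sde_with_killing T b \<sigma> V psi1 R" and V: "C_bounded T V" and T: "0 < T"
    and st: "0 \<le> s" "s \<le> t" "t \<le> T"
    and G[measurable]: "G \<in> borel_measurable state_space" and B: "\<And>y. \<bar>G y\<bar> \<le> B"
  shows "integrable R (\<lambda>\<omega>. G (\<omega> s) * (of_bool (regime_of (\<omega> t) = Dead) - of_bool (regime_of (\<omega> s) = Dead)))"
    and "integrable R (\<lambda>\<omega>. G (\<omega> s) * (\<integral>r. indicator {s<..t} r * intensity T V r \<omega> \<partial>lborel))"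
    and "(\<integral>\<omega>. G (\<omega> s) * (of_bool (regime_of (\<omega> t) = Dead) - of_bool (regime_of (\<omega> s) = Dead)) \<partial>R)
    = (\<integral>\<omega>. G (\<omega> s) * (\<integral>r. indicator {s<..t} r * intensity T V r \<omega> \<partial>lborel) \<partial>R)"
proof -
  let ?P = "path_space T psi1 :: 'n path measure"
  define J where "J t \<omega> = (\<integral>r. indicator {0..t} r * intensity T V r \<omega> \<partial>lborel)" for t and \<omega> :: "'n path"
  define d where "d t \<omega> = (of_bool (regime_of (\<omega> t) = Dead) :: real)" for t and \<omega> :: "'n path"
  obtain C where C0: "0 \<le> C" and C: "\<And>s \<omega>. \<bar>intensity T V s (\<omega> :: 'n path)\<bar> \<le> C"
    using intensity_bound[OF V] by blast
  obtain M :: "('n path \<times> (real \<Rightarrow> real^'n)) measure"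
    where M: "prob_space M" and sM: "sets M = sets (?P \<Otimes>\<^sub>M wiener_space T)"
      and dM: "distr M ?P fst = R"
      and mart0: "\<And>s t. 0 \<le> s \<Longrightarrow> s \<le> t \<Longrightarrow> t \<le> T \<Longrightarrow>
        AE z in M. real_cond_exp M (joint_filtration T M s) (\<lambda>z. (if regime_of (fst z t) = Dead then 1 else 0)
                   - (LBINT r:{0..t}. if regime_of (fst z r) = Active
                                      then V r (pos (fst z r)) else 0)) z
          = (if regime_of (fst z s) = Dead then 1 else 0)
                   - (LBINT r:{0..s}. if regime_of (fst z r) = Active
                                      then V r (pos (fst z r)) else 0)"
    using sde unfolding sde_with_killing_def Let_def
    by - (elim conjE exE, rule that, assumption, assumption, assumption, blast)
  have Qeq: "(if regime_of (\<omega> u) = Dead then 1 else 0)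
       - (LBINT r:{0..u}. if regime_of (\<omega> r) = Active then V r (pos (\<omega> r)) else 0)
     = d u \<omega> - J u \<omega>" if "u \<le> T" for u and \<omega> :: "'n path"
  proof -
    have "(LBINT r:{0..u}. if regime_of (\<omega> r) = Active then V r (pos (\<omega> r)) else 0) = J u \<omega>"
      unfolding J_def set_lebesgue_integral_def using that
      by (intro Bochner_Integration.integral_cong) (auto simp: indicator_def intensity_def)
    then show ?thesis by (simp add: d_def)
  qed
  have mart: "AE z in M. real_cond_exp M (joint_filtration T M s) (\<lambda>z. d t (fst z) - J t (fst z)) z
      = d s (fst z) - J s (fst z)"
    using mart0[OF st] unfolding Qeq[OF st(3)] Qeq[OF order_trans[OF st(2,3)]] .
  interpret M: prob_space M by fact
  have fst_M[measurable]: "fst \<in> M \<rightarrow>\<^sub>M ?P"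
    by (subst measurable_cong_sets[OF sM refl]) (rule measurable_fst)
  have sp: "fst z \<in> path_set T psi1" if "z \<in> space M" for z
    using measurable_space[OF fst_M that] by (simp add: space_path_space)
  have m1[measurable]: "(\<lambda>(\<omega>, r). indicator {0..u} r * intensity T V r \<omega>) \<in> borel_measurable (?P \<Otimes>\<^sub>M lborel)" for u
  proof -
    have "(\<lambda>p. (snd p, fst p)) \<in> ?P \<Otimes>\<^sub>M lborel \<rightarrow>\<^sub>M borel \<Otimes>\<^sub>M ?P" by measurable
    from measurable_compose[OF this measurable_intensity[OF less_imp_le[OF T] V]]
    show ?thesis by (auto simp: case_prod_beta')
  qed
  have J_meas[measurable]: "J u \<in> borel_measurable ?P" for u
    unfolding J_def using m1 by (rule lborel.borel_measurable_lebesgue_integral)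
  have d_meas[measurable]: "d u \<in> borel_measurable ?P" if "u \<in> {0..T}" for u
  proof -
    have "(\<lambda>y. of_bool (regime_of y = Dead) :: real) = indicator {y :: 'n state. regime_of y = Dead}"
      by (auto simp: fun_eq_iff)
    then have "(\<lambda>y. of_bool (regime_of y = Dead) :: real) \<in> borel_measurable (state_space :: 'n state measure)"
      by simp
    from measurable_compose[OF measurable_coordinate[OF that] this] show ?thesis
      by (simp add: d_def[abs_def])
  qed
  have int_i: "integrable lborel (\<lambda>r. indicator A r * intensity T V r \<omega>)"
    if "\<omega> \<in> path_set T psi1" and [measurable]: "A \<in> sets borel" for \<omega> and A :: "real set"
  proof (rule integrable_bounded_interval[where B = C and a = 0 and b = T])
    have [measurable]: "(\<lambda>r. intensity T V r \<omega>) \<in> borel_measurable borel"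
      using T V that by (intro intensity_section) auto
    show "(\<lambda>r. indicator A r * intensity T V r \<omega>) \<in> borel_measurable borel" by measurable
    show "\<bar>indicator A r * intensity T V r \<omega>\<bar> \<le> C" for r
      using C[of r \<omega>] C0 by (auto simp: indicator_def)
  qed (auto simp: intensity_outside)
  have J_diff: "J t \<omega> - J s \<omega> = (\<integral>r. indicator {s<..t} r * intensity T V r \<omega> \<partial>lborel)"
    if "\<omega> \<in> path_set T psi1" for \<omega>
  proof -
    have "J t \<omega> - J s \<omega> = (\<integral>r. indicator {0..t} r * intensity T V r \<omega>
        - indicator {0..s} r * intensity T V r \<omega> \<partial>lborel)"
      unfolding J_def using that by (intro Bochner_Integration.integral_diff[symmetric] int_i) auto
    also have "\<dots> = (\<integral>r. indicator {s<..t} r * intensity T V r \<omega> \<partial>lborel)"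
      using st by (intro Bochner_Integration.integral_cong) (auto simp: indicator_def)
    finally show ?thesis .
  qed
  have J_bound: "\<bar>J u \<omega>\<bar> \<le> C * T" if "\<omega> \<in> path_set T psi1" for u \<omega>
  proof -
    have "norm (J u \<omega>) \<le> (\<integral>r. norm (indicator {0..u} r * intensity T V r \<omega>) \<partial>lborel)"
      unfolding J_def by (rule integral_norm_bound)
    also have "\<dots> \<le> (\<integral>r. C * indicator {0..T} r \<partial>lborel)"
    proof (rule integral_mono)
      show "integrable lborel (\<lambda>r. norm (indicator {0..u} r * intensity T V r \<omega>))"
        using int_i[OF that] by (intro integrable_norm) auto
      show "integrable lborel (\<lambda>r. C * indicat_real {0..T} r)"
        by (intro integrable_mult_right integrable_real_indicator) (simp_all add: emeasure_lborel_Icc_eq)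
      show "norm (indicator {0..u} r * intensity T V r \<omega>) \<le> C * indicator {0..T} r" for r
        using C[of r \<omega>] C0 intensity_outside[of r T V \<omega>] by (auto simp: indicator_def)
    qed
    also have "\<dots> = C * T" using T by simp
    finally show ?thesis by simp
  qed
  have us: "s \<in> {0..T}" and ut: "t \<in> {0..T}" using st by auto
  have Gs[measurable]: "(\<lambda>\<omega>. G (\<omega> s)) \<in> borel_measurable ?P"
    by (rule measurable_compose[OF measurable_coordinate[OF us] G])
  have dmt[measurable]: "d t \<in> borel_measurable ?P" and dms[measurable]: "d s \<in> borel_measurable ?P"
    using d_meas us ut by auto
  have B0: "0 \<le> B" using B[of undefined] by linarith
  have Qint: "integrable M (\<lambda>z. G (fst z s) * (d u (fst z) - J u (fst z)))" if u: "u \<in> {0..T}" for u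
  proof (rule M.integrable_const_bound[where B = "B * (1 + C * T)"])
    show "AE z in M. norm (G (fst z s) * (d u (fst z) - J u (fst z))) \<le> B * (1 + C * T)"
    proof (intro AE_I2)
      fix z assume z: "z \<in> space M"
      have "\<bar>d u (fst z) - J u (fst z)\<bar> \<le> 1 + C * T"
        using J_bound[OF sp[OF z], of u] by (auto simp: d_def)
      then show "norm (G (fst z s) * (d u (fst z) - J u (fst z))) \<le> B * (1 + C * T)"
        unfolding real_norm_def abs_mult using B B0 by (intro mult_mono) auto
    qed
    have [measurable]: "d u \<in> borel_measurable ?P" using d_meas u by auto
    have "(\<lambda>\<omega>. G (\<omega> s) * (d u \<omega> - J u \<omega>)) \<in> borel_measurable ?P" by measurable
    from measurable_compose[OF fst_M this]
    show "(\<lambda>z. G (fst z s) * (d u (fst z) - J u (fst z))) \<in> borel_measurable M" .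
  qed
  have sub: "subalgebra M (joint_filtration T M s)" by (rule subalgebra_joint_filtration[OF sM])
  interpret S: finite_measure_subalgebra M "joint_filtration T M s"
    by standard (rule sub)
  \<comment> \<open>The multiplier belongs to the past up to \<open>s\<close>, so the value at
    \<open>t\<close> may be replaced by its conditional expectation, which the martingale property
    identifies with the value at \<open>s\<close>.\<close>
  have "(\<integral>z. G (fst z s) * (d t (fst z) - J t (fst z)) \<partial>M)
      = (\<integral>z. G (fst z s) * real_cond_exp M (joint_filtration T M s) (\<lambda>z. d t (fst z) - J t (fst z)) z \<partial>M)"
  proof (rule S.real_cond_exp_intg(2)[symmetric])
    show "integrable M (\<lambda>z. G (fst z s) * (d t (fst z) - J t (fst z)))" by (rule Qint[OF ut])
    show "(\<lambda>z. G (fst z s)) \<in> borel_measurable (joint_filtration T M s)"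
      by (rule measurable_joint_filtration[OF G us])
    have "(\<lambda>\<omega>. d t \<omega> - J t \<omega>) \<in> borel_measurable ?P" by measurable
    from measurable_compose[OF fst_M this]
    show "(\<lambda>z. d t (fst z) - J t (fst z)) \<in> borel_measurable M" .
  qed
  also have "\<dots> = (\<integral>z. G (fst z s) * (d s (fst z) - J s (fst z)) \<partial>M)"
  proof (rule integral_cong_AE)
    have "(\<lambda>\<omega>. G (\<omega> s)) \<in> borel_measurable ?P" by measurable
    note g = measurable_compose[OF fst_M this]
    show "(\<lambda>z. G (fst z s) * real_cond_exp M (joint_filtration T M s) (\<lambda>z. d t (fst z) - J t (fst z)) z)
        \<in> borel_measurable M"
      using g by (intro borel_measurable_times borel_measurable_cond_exp2)
    show "(\<lambda>z. G (fst z s) * (d s (fst z) - J s (fst z))) \<in> borel_measurable M"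
      using Qint[OF us] by blast
    show "AE z in M. G (fst z s) * real_cond_exp M (joint_filtration T M s) (\<lambda>z. d t (fst z) - J t (fst z)) z
        = G (fst z s) * (d s (fst z) - J s (fst z))"
      using mart by (rule eventually_mono) simp
  qed
  finally have "(\<integral>z. G (fst z s) * (d t (fst z) - J t (fst z)) - G (fst z s) * (d s (fst z) - J s (fst z)) \<partial>M) = 0"
    using Qint[OF us] Qint[OF ut] by (subst Bochner_Integration.integral_diff) auto
  then have z: "(\<integral>z. G (fst z s) * (d t (fst z) - d s (fst z)) - G (fst z s) * (J t (fst z) - J s (fst z)) \<partial>M) = 0"
    by (simp add: algebra_simps)
  have ib: "integrable M (\<lambda>z. \<phi> (fst z))" if m: "\<phi> \<in> borel_measurable ?P"
    and b: "\<And>\<omega>. \<omega> \<in> path_set T psi1 \<Longrightarrow> \<bar>\<phi> \<omega>\<bar> \<le> K" for \<phi> :: "'n path \<Rightarrow> real" and K :: real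
  proof (rule M.integrable_const_bound[where B = K])
    show "(\<lambda>z. \<phi> (fst z)) \<in> borel_measurable M" by (rule measurable_compose[OF fst_M m])
    show "AE z in M. norm (\<phi> (fst z)) \<le> K" using b sp by (intro AE_I2) simp
  qed
  have i1: "integrable M (\<lambda>z. G (fst z s) * (d t (fst z) - d s (fst z)))"
  proof (rule ib[of "\<lambda>\<omega>. G (\<omega> s) * (d t \<omega> - d s \<omega>)" "B * 1"])
    fix \<omega> :: "'n path"
    have "\<bar>d t \<omega> - d s \<omega>\<bar> \<le> 1" by (auto simp: d_def)
    then show "\<bar>G (\<omega> s) * (d t \<omega> - d s \<omega>)\<bar> \<le> B * 1"
      unfolding abs_mult using B B0 by (intro mult_mono) auto
  qed measurable
  have i2: "integrable M (\<lambda>z. G (fst z s) * (J t (fst z) - J s (fst z)))"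
  proof (rule ib[of "\<lambda>\<omega>. G (\<omega> s) * (J t \<omega> - J s \<omega>)" "B * (2 * (C * T))"])
    fix \<omega> :: "'n path" assume "\<omega> \<in> path_set T psi1"
    then have "\<bar>J t \<omega> - J s \<omega>\<bar> \<le> 2 * (C * T)" using J_bound[of \<omega> t] J_bound[of \<omega> s] by linarith
    then show "\<bar>G (\<omega> s) * (J t \<omega> - J s \<omega>)\<bar> \<le> B * (2 * (C * T))"
      unfolding abs_mult using B B0 by (intro mult_mono) auto
  qed measurable
  \<comment> \<open>From the joint law with the Brownian motion back to its path marginal
    \<open>R\<close>.\<close>
  have "(\<integral>\<omega>. G (\<omega> s) * (d t \<omega> - d s \<omega>) \<partial>R) = (\<integral>z. G (fst z s) * (d t (fst z) - d s (fst z)) \<partial>M)"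
    unfolding dM[symmetric] by (rule integral_distr[OF fst_M]) measurable
  also have "\<dots> = (\<integral>z. G (fst z s) * (J t (fst z) - J s (fst z)) \<partial>M)"
    using z i1 i2 by (subst (asm) Bochner_Integration.integral_diff) auto
  also have "\<dots> = (\<integral>\<omega>. G (\<omega> s) * (J t \<omega> - J s \<omega>) \<partial>R)"
    unfolding dM[symmetric] by (rule integral_distr[OF fst_M, symmetric]) measurable
  finally have eq: "(\<integral>\<omega>. G (\<omega> s) * (d t \<omega> - d s \<omega>) \<partial>R) = (\<integral>\<omega>. G (\<omega> s) * (J t \<omega> - J s \<omega>) \<partial>R)" .
  have J_eq: "G (\<omega> s) * (J t \<omega> - J s \<omega>) = G (\<omega> s) * (\<integral>r. indicator {s<..t} r * intensity T V r \<omega> \<partial>lborel)"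
    if "\<omega> \<in> space R" for \<omega>
  proof -
    have "\<omega> \<in> path_set T psi1" using that unfolding dM[symmetric] by (simp add: space_path_space)
    then show ?thesis by (simp add: J_diff)
  qed
  have "(\<integral>\<omega>. G (\<omega> s) * (J t \<omega> - J s \<omega>) \<partial>R)
      = (\<integral>\<omega>. G (\<omega> s) * (\<integral>r. indicator {s<..t} r * intensity T V r \<omega> \<partial>lborel) \<partial>R)"
    by (rule Bochner_Integration.integral_cong[OF refl J_eq])
  then show "(\<integral>\<omega>. G (\<omega> s) * (of_bool (regime_of (\<omega> t) = Dead) - of_bool (regime_of (\<omega> s) = Dead)) \<partial>R)
      = (\<integral>\<omega>. G (\<omega> s) * (\<integral>r. indicator {s<..t} r * intensity T V r \<omega> \<partial>lborel) \<partial>R)"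
    using eq unfolding d_def by simp
  have r1: "integrable R (\<lambda>\<omega>. G (\<omega> s) * (d t \<omega> - d s \<omega>))"
    unfolding dM[symmetric] by (subst integrable_distr_eq[OF fst_M]) (measurable, rule i1)
  then show "integrable R (\<lambda>\<omega>. G (\<omega> s) * (of_bool (regime_of (\<omega> t) = Dead) - of_bool (regime_of (\<omega> s) = Dead)))"
    unfolding d_def .
  have "integrable R (\<lambda>\<omega>. G (\<omega> s) * (J t \<omega> - J s \<omega>))"
    unfolding dM[symmetric] by (subst integrable_distr_eq[OF fst_M]) (measurable, rule i2)
  moreover have "integrable R (\<lambda>\<omega>. G (\<omega> s) * (J t \<omega> - J s \<omega>))
      \<longleftrightarrow> integrable R (\<lambda>\<omega>. G (\<omega> s) * (\<integral>r. indicator {s<..t} r * intensity T V r \<omega> \<partial>lborel))"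
    by (rule Bochner_Integration.integrable_cong[OF refl J_eq])
  ultimately show "integrable R (\<lambda>\<omega>. G (\<omega> s) * (\<integral>r. indicator {s<..t} r * intensity T V r \<omega> \<partial>lborel))"
    by blast
qed

text \<open>The cells partition \<open>{0<..T}\<close>, so the sum picks the left endpoint of the
  one containing \<open>r\<close>, which is \<open>grid T n r\<close>. It is used with
  \<open>r\<close> the killing time as well as with \<open>r\<close> an integration
  variable.\<close>

lemma grid_sum:
  fixes a :: "real \<Rightarrow> real"
  assumes T: "0 < T"
  shows "(\<Sum>i<Suc n. indicator {T * real i / real (Suc n)<..T * real (Suc i) / real (Suc n)} r
      * a (T * real i / real (Suc n))) = (if r \<in> {0<..T} then a (grid T n r) else 0)"
proof -
  define N where "N = real (Suc n)"
  have N: "0 < N" by (simp add: N_def)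
  \<comment> \<open>Cells open on the left and closed on the right match the ceiling; this is the
    origin of the \<open>- 1\<close> in \<open>grid\<close>.\<close>
  have iff: "r \<in> {T * real i / N<..T * real (Suc i) / N} \<longleftrightarrow> \<lceil>r * N / T\<rceil> = int i + 1" for i
  proof -
    have "r \<in> {T * real i / N<..T * real (Suc i) / N} \<longleftrightarrow> T * real i < r * N \<and> r * N \<le> T * real (Suc i)"
      using N by (simp add: pos_divide_less_eq pos_le_divide_eq)
    also have "\<dots> \<longleftrightarrow> real i < r * N / T \<and> r * N / T \<le> real (Suc i)"
      using T by (simp add: pos_divide_le_eq pos_less_divide_eq mult.commute)
    also have "\<dots> \<longleftrightarrow> \<lceil>r * N / T\<rceil> = int i + 1"
      by (simp add: ceiling_eq_iff add.commute)
    finally show ?thesis .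
  qed
  have s: "(\<Sum>i<Suc n. indicator {T * real i / N<..T * real (Suc i) / N} r * a (T * real i / N))
      = (\<Sum>i<Suc n. if \<lceil>r * N / T\<rceil> = int i + 1 then a (T * real i / N) else 0)"
    by (intro sum.cong refl) (unfold indicator_def iff, simp)
  show ?thesis
  proof (cases "r \<in> {0<..T}")
    case True
    let ?j = "nat (\<lceil>r * N / T\<rceil> - 1)"
    have p: "0 < r * N / T" using True N T by simp
    have "r * N / T \<le> N" using True N T by (simp add: pos_divide_le_eq mult.commute)
    then have q: "\<lceil>r * N / T\<rceil> \<le> int (Suc n)" unfolding N_def by (simp add: ceiling_le_iff)
    have p': "1 \<le> \<lceil>r * N / T\<rceil>" using p by linarith
    have e: "(\<lceil>r * N / T\<rceil> = int i + 1) = (i = ?j)" for i using p' by auto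
    have j: "?j < Suc n" using q p' by linarith
    have "(\<Sum>i<Suc n. if \<lceil>r * N / T\<rceil> = int i + 1 then a (T * real i / N) else 0) = a (T * real ?j / N)"
      unfolding e using j by (subst sum.delta) simp_all
    moreover have "grid T n r = T * real ?j / N"
    proof -
      have rj: "real ?j = real_of_int \<lceil>r * N / T\<rceil> - 1" using p' by simp
      have "real ?j \<le> N" using j unfolding N_def by linarith
      then have "T * real ?j / N \<le> T" using T N by (simp add: pos_divide_le_eq)
      moreover have "0 \<le> T * real ?j / N" using T N by simp
      ultimately show ?thesis unfolding grid_def N_def[symmetric] rj[symmetric] by simp
    qed
    ultimately show ?thesis using s True unfolding N_def by simp
  next
    case False
    have "\<lceil>r * N / T\<rceil> \<noteq> int i + 1" if "i < Suc n" for i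
    proof
      assume "\<lceil>r * N / T\<rceil> = int i + 1"
      then have r: "T * real i / N < r" "r \<le> T * real (Suc i) / N" using iff[of i] by auto
      have "0 \<le> T * real i / N" using T N by simp
      then have "0 < r" using r by linarith
      have "real (Suc i) \<le> N" using that unfolding N_def by simp
      then have "T * real (Suc i) / N \<le> T" using T N by (simp add: pos_divide_le_eq)
      then show False using False r \<open>0 < r\<close> by simp
    qed
    then have "(\<Sum>i<Suc n. if \<lceil>r * N / T\<rceil> = int i + 1 then a (T * real i / N) else 0) = 0"
      by (intro sum.neutral) simp
    then show ?thesis using s False unfolding N_def by auto
  qed
qed

section \<open>The joint law of killing position and killing time\<close>

lemma tendsto_grid:
  assumes "0 < s" "s \<le> T"
  shows "(\<lambda>n. grid T n s) \<longlonglongrightarrow> s"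
  using filterlim_grid[OF assms] by (simp add: filterlim_at)

text \<open>
  Summing the increments over a grid yields the formula with \<open>h\<close> evaluated at the last grid point
  before the killing time, respectively before \<open>r\<close>; refining the grid gives left limits, and that at
  the killing time is the dead position.
\<close>

lemma compensator_formula:
  fixes R :: "('n::finite) path measure" and h :: "(real^'n) \<times> real \<Rightarrow> real"
  assumes R: "prob_space R" and sR: "sets R = sets (path_space T psi1)"
    and act: "AE \<omega> in R. regime_of (\<omega> 0) = Active"
    and sde: "sde_with_killing T b \<sigma> V psi1 R" and V: "C_bounded T V" and T: "0 < T"
    and h: "continuous_on UNIV h" and h01: "\<And>y. 0 \<le> h y \<and> h y \<le> 1"
  shows "(\<integral>\<omega>. of_bool (regime_of (\<omega> T) = Dead) * h (fst (\<omega> T)) \<partial>R)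
    = (\<integral>\<omega>. (\<integral>r. h (pos (\<omega> (clip T r)), r) * intensity T V r \<omega> \<partial>lborel) \<partial>R)"
proof -
  interpret R: prob_space R by fact
  have sp: "\<omega> \<in> path_set T psi1" if "\<omega> \<in> space R" for \<omega>
    using that sets_eq_imp_space_eq[OF sR] by (simp add: space_path_space)
  obtain C where C0: "0 \<le> C" and C: "\<And>s \<omega>. \<bar>intensity T V s (\<omega> :: 'n path)\<bar> \<le> C"
    using intensity_bound[OF V] by blast
  have h_meas: "h \<in> borel_measurable (borel \<Otimes>\<^sub>M borel)"
    unfolding borel_prod by (rule borel_measurable_continuous_onI[OF h])
  \<comment> \<open>The time is a separate argument because an active state records 0 as its killing
    time.\<close>
  define H where "H u y = (if regime_of y = Active then h (pos y, u) else 0)" for u and y :: "'n state"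
  have H_meas: "H u \<in> borel_measurable state_space" for u
  proof -
    have "(\<lambda>y :: 'n state. (pos y, u)) \<in> state_space \<rightarrow>\<^sub>M borel \<Otimes>\<^sub>M borel" by measurable
    note [measurable] = measurable_compose[OF this h_meas]
    show ?thesis unfolding H_def[abs_def] by measurable
  qed
  have H01: "0 \<le> H u y \<and> H u y \<le> 1" for u y using h01 by (simp add: H_def)
  define t where "t n i = T * real i / real (Suc n)" for n i :: nat
  have t: "0 \<le> t n i" "t n i \<le> t n (Suc i)" "t n (Suc i) \<le> T" if "i < Suc n" for n i
  proof -
    show "0 \<le> t n i" using T by (simp add: t_def)
    show "t n i \<le> t n (Suc i)" unfolding t_def using T by (intro divide_right_mono mult_left_mono) auto
    have "real (Suc i) \<le> real (Suc n)" using that by simp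
    then have "T * real (Suc i) \<le> T * real (Suc n)" using T by (intro mult_left_mono) auto
    then show "t n (Suc i) \<le> T" unfolding t_def by (subst pos_divide_le_eq) simp_all
  qed
  \<comment> \<open>\<open>L\<close> is a left-point Stieltjes sum against the killing indicator,
    \<open>Q\<close> the corresponding sum against its compensator. Their expectations agree cell by
    cell, and the theorem is the limit of this equality.\<close>
  define L where "L n \<omega> = (\<Sum>i<Suc n. H (t n i) (\<omega> (t n i)) * (of_bool (regime_of (\<omega> (t n (Suc i))) = Dead)
      - of_bool (regime_of (\<omega> (t n i)) = Dead)))" for n and \<omega> :: "'n path"
  define Q where "Q n \<omega> = (\<Sum>i<Suc n. H (t n i) (\<omega> (t n i))
      * (\<integral>r. indicator {t n i<..t n (Suc i)} r * intensity T V r \<omega> \<partial>lborel))" for n and \<omega> :: "'n path"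
  note inc = compensator_increment[OF sde V T t H_meas, where B = 1]
  have H1: "\<bar>H u y\<bar> \<le> 1" for u y using H01[of u y] by simp
  have iL: "integrable R (L n)" for n
    unfolding L_def[abs_def] by (intro Bochner_Integration.integrable_sum inc(1) H1) simp_all
  have iQ: "integrable R (Q n)" for n
    unfolding Q_def[abs_def] by (intro Bochner_Integration.integrable_sum inc(2) H1) simp_all
  have LQ: "(\<integral>\<omega>. L n \<omega> \<partial>R) = (\<integral>\<omega>. Q n \<omega> \<partial>R)" for n
  proof -
    have "(\<integral>\<omega>. L n \<omega> \<partial>R) = (\<Sum>i<Suc n. \<integral>\<omega>. H (t n i) (\<omega> (t n i)) * (of_bool (regime_of (\<omega> (t n (Suc i))) = Dead)
      - of_bool (regime_of (\<omega> (t n i)) = Dead)) \<partial>R)"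
      unfolding L_def by (intro Bochner_Integration.integral_sum inc(1) H1) simp_all
    also have "\<dots> = (\<Sum>i<Suc n. \<integral>\<omega>. H (t n i) (\<omega> (t n i))
      * (\<integral>r. indicator {t n i<..t n (Suc i)} r * intensity T V r \<omega> \<partial>lborel) \<partial>R)"
      by (intro sum.cong refl inc(3) H1) simp_all
    also have "\<dots> = (\<integral>\<omega>. Q n \<omega> \<partial>R)"
      unfolding Q_def by (intro Bochner_Integration.integral_sum[symmetric] inc(2) H1) simp_all
    finally show ?thesis .
  qed
  have sec: "(\<lambda>r. intensity T V r \<omega>) \<in> borel_measurable borel" if "\<omega> \<in> path_set T psi1" for \<omega>
    using T V that by (intro intensity_section) auto
  have mQ: "(\<lambda>r. (if r \<in> {0<..T} then H (grid T n r) (\<omega> (grid T n r)) else 0) * intensity T V r \<omega>)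
      \<in> borel_measurable lborel" if \<omega>: "\<omega> \<in> path_set T psi1" for n \<omega>
  proof -
    note [measurable] = sec[OF \<omega>]
    \<comment> \<open>Read backwards, \<open>grid_sum\<close> presents the step function as a finite
      sum of indicators, which is visibly measurable.\<close>
    show ?thesis
      unfolding grid_sum[OF T, where a = "\<lambda>u. H u (\<omega> u)", symmetric] by measurable
  qed
  have Q_eq: "Q n \<omega> = (\<integral>r. (if r \<in> {0<..T} then H (grid T n r) (\<omega> (grid T n r)) else 0)
      * intensity T V r \<omega> \<partial>lborel)" if \<omega>: "\<omega> \<in> path_set T psi1" for n \<omega>
  proof -
    note [measurable] = sec[OF \<omega>]
    have i: "integrable lborel (\<lambda>r. indicator A r * intensity T V r \<omega>)"
      if [measurable]: "A \<in> sets borel" for A :: "real set"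
    proof (rule integrable_bounded_interval[where B = C and a = 0 and b = T])
      show "(\<lambda>r. indicator A r * intensity T V r \<omega>) \<in> borel_measurable borel" by measurable
      show "\<bar>indicator A r * intensity T V r \<omega>\<bar> \<le> C" for r
        using C[of r \<omega>] C0 by (auto simp: indicator_def)
    qed (auto simp: intensity_outside)
    have "Q n \<omega> = (\<Sum>i<Suc n. \<integral>r. H (t n i) (\<omega> (t n i))
        * (indicator {t n i<..t n (Suc i)} r * intensity T V r \<omega>) \<partial>lborel)"
      unfolding Q_def by (intro sum.cong refl integral_mult_right_zero[symmetric])
    also have "\<dots> = (\<integral>r. (\<Sum>i<Suc n. H (t n i) (\<omega> (t n i))
        * (indicator {t n i<..t n (Suc i)} r * intensity T V r \<omega>)) \<partial>lborel)"
      by (intro Bochner_Integration.integral_sum[symmetric] integrable_mult_right i) simp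
    also have "\<dots> = (\<integral>r. (\<Sum>i<Suc n. indicator {t n i<..t n (Suc i)} r * H (t n i) (\<omega> (t n i)))
        * intensity T V r \<omega> \<partial>lborel)"
      by (intro Bochner_Integration.integral_cong refl) (simp only: sum_distrib_right, simp only: mult_ac)
    also have "\<dots> = (\<integral>r. (if r \<in> {0<..T} then H (grid T n r) (\<omega> (grid T n r)) else 0)
        * intensity T V r \<omega> \<partial>lborel)"
      unfolding t_def using grid_sum[OF T, where a = "\<lambda>u. H u (\<omega> u)"] by (simp only:)
    finally show ?thesis .
  qed
  \<comment> \<open>The killing indicator jumps at most once, so only the cell that contains the
    killing time survives.\<close>
  have L_eq: "L n \<omega> = (if regime_of (\<omega> T) = Dead then
      (if ktime (\<omega> T) \<in> {0<..T} then H (grid T n (ktime (\<omega> T))) (\<omega> (grid T n (ktime (\<omega> T)))) else 0) else 0)"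
    if \<omega>: "\<omega> \<in> path_set T psi1" and a: "regime_of (\<omega> 0) = Active" for n \<omega>
  proof -
    have "L n \<omega> = (\<Sum>i<Suc n. if regime_of (\<omega> T) = Dead then
        indicator {t n i<..t n (Suc i)} (ktime (\<omega> T)) * H (t n i) (\<omega> (t n i)) else 0)"
      unfolding L_def
    proof (intro sum.cong refl)
      fix i assume "i \<in> {..<Suc n}"
      then have ti: "0 \<le> t n i" "t n i \<le> t n (Suc i)" "t n (Suc i) \<le> T" using t by auto
      show "H (t n i) (\<omega> (t n i)) * (of_bool (regime_of (\<omega> (t n (Suc i))) = Dead)
            - of_bool (regime_of (\<omega> (t n i)) = Dead))
          = (if regime_of (\<omega> T) = Dead then
              indicator {t n i<..t n (Suc i)} (ktime (\<omega> T)) * H (t n i) (\<omega> (t n i)) else 0)"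
        using \<omega> T a
      proof (cases rule: path_cases)
        case alive
        then have "regime_of (\<omega> (t n i)) = Active" "regime_of (\<omega> (t n (Suc i))) = Active" "regime_of (\<omega> T) = Active"
          using ti T by auto
        then show ?thesis by simp
      next
        case (killed K x)
        have \<omega>T: "\<omega> T = ((x, K), Dead)" using killed by simp
        have k: "regime_of (\<omega> u) = (if u < K then Active else Dead)" if "0 \<le> u" "u \<le> T" for u
          using killed(3)[of u] killed(6)[of u] that by auto
        have k1: "regime_of (\<omega> (t n i)) = (if t n i < K then Active else Dead)"
          and k2: "regime_of (\<omega> (t n (Suc i))) = (if t n (Suc i) < K then Active else Dead)"
          using ti by (intro k; linarith)+
        show ?thesis
          unfolding k1 k2 \<omega>T using ti by (auto simp: H_def k1 indicator_def)
      qed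
    qed
    also have "\<dots> = (if regime_of (\<omega> T) = Dead then (\<Sum>i<Suc n.
        indicator {t n i<..t n (Suc i)} (ktime (\<omega> T)) * H (t n i) (\<omega> (t n i))) else 0)"
      by simp
    also have "(\<Sum>i<Suc n. indicator {t n i<..t n (Suc i)} (ktime (\<omega> T)) * H (t n i) (\<omega> (t n i)))
        = (if ktime (\<omega> T) \<in> {0<..T} then H (grid T n (ktime (\<omega> T))) (\<omega> (grid T n (ktime (\<omega> T)))) else 0)"
      unfolding t_def by (rule grid_sum[OF T, where a = "\<lambda>u. H u (\<omega> u)"])
    finally show ?thesis .
  qed
  have h_lim: "(\<lambda>n. h (X n)) \<longlonglongrightarrow> h y" if "X \<longlonglongrightarrow> y" for X y
    using h that by (intro continuous_on_tendsto_compose[OF h]) auto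
  have L_lim: "(\<lambda>n. L n \<omega>) \<longlonglongrightarrow> of_bool (regime_of (\<omega> T) = Dead) * h (fst (\<omega> T))"
    if \<omega>: "\<omega> \<in> path_set T psi1" and a: "regime_of (\<omega> 0) = Active" for \<omega>
    using \<omega> T a
  proof (cases rule: path_cases)
    case alive
    then have "regime_of (\<omega> T) = Active" using T by simp
    then show ?thesis by (simp add: L_eq[OF \<omega> a])
  next
    case (killed K x)
    have \<omega>T: "\<omega> T = ((x, K), Dead)" using killed by simp
    have "regime_of (\<omega> (grid T n K)) = Active" for n
      using killed(3)[of "grid T n K"] grid_bounds[OF killed(1,2), of n] by simp
    then have e: "L n \<omega> = h (pos (\<omega> (grid T n K)), grid T n K)" for n
      using killed(1,2) by (simp add: L_eq[OF \<omega> a] \<omega>T H_def)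
    have "(\<lambda>n. pos (\<omega> (grid T n K))) \<longlonglongrightarrow> x"
      by (rule filterlim_compose[OF killed(5) filterlim_grid[OF killed(1,2)]])
    then have "(\<lambda>n. (pos (\<omega> (grid T n K)), grid T n K)) \<longlonglongrightarrow> (x, K)"
      by (intro tendsto_Pair tendsto_grid killed)
    from h_lim[OF this] show ?thesis by (simp add: e \<omega>T)
  qed
  \<comment> \<open>While the path is active at \<open>r\<close>, its position is continuous on a
    set containing \<open>{0..r}\<close>, so the left limit at \<open>r\<close> is the value at
    \<open>r\<close>.\<close>
  have r_lim: "(\<lambda>n. H (grid T n r) (\<omega> (grid T n r))) \<longlonglongrightarrow> h (pos (\<omega> r), r)"
    if \<omega>: "\<omega> \<in> path_set T psi1" and a: "regime_of (\<omega> 0) = Active" and r: "0 < r" "r \<le> T"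
      and ar: "regime_of (\<omega> r) = Active" for \<omega> r
  proof -
    have "\<exists>I. continuous_on I (\<lambda>t. pos (\<omega> t)) \<and> {0..r} \<subseteq> I \<and> (\<forall>u\<in>I. regime_of (\<omega> u) = Active)"
      using \<omega> T a
    proof (cases rule: path_cases)
      case alive
      then show ?thesis using r by (intro exI[of _ "{0..T}"]) auto
    next
      case (killed K x)
      have "r < K"
      proof (rule ccontr)
        assume "\<not> r < K"
        then have "\<omega> r = ((x, K), Dead)" using killed r by simp
        then show False using ar by simp
      qed
      then show ?thesis using killed by (intro exI[of _ "{0..<K}"]) auto
    qed
    then obtain I where I: "continuous_on I (\<lambda>t. pos (\<omega> t))" "{0..r} \<subseteq> I"
      "\<And>u. u \<in> I \<Longrightarrow> regime_of (\<omega> u) = Active" by blast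
    have g: "grid T n r \<in> I" for n using grid_bounds[OF r, of n] I(2) by auto
    have "(\<lambda>n. pos (\<omega> (grid T n r))) \<longlonglongrightarrow> pos (\<omega> r)"
      using I(2) r g
      by (intro continuous_on_tendsto_compose[OF I(1) tendsto_grid[OF r]] always_eventually) auto
    then have "(\<lambda>n. (pos (\<omega> (grid T n r)), grid T n r)) \<longlonglongrightarrow> (pos (\<omega> r), r)"
      by (intro tendsto_Pair tendsto_grid r)
    from h_lim[OF this] show ?thesis using I(3)[OF g] by (simp add: H_def)
  qed
  have HI: "\<bar>x * intensity T V r \<omega>\<bar> \<le> C * indicator {0..T} r" if "0 \<le> x" "x \<le> 1" for x r and \<omega> :: "'n path"
  proof (cases "r \<in> {0..T}")
    case True
    have "\<bar>x\<bar> * \<bar>intensity T V r \<omega>\<bar> \<le> 1 * C"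
      using C[of r \<omega>] that by (intro mult_mono) auto
    then show ?thesis using True by (simp add: abs_mult)
  next
    case False
    then show ?thesis using intensity_outside[of r T V \<omega>] by simp
  qed
  have iC: "integrable lborel (\<lambda>r. C * indicat_real {0..T} r)"
    by (intro integrable_mult_right integrable_real_indicator) (simp_all add: emeasure_lborel_Icc_eq)
  have joint: "(\<lambda>(\<omega>, r). h (pos (\<omega> (clip T r)), r) * intensity T V r \<omega>) \<in> borel_measurable (R \<Otimes>\<^sub>M lborel)"
  proof -
    have sw: "(\<lambda>p. (snd p, fst p)) \<in> R \<Otimes>\<^sub>M lborel \<rightarrow>\<^sub>M borel \<Otimes>\<^sub>M path_space T psi1"
      by (subst measurable_cong_sets[OF sets_pair_measure_cong[OF sR sets_lborel] refl]) measurable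
    note i = measurable_compose[OF sw measurable_intensity[OF less_imp_le[OF T] V]]
    note p = measurable_compose[OF sw measurable_path_joint_pos[OF less_imp_le[OF T]]]
    have "(\<lambda>p. (pos (fst p (clip T (snd p))), snd p)) \<in> R \<Otimes>\<^sub>M lborel \<rightarrow>\<^sub>M borel \<Otimes>\<^sub>M borel"
      using p by (intro measurable_Pair) simp_all
    from measurable_compose[OF this h_meas] i show ?thesis
      by (simp add: case_prod_beta')
  qed
  have Q_lim: "(\<lambda>n. Q n \<omega>) \<longlonglongrightarrow> (\<integral>r. h (pos (\<omega> (clip T r)), r) * intensity T V r \<omega> \<partial>lborel)"
    if \<omega>: "\<omega> \<in> path_set T psi1" and a: "regime_of (\<omega> 0) = Active" for \<omega>
    unfolding Q_eq[OF \<omega>]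
  proof (rule integral_dominated_convergence[where w = "\<lambda>r. C * indicator {0..T} r"])
    note [measurable] = sec[OF \<omega>]
    have \<omega>R: "\<omega> \<in> space R" using \<omega> sets_eq_imp_space_eq[OF sR] by (simp add: space_path_space)
    show "(\<lambda>r. h (pos (\<omega> (clip T r)), r) * intensity T V r \<omega>) \<in> borel_measurable lborel"
      using measurable_compose[OF measurable_Pair1'[OF \<omega>R] joint] by simp
    show "(\<lambda>r. (if r \<in> {0<..T} then H (grid T n r) (\<omega> (grid T n r)) else 0) * intensity T V r \<omega>)
        \<in> borel_measurable lborel" for n
      by (rule mQ[OF \<omega>])
    show "AE r in lborel. norm ((if r \<in> {0<..T} then H (grid T n r) (\<omega> (grid T n r)) else 0)
        * intensity T V r \<omega>) \<le> C * indicator {0..T} r" for n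
      using H01 unfolding real_norm_def by (intro AE_I2 HI) auto
    \<comment> \<open>No grid point precedes 0, and the step function is set to 0 there; a single
      point is negligible.\<close>
    have "AE r in lborel. r \<noteq> (0::real)" by (rule AE_lborel_singleton)
    then show "AE r in lborel. (\<lambda>n. (if r \<in> {0<..T} then H (grid T n r) (\<omega> (grid T n r)) else 0)
        * intensity T V r \<omega>) \<longlonglongrightarrow> h (pos (\<omega> (clip T r)), r) * intensity T V r \<omega>"
    proof (rule eventually_mono)
      fix r :: real assume r0: "r \<noteq> 0"
      show "(\<lambda>n. (if r \<in> {0<..T} then H (grid T n r) (\<omega> (grid T n r)) else 0)
        * intensity T V r \<omega>) \<longlonglongrightarrow> h (pos (\<omega> (clip T r)), r) * intensity T V r \<omega>"
      proof (cases "r \<in> {0..T} \<and> regime_of (\<omega> r) = Active")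
        case True
        then have r: "0 < r" "r \<le> T" using r0 by auto
        have "(\<lambda>n. H (grid T n r) (\<omega> (grid T n r)) * intensity T V r \<omega>)
            \<longlonglongrightarrow> h (pos (\<omega> r), r) * intensity T V r \<omega>"
          using True by (intro tendsto_mult_right r_lim \<omega> a r) auto
        then show ?thesis using r by simp
      next
        case False
        then have "intensity T V r \<omega> = 0" unfolding intensity_def by (rule if_not_P)
        then show ?thesis by simp
      qed
    qed
  qed (rule iC)
  have act': "AE \<omega> in R. \<omega> \<in> path_set T psi1 \<and> regime_of (\<omega> 0) = Active"
    using act sp by (auto intro: AE_mp)
  have cT: "(\<lambda>\<omega>. \<omega> T) \<in> R \<rightarrow>\<^sub>M state_space"
    using T by (subst measurable_cong_sets[OF sR refl]) (auto intro: measurable_coordinate)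
  have lim1: "(\<lambda>n. \<integral>\<omega>. L n \<omega> \<partial>R) \<longlonglongrightarrow> (\<integral>\<omega>. of_bool (regime_of (\<omega> T) = Dead) * h (fst (\<omega> T)) \<partial>R)"
  proof (rule integral_dominated_convergence[where w = "\<lambda>_. 1"])
    have "(\<lambda>y. h (fst y)) \<in> borel_measurable (state_space :: 'n state measure)"
      unfolding state_space_def borel_prod[symmetric]
      by (rule measurable_compose[OF measurable_fst]) (rule h_meas)
    moreover have "(\<lambda>y. of_bool (regime_of y = Dead) :: real) = indicator {y :: 'n state. regime_of y = Dead}"
      by (auto simp: fun_eq_iff)
    ultimately have "(\<lambda>y. of_bool (regime_of y = Dead) * h (fst y)) \<in> borel_measurable (state_space :: 'n state measure)"
      by (intro borel_measurable_times) simp_all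
    from measurable_compose[OF cT this]
    show "(\<lambda>\<omega>. of_bool (regime_of (\<omega> T) = Dead) * h (fst (\<omega> T))) \<in> borel_measurable R" .
    show "AE \<omega> in R. (\<lambda>n. L n \<omega>) \<longlonglongrightarrow> of_bool (regime_of (\<omega> T) = Dead) * h (fst (\<omega> T))"
      using act' by (rule eventually_mono) (use L_lim in blast)
    show "AE \<omega> in R. norm (L n \<omega>) \<le> 1" for n
      using act'
    proof (rule eventually_mono)
      fix \<omega> :: "'n path" assume "\<omega> \<in> path_set T psi1 \<and> regime_of (\<omega> 0) = Active"
      then have e: "L n \<omega> = (if regime_of (\<omega> T) = Dead then
      (if ktime (\<omega> T) \<in> {0<..T} then H (grid T n (ktime (\<omega> T))) (\<omega> (grid T n (ktime (\<omega> T)))) else 0) else 0)"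
        by (intro L_eq) auto
      show "norm (L n \<omega>) \<le> 1" unfolding e real_norm_def using H1 by simp
    qed
  qed (use iL in auto)
  have lim2: "(\<lambda>n. \<integral>\<omega>. Q n \<omega> \<partial>R) \<longlonglongrightarrow>
      (\<integral>\<omega>. (\<integral>r. h (pos (\<omega> (clip T r)), r) * intensity T V r \<omega> \<partial>lborel) \<partial>R)"
  proof (rule integral_dominated_convergence[where w = "\<lambda>_. C * T"])
    show "(\<lambda>\<omega>. \<integral>r. h (pos (\<omega> (clip T r)), r) * intensity T V r \<omega> \<partial>lborel) \<in> borel_measurable R"
      using joint by (rule lborel.borel_measurable_lebesgue_integral)
    show "AE \<omega> in R. (\<lambda>n. Q n \<omega>) \<longlonglongrightarrow> (\<integral>r. h (pos (\<omega> (clip T r)), r) * intensity T V r \<omega> \<partial>lborel)"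
      using act' by (rule eventually_mono) (use Q_lim in blast)
    show "AE \<omega> in R. norm (Q n \<omega>) \<le> C * T" for n
    proof (intro AE_I2)
      fix \<omega> assume "\<omega> \<in> space R"
      then have \<omega>: "\<omega> \<in> path_set T psi1" by (rule sp)
      let ?f = "\<lambda>r. (if r \<in> {0<..T} then H (grid T n r) (\<omega> (grid T n r)) else 0) * intensity T V r \<omega>"
      have b: "norm (?f r) \<le> C * indicator {0..T} r" for r
        using H01 unfolding real_norm_def by (intro HI) auto
      have "norm (Q n \<omega>) \<le> (\<integral>r. C * indicator {0..T} r \<partial>lborel)"
        unfolding Q_eq[OF \<omega>]
      proof (rule Bochner_Integration.integral_norm_bound_integral[OF _ iC b])
        show "integrable lborel ?f"
        proof (rule Bochner_Integration.integrable_bound[OF iC mQ[OF \<omega>]], intro AE_I2)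
          fix r
          show "norm (?f r) \<le> norm (C * indicat_real {0..T} r)"
            by (rule order_trans[OF b]) simp
        qed
      qed
      also have "\<dots> = C * T" using T by simp
      finally show "norm (Q n \<omega>) \<le> C * T" .
    qed
  qed (use iQ in auto)
  show ?thesis using LIMSEQ_unique[OF lim1] lim2 LQ by simp
qed

text \<open>The compensator formula extends from continuous functions to an identity of finite
  measures, so a set that is null for the killing position and time is null for the intensity
  accumulated along active paths.\<close>

lemma AE_intensity_zero:
  fixes R :: "('n::finite) path measure"
  assumes R: "prob_space R" and sR: "sets R = sets (path_space T psi1)"
    and act: "AE \<omega> in R. regime_of (\<omega> 0) = Active"
    and sde: "sde_with_killing T b \<sigma> V psi1 R" and V: "C_bounded T V" and T: "0 < T"
    and V0: "\<And>t x. t \<in> {0..T} \<Longrightarrow> 0 \<le> V t x"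
    and B: "B \<in> sets borel"
    and null: "AE \<omega> in R. regime_of (\<omega> T) = Dead \<longrightarrow> fst (\<omega> T) \<notin> B"
  shows "AE r in lborel. AE \<omega> in R. (pos (\<omega> (clip T r)), r) \<in> B \<longrightarrow> intensity T V r \<omega> = 0"
proof -
  interpret R: prob_space R by fact
  interpret P: pair_sigma_finite R "lborel :: real measure" ..
  have I0: "0 \<le> intensity T V r \<omega>" for r and \<omega> :: "'n path" using V0 by (simp add: intensity_def)
  obtain C where C0: "0 \<le> C" and C: "\<And>s \<omega>. \<bar>intensity T V s (\<omega> :: 'n path)\<bar> \<le> C"
    using intensity_bound[OF V] by blast
  have sw: "(\<lambda>p. (snd p, fst p)) \<in> R \<Otimes>\<^sub>M lborel \<rightarrow>\<^sub>M borel \<Otimes>\<^sub>M path_space T psi1"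
    by (subst measurable_cong_sets[OF sets_pair_measure_cong[OF sR sets_lborel] refl]) measurable
  have Im[measurable]: "(\<lambda>p. intensity T V (snd p) (fst p)) \<in> borel_measurable (R \<Otimes>\<^sub>M lborel)"
    using measurable_compose[OF sw measurable_intensity[OF less_imp_le[OF T] V]] by simp
  have Xm[measurable]: "(\<lambda>p. (pos (fst p (clip T (snd p))), snd p)) \<in> R \<Otimes>\<^sub>M lborel \<rightarrow>\<^sub>M borel"
    unfolding borel_prod[symmetric]
    using measurable_compose[OF sw measurable_path_joint_pos[OF less_imp_le[OF T]]]
    by (intro measurable_Pair) simp_all
  have cT: "(\<lambda>\<omega>. \<omega> T) \<in> R \<rightarrow>\<^sub>M state_space"
    using T by (subst measurable_cong_sets[OF sR refl]) (auto intro: measurable_coordinate)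
  have Fm[measurable]: "(\<lambda>\<omega>. fst (\<omega> T)) \<in> borel_measurable R"
    by (rule measurable_compose[OF cT]) (simp add: state_space_def)
  have Dm[measurable]: "(\<lambda>\<omega>. of_bool (regime_of (\<omega> T) = Dead) :: real) \<in> borel_measurable R"
  proof -
    have "(\<lambda>y. of_bool (regime_of y = Dead) :: real) = indicator {y :: 'n state. regime_of y = Dead}"
      by (auto simp: fun_eq_iff)
    then have "(\<lambda>y. of_bool (regime_of y = Dead) :: real) \<in> borel_measurable (state_space :: 'n state measure)"
      by simp
    from measurable_compose[OF cT this] show ?thesis .
  qed
  \<comment> \<open>\<open>\<mu>\<close> is the law of killing position and time, restricted to the
    event of death. \<open>\<nu>\<close> is the image, under position and time, of the intensity as
    a density over paths and times.\<close>
  define \<mu> where "\<mu> = distr (density R (\<lambda>\<omega>. ennreal (of_bool (regime_of (\<omega> T) = Dead)))) borel (\<lambda>\<omega>. fst (\<omega> T))"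
  define \<nu> where "\<nu> = distr (density (R \<Otimes>\<^sub>M lborel) (\<lambda>p. ennreal (intensity T V (snd p) (fst p)))) borel
    (\<lambda>p. (pos (fst p (clip T (snd p))), snd p))"
  have bound: "ennreal (intensity T V (snd p) (fst p)) \<le> ennreal C * indicator (space R \<times> {0..T}) p"
    if "p \<in> space (R \<Otimes>\<^sub>M lborel)" for p
    using C[of "snd p" "fst p"] that
    by (cases "snd p \<in> {0..T}") (auto simp: intensity_outside space_pair_measure mem_Times_iff intro!: ennreal_leI)
  have "emeasure (R \<Otimes>\<^sub>M lborel) (space R \<times> {0..T}) = emeasure R (space R) * emeasure lborel {0..T}"
    by (rule lborel.emeasure_pair_measure_Times) simp_all
  also have "\<dots> < \<infinity>" using T by (simp add: R.emeasure_space_1 ennreal_mult_less_top)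
  finally have box: "emeasure (R \<Otimes>\<^sub>M lborel) (space R \<times> {0..T}) < \<infinity>" .
  have fin_n: "(\<integral>\<^sup>+p. ennreal (intensity T V (snd p) (fst p)) \<partial>(R \<Otimes>\<^sub>M lborel)) < \<infinity>"
  proof -
    have "(\<integral>\<^sup>+p. ennreal (intensity T V (snd p) (fst p)) \<partial>(R \<Otimes>\<^sub>M lborel))
        \<le> (\<integral>\<^sup>+p. ennreal C * indicator (space R \<times> {0..T}) p \<partial>(R \<Otimes>\<^sub>M lborel))"
      by (rule nn_integral_mono) (rule bound)
    also have "\<dots> = ennreal C * emeasure (R \<Otimes>\<^sub>M lborel) (space R \<times> {0..T})"
      by (rule nn_integral_cmult_indicator) simp
    also have "\<dots> < \<infinity>" using box by (simp add: ennreal_mult_less_top)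
    finally show ?thesis .
  qed
  have eq: "\<mu> = \<nu>"
  proof (rule finite_measure_eqI_continuous)
    show "finite_measure \<mu>"
    proof
      have "emeasure \<mu> (space \<mu>) = (\<integral>\<^sup>+\<omega>. ennreal (of_bool (regime_of (\<omega> T) = Dead)) \<partial>R)"
        unfolding \<mu>_def by (subst emeasure_distr) (simp_all add: emeasure_density cong: nn_integral_cong)
      also have "\<dots> \<le> (\<integral>\<^sup>+\<omega>. 1 \<partial>R)" by (rule nn_integral_mono) simp
      also have "\<dots> < \<infinity>" by (simp add: R.emeasure_space_1)
      finally show "emeasure \<mu> (space \<mu>) \<noteq> \<infinity>" by simp
    qed
    show "finite_measure \<nu>"
    proof
      have "emeasure \<nu> (space \<nu>) = (\<integral>\<^sup>+p. ennreal (intensity T V (snd p) (fst p)) \<partial>(R \<Otimes>\<^sub>M lborel))"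
      proof -
        have "emeasure \<nu> (space \<nu>) = emeasure (density (R \<Otimes>\<^sub>M lborel)
            (\<lambda>p. ennreal (intensity T V (snd p) (fst p)))) (space (R \<Otimes>\<^sub>M lborel))"
          unfolding \<nu>_def by (subst emeasure_distr) simp_all
        also have "\<dots> = (\<integral>\<^sup>+p. ennreal (intensity T V (snd p) (fst p))
            * indicator (space (R \<Otimes>\<^sub>M lborel)) p \<partial>(R \<Otimes>\<^sub>M lborel))"
          by (rule emeasure_density[OF _ sets.top]) measurable
        also have "\<dots> = (\<integral>\<^sup>+p. ennreal (intensity T V (snd p) (fst p)) \<partial>(R \<Otimes>\<^sub>M lborel))"
          by (intro nn_integral_cong) simp
        finally show ?thesis .
      qed
      then show "emeasure \<nu> (space \<nu>) \<noteq> \<infinity>" using fin_n by simp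
    qed
    fix h :: "(real^'n) \<times> real \<Rightarrow> real"
    assume h: "continuous_on UNIV h" and h01: "\<And>x. 0 \<le> h x \<and> h x \<le> 1"
    have [measurable]: "h \<in> borel_measurable borel" by (rule borel_measurable_continuous_onI[OF h])
    have "(\<integral>x. h x \<partial>\<mu>) = (\<integral>\<omega>. of_bool (regime_of (\<omega> T) = Dead) * h (fst (\<omega> T)) \<partial>R)"
      unfolding \<mu>_def by (subst integral_distr, simp, simp, subst integral_density) simp_all
    also have "\<dots> = (\<integral>\<omega>. (\<integral>r. h (pos (\<omega> (clip T r)), r) * intensity T V r \<omega> \<partial>lborel) \<partial>R)"
      by (rule compensator_formula[OF R sR act sde V T h h01])
    also have "\<dots> = (\<integral>p. h (pos (fst p (clip T (snd p))), snd p) * intensity T V (snd p) (fst p) \<partial>(R \<Otimes>\<^sub>M lborel))"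
    proof -
      have "integrable (R \<Otimes>\<^sub>M lborel) (\<lambda>p. intensity T V (snd p) (fst p))"
        using fin_n I0 by (intro integrableI_nonneg) auto
      then have "integrable (R \<Otimes>\<^sub>M lborel) (\<lambda>p. h (pos (fst p (clip T (snd p))), snd p) * intensity T V (snd p) (fst p))"
      proof (rule Bochner_Integration.integrable_bound)
        show "AE p in R \<Otimes>\<^sub>M lborel. norm (h (pos (fst p (clip T (snd p))), snd p) * intensity T V (snd p) (fst p))
            \<le> norm (intensity T V (snd p) (fst p))"
          using h01 I0 by (intro AE_I2) (simp add: abs_mult mult_left_le_one_le)
      qed measurable
      from P.integral_fst'[OF this] show ?thesis by simp
    qed
    also have "\<dots> = (\<integral>x. h x \<partial>\<nu>)"
      unfolding \<nu>_def using I0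
      by (subst integral_distr, simp, simp, subst integral_density) (simp_all add: mult.commute)
    finally show "(\<integral>x. h x \<partial>\<mu>) = (\<integral>x. h x \<partial>\<nu>)" .
  qed (simp_all add: \<mu>_def \<nu>_def)
  have "AE y in \<mu>. y \<notin> B"
    unfolding \<mu>_def using null B
    by (subst AE_distr_iff) (auto simp: AE_density split: if_splits elim!: eventually_mono)
  then have "AE y in \<nu>. y \<notin> B" unfolding eq .
  then have "AE p in density (R \<Otimes>\<^sub>M lborel) (\<lambda>p. ennreal (intensity T V (snd p) (fst p))).
      (pos (fst p (clip T (snd p))), snd p) \<notin> B"
    unfolding \<nu>_def using B by (subst (asm) AE_distr_iff) auto
  then have "AE p in R \<Otimes>\<^sub>M lborel. (pos (fst p (clip T (snd p))), snd p) \<in> B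
      \<longrightarrow> intensity T V (snd p) (fst p) = 0"
    using I0 by (subst (asm) AE_density) (auto elim!: eventually_mono simp: less_le)
  then have "AE \<omega> in R. AE r in lborel. (pos (\<omega> (clip T r)), r) \<in> B \<longrightarrow> intensity T V r \<omega> = 0"
    by (rule P.AE_pair[where Q = "\<lambda>p. (pos (fst p (clip T (snd p))), snd p) \<in> B \<longrightarrow> intensity T V (snd p) (fst p) = 0", simplified])
  \<comment> \<open>Fubini gives the quantifiers in the order path, time. They are exchanged because
    the transition density gives information about the law at a fixed time.\<close>
  moreover have "{p \<in> space (R \<Otimes>\<^sub>M lborel). (pos (fst p (clip T (snd p))), snd p) \<in> B
      \<longrightarrow> intensity T V (snd p) (fst p) = 0} \<in> sets (R \<Otimes>\<^sub>M lborel)"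
    using B by measurable
  ultimately show ?thesis
    by (subst (asm) P.AE_commute) simp_all
qed

section \<open>Lebesgue-null sets and the terminal law\<close>

text \<open>Measurability of \<open>q\<close> is given only on the domain
  \<open>t < s \<le> T\<close>; the indicator extends the section by 0 to the whole product.\<close>

lemma measurable_transition_density:
  assumes q: "active_transition_density T R q" and t: "0 \<le> t"
  shows "(\<lambda>p. indicat_real ({t<..T} \<times> UNIV) p * q t x (fst p) (snd p))
    \<in> borel_measurable (borel \<Otimes>\<^sub>M (borel :: (real^'n::finite) measure))"
proof -
  let ?\<Omega> = "{t<..T} \<times> (UNIV :: (real^'n) set)"
  let ?D = "{(t :: real, x :: real^'n, s, y :: real^'n). 0 \<le> t \<and> t < s \<and> s \<le> T}"
  have \<Omega>: "?\<Omega> \<in> sets borel"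
    by (metis borel_prod greaterThanAtMost_borel pair_measureI sets.top space_borel)
  have "(\<lambda>p. (t, x, fst p, snd p)) \<in> restrict_space borel ?\<Omega> \<rightarrow>\<^sub>M restrict_space borel ?D"
    using t by (intro measurable_restrict_space2 measurable_restrict_space1)
      (auto simp: space_restrict_space borel_prod[symmetric])
  from measurable_compose[OF this, of "\<lambda>(t, x, s, y). q t x s y" borel]
  have "(\<lambda>p. q t x (fst p) (snd p)) \<in> borel_measurable (restrict_space borel ?\<Omega>)"
    using q unfolding active_transition_density_def by (simp add: case_prod_beta')
  then show ?thesis
    using \<Omega> unfolding borel_prod by (subst (asm) borel_measurable_restrict_space_iff) simp_all
qed

lemma measurable_transition_density_section:
  assumes q: "active_transition_density T R q" and t: "0 \<le> t" "t < s" "s \<le> T"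
  shows "(\<lambda>z. q t x s z) \<in> borel_measurable (borel :: (real^'n::finite) measure)"
proof -
  have "(\<lambda>z. (s, z)) \<in> borel \<rightarrow>\<^sub>M borel \<Otimes>\<^sub>M (borel :: (real^'n) measure)" by measurable
  from measurable_compose[OF this measurable_transition_density[OF q t(1), of x]]
  show ?thesis using t by simp
qed

text \<open>Positivity of the transition density makes Lebesgue measure absolutely continuous with
  respect to the active part of the law at any positive time.\<close>

lemma AE_lborel_of_active_law:
  fixes R :: "('n::finite) path measure"
  assumes R: "prob_space R" and sR: "sets R = sets (path_space T psi1)"
    and act: "AE \<omega> in R. regime_of (\<omega> 0) = Active"
    and q: "active_transition_density T R q" and T: "0 < T" and s: "0 < s" "s \<le> T"
    and N: "N \<in> sets borel" and null: "AE \<omega> in R. regime_of (\<omega> s) = Active \<longrightarrow> pos (\<omega> s) \<notin> N"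
  shows "AE z in lborel. z \<notin> N"
proof -
  interpret R: prob_space R by fact
  have c0[measurable]: "(\<lambda>\<omega>. \<omega> 0) \<in> R \<rightarrow>\<^sub>M state_space"
    using T by (subst measurable_cong_sets[OF sR refl]) (auto intro: measurable_coordinate)
  have cs[measurable]: "(\<lambda>\<omega>. \<omega> s) \<in> R \<rightarrow>\<^sub>M state_space"
    using s by (subst measurable_cong_sets[OF sR refl]) (auto intro: measurable_coordinate)
  let ?E = "{\<omega> :: 'n path. regime_of (\<omega> s) = Active \<and> pos (\<omega> s) \<in> N}"
  let ?c = "cond_exp_given R state_space (\<lambda>\<omega>. \<omega> 0) (indicator ?E)"
  have E: "(indicator ?E :: _ \<Rightarrow> ennreal) \<in> borel_measurable R"
  proof -
    have "{y :: 'n state. regime_of y = Active} \<inter> (\<lambda>y. pos y) -` N \<in> sets state_space"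
      using measurable_sets[OF measurable_pos N] by (intro sets.Int sets_regime_of) simp
    then have "indicator ({y :: 'n state. regime_of y = Active} \<inter> (\<lambda>y. pos y) -` N)
        \<in> borel_measurable state_space" by simp
    from measurable_compose[OF cs this] show ?thesis by (simp add: indicator_def[abs_def])
  qed
  have univ: "UNIV \<in> sets (state_space :: 'n state measure)"
    using sets.top[of "state_space :: 'n state measure"] by simp
  have c_meas: "?c \<in> borel_measurable state_space"
    unfolding cond_exp_given_def by simp
  \<comment> \<open>Averaging the conditional probability of \<open>?E\<close> over the initial law
    gives the probability of \<open>?E\<close>, which is 0. So it vanishes for almost every starting
    point.\<close>
  have "(\<integral>\<^sup>+y. ?c y \<partial>law_at R 0) = emeasure (density (law_at R 0) (\<lambda>y. 1 * ?c y)) UNIV"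
    using c_meas univ by (subst emeasure_density) (simp_all add: law_at_def)
  also have "\<dots> = emeasure (distr (density R (\<lambda>\<omega>. 1 * indicator ?E \<omega>)) state_space (\<lambda>\<omega>. \<omega> 0)) UNIV"
    unfolding law_at_def
    by (subst distr_density_comp_mult[OF R c0 _ E, of "\<lambda>_. 1", symmetric]) simp_all
  also have "\<dots> = (\<integral>\<^sup>+\<omega>. indicator ?E \<omega> \<partial>R)"
  proof -
    have "emeasure (distr (density R (\<lambda>\<omega>. 1 * indicator ?E \<omega>)) state_space (\<lambda>\<omega>. \<omega> 0)) UNIV
        = emeasure (density R (indicator ?E)) (space R)"
      using univ by (subst emeasure_distr) simp_all
    also have "\<dots> = (\<integral>\<^sup>+\<omega>. indicator ?E \<omega> * indicator (space R) \<omega> \<partial>R)"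
      by (rule emeasure_density[OF E sets.top])
    also have "\<dots> = (\<integral>\<^sup>+\<omega>. indicator ?E \<omega> \<partial>R)" by (intro nn_integral_cong) simp
    finally show ?thesis .
  qed
  also have "\<dots> = 0"
    using null by (subst nn_integral_0_iff_AE[OF E]) (auto elim!: eventually_mono simp: indicator_def)
  finally have "AE y in law_at R 0. ?c y = 0"
    using c_meas by (subst (asm) nn_integral_0_iff_AE) (simp_all add: law_at_def)
  moreover have "AE y in law_at R 0. regime_of y = Active"
    unfolding law_at_def using act by (subst AE_distr_iff) simp_all
  moreover have "AE y in law_at R 0. regime_of y = Active \<longrightarrow>
      ?c y = (\<integral>\<^sup>+ z. ennreal (q 0 (pos y) s z) * indicator N z \<partial>lborel)"
    using q s N unfolding active_transition_density_def by blast
  ultimately have "AE y in law_at R 0. (\<integral>\<^sup>+ z. ennreal (q 0 (pos y) s z) * indicator N z \<partial>lborel) = 0"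
    by eventually_elim simp
  \<comment> \<open>A single good starting point suffices, since \<open>q\<close> is positive from
    each one; it exists because the initial law is not the zero measure.\<close>
  moreover have "\<not> (AE y in law_at R 0. False)"
    using R.prob_space_distr[OF c0] unfolding law_at_def by (simp add: prob_space.AE_False)
  ultimately have "\<exists>y :: 'n state. (\<integral>\<^sup>+ z. ennreal (q 0 (pos y) s z) * indicator N z \<partial>lborel) = 0"
    using eventually_mono[where Q = "\<lambda>_. False"] by blast
  then obtain y :: "'n state" where y: "(\<integral>\<^sup>+ z. ennreal (q 0 (pos y) s z) * indicator N z \<partial>lborel) = 0"
    by blast
  have [measurable]: "(\<lambda>z. q 0 (pos y) s z) \<in> borel_measurable borel"
    using measurable_transition_density_section[OF q _ s] by simp
  have "AE z in lborel. ennreal (q 0 (pos y) s z) * indicator N z = 0"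
    using y N by (subst (asm) nn_integral_0_iff_AE) simp_all
  then show ?thesis
  proof (rule eventually_mono)
    fix z assume z: "ennreal (q 0 (pos y) s z) * indicator N z = 0"
    have "0 < q 0 (pos y) s z"
      using q s unfolding active_transition_density_def by blast
    then have "ennreal (q 0 (pos y) s z) \<noteq> 0" by simp
    then show "z \<notin> N" using z by (auto simp: indicator_def)
  qed
qed

lemma sets_killing_null:
  fixes V :: "real \<Rightarrow> real^'n::finite \<Rightarrow> real"
  assumes V: "C_bounded T V" and N[measurable]: "N \<in> sets borel"
  shows "{p. fst p \<in> {0..T} \<longrightarrow> (snd p, fst p) \<in> N \<longrightarrow> V (fst p) (snd p) = 0} \<in> sets (borel \<Otimes>\<^sub>M borel)"
proof -
  have [measurable]: "(\<lambda>p. if fst p \<in> {0..T} then V (fst p) (snd p) else 0) \<in> borel_measurable (borel \<Otimes>\<^sub>M borel)"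
    by (rule measurable_cutoff[OF V])
  have [measurable]: "(\<lambda>p. (snd p, fst p)) \<in> borel \<Otimes>\<^sub>M borel \<rightarrow>\<^sub>M (borel :: ((real^'n) \<times> real) measure)"
    unfolding borel_prod[symmetric] by measurable
  have "{p \<in> space (borel \<Otimes>\<^sub>M borel). (snd p, fst p) \<in> N \<longrightarrow>
      (if fst p \<in> {0..T} then V (fst p) (snd p) else 0) = 0} \<in> sets (borel \<Otimes>\<^sub>M borel)"
    by measurable
  also have "{p \<in> space (borel \<Otimes>\<^sub>M borel). (snd p, fst p) \<in> N \<longrightarrow>
      (if fst p \<in> {0..T} then V (fst p) (snd p) else 0) = 0}
    = {p. fst p \<in> {0..T} \<longrightarrow> (snd p, fst p) \<in> N \<longrightarrow> V (fst p) (snd p) = 0}"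
    by (auto simp: space_pair_measure)
  finally show ?thesis .
qed

text \<open>For almost every time \<open>r\<close>, the active position at \<open>r\<close> avoids
  the points of the slice of \<open>N\<close> where \<open>V\<close> is nonzero. By positivity of
  \<open>q\<close> such a slice is Lebesgue null, and Fubini joins the slices.\<close>

lemma AE_lborel_of_dead_law:
  fixes R :: "('n::finite) path measure"
  assumes R: "prob_space R" and sR: "sets R = sets (path_space T psi1)"
    and act: "AE \<omega> in R. regime_of (\<omega> 0) = Active"
    and sde: "sde_with_killing T b \<sigma> V psi1 R" and q: "active_transition_density T R q"
    and V: "C_bounded T V" and T: "0 < T" and V0: "\<And>t x. t \<in> {0..T} \<Longrightarrow> 0 \<le> V t x"
    and N: "N \<in> sets borel" and null: "AE \<omega> in R. regime_of (\<omega> T) = Dead \<longrightarrow> fst (\<omega> T) \<notin> N"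
  shows "AE p in lborel. fst p \<in> {0..T} \<longrightarrow> (snd p, fst p) \<in> N \<longrightarrow> V (fst p) (snd p) = 0"
proof -
  have "AE r in lborel. AE \<omega> in R. (pos (\<omega> (clip T r)), r) \<in> N \<longrightarrow> intensity T V r \<omega> = 0"
    by (rule AE_intensity_zero[OF R sR act sde V T V0 N null])
  moreover have "AE r in lborel. r \<noteq> (0::real)" by (rule AE_lborel_singleton)
  ultimately have "AE r in lborel. AE z in lborel. r \<in> {0..T} \<longrightarrow> (z, r) \<in> N \<longrightarrow> V r z = 0"
  proof eventually_elim
    fix r :: real
    assume a: "AE \<omega> in R. (pos (\<omega> (clip T r)), r) \<in> N \<longrightarrow> intensity T V r \<omega> = 0" and r0: "r \<noteq> 0"
    show "AE z in lborel. r \<in> {0..T} \<longrightarrow> (z, r) \<in> N \<longrightarrow> V r z = 0"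
    proof (cases "r \<in> {0..T}")
      case True
      let ?S = "{p. fst p \<in> {0..T} \<longrightarrow> (snd p, fst p) \<in> N \<longrightarrow> V (fst p) (snd p) = 0}"
      \<comment> \<open>The part of the slice at \<open>r\<close> on which killing can occur; an
        active path avoids it at time \<open>r\<close> almost surely, because the intensity is
        \<open>V\<close> there.\<close>
      let ?N = "{z. (z, r) \<in> N \<and> V r z \<noteq> 0}"
      have "Pair r -` ?S \<inter> space borel \<in> sets borel"
        by (rule measurable_sets[OF _ sets_killing_null[OF V N]]) (rule measurable_Pair1', simp)
      then have "- (Pair r -` ?S) \<in> sets borel"
        unfolding space_borel Int_UNIV_right by (rule borel_comp)
      also have "- (Pair r -` ?S) = ?N" using True unfolding vimage_def by auto
      finally have "?N \<in> sets borel" .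
      moreover have "AE \<omega> in R. regime_of (\<omega> r) = Active \<longrightarrow> pos (\<omega> r) \<notin> ?N"
        using a by (rule eventually_mono) (use True in \<open>auto simp: intensity_def\<close>)
      moreover have "0 < r" "r \<le> T" using True r0 by simp_all
      ultimately have "AE z in lborel. z \<notin> ?N"
        by (intro AE_lborel_of_active_law[OF R sR act q T])
      then show ?thesis by (rule eventually_mono) simp
    qed auto
  qed
  note ae = this
  have e: "sets (lborel \<Otimes>\<^sub>M lborel) = sets (borel \<Otimes>\<^sub>M (borel :: (real^'n) measure))"
    by (rule sets_pair_measure_cong) simp_all
  have m: "{p \<in> space (lborel \<Otimes>\<^sub>M lborel). fst p \<in> {0..T} \<longrightarrow> (snd p, fst p) \<in> N \<longrightarrow> V (fst p) (snd p) = 0}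
      \<in> sets (lborel \<Otimes>\<^sub>M lborel)"
    using sets_killing_null[OF V N] unfolding e by (simp add: space_pair_measure)
  have "AE p in lborel \<Otimes>\<^sub>M lborel. fst p \<in> {0..T} \<longrightarrow> (snd p, fst p) \<in> N \<longrightarrow> V (fst p) (snd p) = 0"
    by (rule lborel_pair.AE_pair_measure[OF m]) (unfold fst_conv snd_conv, rule ae)
  then show ?thesis by (simp only: lborel_prod)
qed

lemma AE_lborel_swap:
  assumes "AE p in (lborel :: ('a::euclidean_space \<times> 'b::euclidean_space) measure). Q p"
  shows "AE p in lborel. Q (snd p, fst p)"
proof -
  have "AE p in distr (lborel \<Otimes>\<^sub>M lborel) (lborel \<Otimes>\<^sub>M lborel) (\<lambda>(x :: 'b, y :: 'a). (y, x)). Q p"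
    using assms unfolding lborel_prod[symmetric] by (subst (asm) lborel_pair.distr_pair_swap)
  from AE_distrD[OF measurable_pair_swap' this] show ?thesis
    unfolding lborel_prod by (simp add: case_prod_beta')
qed

text \<open>Transfers almost sure statements about the terminal state to Lebesgue measure, on
  exactly the sets seen by the integrals in \<open>phi_active\<close>. In the dead part this means
  where \<open>V\<close> is nonzero, with time as the first coordinate.\<close>

lemma AE_lborel_of_terminal_law:
  fixes R :: "('n::finite) path measure"
  assumes R: "prob_space R" and sR: "sets R = sets (path_space T psi1)"
    and act: "AE \<omega> in R. regime_of (\<omega> 0) = Active"
    and sde: "sde_with_killing T b \<sigma> V psi1 R" and q: "active_transition_density T R q"
    and V: "C_bounded T V" and T: "0 < T" and V0: "\<And>t x. t \<in> {0..T} \<Longrightarrow> 0 \<le> V t x"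
    and Q: "{y. Q y} \<in> sets state_space" and ae: "AE y in law_at R T. Q y"
  shows "AE z in lborel. Q ((z, 0), Active)"
    and "AE p in lborel. fst p \<in> {0..T} \<longrightarrow> V (fst p) (snd p) \<noteq> 0 \<longrightarrow> Q ((snd p, fst p), Dead)"
proof -
  have cT: "(\<lambda>\<omega>. \<omega> T) \<in> R \<rightarrow>\<^sub>M state_space"
    using T by (subst measurable_cong_sets[OF sR refl]) (auto intro: measurable_coordinate)
  have QT: "AE \<omega> in R. Q (\<omega> T)" using ae unfolding law_at_def by (rule AE_distrD[OF cT])
  have sp: "AE \<omega> in R. \<omega> \<in> path_set T psi1"
    using sets_eq_imp_space_eq[OF sR] by (intro AE_I2) (simp add: space_path_space)
  have m1: "(\<lambda>z. ((z, 0), Active)) \<in> borel \<rightarrow>\<^sub>M (state_space :: 'n state measure)"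
    by (intro measurable_stateI) simp_all
  have m2: "(\<lambda>p. (p, Dead)) \<in> borel \<rightarrow>\<^sub>M (state_space :: 'n state measure)"
    unfolding state_space_def by measurable
  have N1: "{z. \<not> Q ((z, 0), Active)} \<in> sets borel"
    using borel_comp[OF measurable_sets[OF m1 Q, unfolded space_borel Int_UNIV_right]]
    by (simp add: vimage_def Collect_neg_eq)
  have N2: "{p. \<not> Q (p, Dead)} \<in> sets borel"
    using borel_comp[OF measurable_sets[OF m2 Q, unfolded space_borel Int_UNIV_right]]
    by (simp add: vimage_def Collect_neg_eq)
  have "AE \<omega> in R. regime_of (\<omega> T) = Active \<longrightarrow> pos (\<omega> T) \<notin> {z. \<not> Q ((z, 0), Active)}"
    using QT sp
  proof eventually_elim
    fix \<omega> :: "'n path" assume Q: "Q (\<omega> T)" and \<omega>: "\<omega> \<in> path_set T psi1"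
    have "\<omega> T = ((pos (\<omega> T), 0), Active)" if a: "regime_of (\<omega> T) = Active"
    proof -
      have "ktime (\<omega> T) = 0"
        using \<omega> a T unfolding path_set_def by fastforce
      then show ?thesis using a by (metis prod.collapse)
    qed
    then show "regime_of (\<omega> T) = Active \<longrightarrow> pos (\<omega> T) \<notin> {z. \<not> Q ((z, 0), Active)}"
      using Q by auto
  qed
  from AE_lborel_of_active_law[OF R sR act q T T order_refl N1 this]
  show "AE z in lborel. Q ((z, 0), Active)" by simp
  have "AE \<omega> in R. regime_of (\<omega> T) = Dead \<longrightarrow> fst (\<omega> T) \<notin> {p. \<not> Q (p, Dead)}"
    using QT by (rule eventually_mono) (metis mem_Collect_eq prod.collapse)
  from AE_lborel_of_dead_law[OF R sR act sde q V T V0 N2 this]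
  show "AE p in lborel. fst p \<in> {0..T} \<longrightarrow> V (fst p) (snd p) \<noteq> 0 \<longrightarrow> Q ((snd p, fst p), Dead)"
    by (rule eventually_mono) auto
qed

text \<open>The complement of the support is covered by countably many null boxes from a countable
  basis. This turns the bound on the support in (B) into an almost sure bound.\<close>

lemma AE_state_support:
  fixes M :: "('n::finite) state measure"
  assumes sM: "sets M = sets state_space"
  shows "AE y in M. y \<in> state_support M"
proof -
  obtain \<B> :: "((real^'n) \<times> real) set set" where \<B>: "countable \<B>" "topological_basis \<B>"
    using ex_countable_basis by blast
  define W where "W = (\<Union>p\<in>{p \<in> \<B> \<times> (UNIV :: regime set). emeasure M (fst p \<times> {snd p}) = 0}. fst p \<times> {snd p})"
  have U: "U \<times> {i} \<in> sets M" if "open U" for U :: "((real^'n) \<times> real) set" and i :: regime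
    unfolding sM state_space_def using that by (intro pair_measureI) auto
  have "countable (UNIV :: regime set)"
  proof -
    have "(UNIV :: regime set) = {Active, Dead}" by (auto intro: regime.exhaust)
    then show ?thesis by (metis countable_finite finite.emptyI finite.insertI)
  qed
  then have "W \<in> null_sets M"
    unfolding W_def using \<B> U topological_basis_open[OF \<B>(2)]
    by (intro null_sets_UN' countable_subset[OF _ countable_SIGMA[OF \<B>(1)]]) (auto intro!: null_setsI)
  moreover have "{y \<in> space M. \<not> y \<in> state_support M} \<subseteq> W"
  proof
    fix y assume "y \<in> {y \<in> space M. \<not> y \<in> state_support M}"
    then obtain U where o: "open U" "fst y \<in> U" "emeasure M (U \<times> {snd y}) = 0"
      by (auto simp: state_support_def case_prod_beta')
    then obtain B where B: "B \<in> \<B>" "fst y \<in> B" "B \<subseteq> U"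
      using topological_basisE[OF \<B>(2)] by metis
    have "emeasure M (B \<times> {snd y}) \<le> emeasure M (U \<times> {snd y})"
      using B U[OF o(1)] by (intro emeasure_mono) auto
    then have "emeasure M (B \<times> {snd y}) = 0" using o(3) by simp
    then show "y \<in> W" unfolding W_def using B by (intro UN_I[of "(B, snd y)"]) (auto simp: mem_Times_iff)
  qed
  ultimately show ?thesis by (rule AE_I')
qed

text \<open>No differentiability is required: \<open>frechet_derivative\<close> chooses from the set
  of derivatives, and adding a constant leaves this set unchanged, even when it is empty.\<close>

lemma grad_add_const: "grad (\<lambda>x. a + f x) = grad f"
proof -
  have "((\<lambda>x. a + f x) has_derivative f') (at x) \<longleftrightarrow> (f has_derivative f') (at x)" for f' x
  proof
    assume "((\<lambda>x. a + f x) has_derivative f') (at x)"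
    from has_derivative_add_const[OF this, of "- a"] show "(f has_derivative f') (at x)" by simp
  next
    assume "(f has_derivative f') (at x)"
    from has_derivative_add_const[OF this, of a] show "((\<lambda>x. a + f x) has_derivative f') (at x)"
      by (simp add: add.commute)
  qed
  then show ?thesis by (simp add: grad_def partial_def frechet_derivative_def fun_eq_iff)
qed

section \<open>The function phi of the bridge\<close>

text \<open>The extended value behind \<^const>\<open>phi_active\<close>, which maps both \<open>0\<close> and \<open>\<infinity>\<close> to \<open>0\<close>.\<close>

definition phi_ennreal ::
    "real \<Rightarrow> (real \<Rightarrow> real^'n \<Rightarrow> real \<Rightarrow> real^'n \<Rightarrow> real) \<Rightarrow> (real \<Rightarrow> real^'n \<Rightarrow> real)
      \<Rightarrow> (('n::finite) state \<Rightarrow> real) \<Rightarrow> real \<Rightarrow> real^'n \<Rightarrow> ennreal" where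
  "phi_ennreal T q V g t x =
     (\<integral>\<^sup>+ z. ennreal (q t x T z * g ((z, 0), Active)) \<partial>lborel)
   + (\<integral>\<^sup>+ z. (\<integral>\<^sup>+ r. ennreal (q t x r z * V r z * g ((z, r), Dead)) * indicator {t<..T} r \<partial>lborel)
       \<partial>lborel)"

lemma phi_active_psi1: "phi_active T q V psi1 g t x = enn2real (phi_ennreal T q V g t x)"
  by (simp add: phi_active_def phi_ennreal_def psi1_def)

text \<open>Expresses Scenario (2) through the formula of Scenario (1), so that only two terminal
  functions remain to be compared.\<close>

lemma phi_active_psi2: "phi_active T q V (psi2 c) g t x = phi_active T q V psi1 (g \<circ> collapse c) t x"
  by (simp add: phi_active_def psi1_def psi2_def collapse_def)

locale phi_setting =
  fixes T :: real and R :: "('n::finite) path measure"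
    and q :: "real \<Rightarrow> real^'n \<Rightarrow> real \<Rightarrow> real^'n \<Rightarrow> real" and V :: "real \<Rightarrow> real^'n \<Rightarrow> real"
    and g :: "'n state \<Rightarrow> real" and t :: real
  assumes q: "active_transition_density T R q" and V: "C_bounded T V"
    and V0: "\<And>t x. t \<in> {0..T} \<Longrightarrow> 0 \<le> V t x"
    and g[measurable]: "g \<in> borel_measurable state_space" and g0: "\<And>y. 0 \<le> g y"
    and t: "0 \<le> t" "t < T"
begin

lemma q_pos: "t < r \<Longrightarrow> r \<le> T \<Longrightarrow> 0 < q t x r z"
  using q t unfolding active_transition_density_def by auto

lemma active_measurable [measurable]: "(\<lambda>z. q t x T z * g ((z, 0), Active)) \<in> borel_measurable borel"
proof -
  have [measurable]: "(\<lambda>z. q t x T z) \<in> borel_measurable borel"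
    using measurable_transition_density_section[OF q t(1,2)] by simp
  have [measurable]: "(\<lambda>z. ((z, 0), Active)) \<in> borel \<rightarrow>\<^sub>M (state_space :: 'n state measure)"
    by (intro measurable_stateI) simp_all
  show ?thesis by measurable
qed

lemma dead_measurable [measurable]:
  "(\<lambda>p. ennreal (q t x (snd p) (fst p) * V (snd p) (fst p) * g (p, Dead)) * indicator {t<..T} (snd p))
    \<in> borel_measurable (borel \<Otimes>\<^sub>M borel)"
proof -
  have sw: "(\<lambda>p. (snd p, fst p)) \<in> (borel :: (real^'n) measure) \<Otimes>\<^sub>M (borel :: real measure) \<rightarrow>\<^sub>M borel \<Otimes>\<^sub>M borel"
    by measurable
  note [measurable] = measurable_compose[OF sw measurable_transition_density[OF q t(1), of x]]
    measurable_compose[OF sw measurable_cutoff[OF V]]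
  have [measurable]: "(\<lambda>p. (p, Dead)) \<in> borel \<Otimes>\<^sub>M borel \<rightarrow>\<^sub>M (state_space :: 'n state measure)"
    unfolding state_space_def borel_prod by measurable
  have "(\<lambda>p. ennreal ((indicat_real ({t<..T} \<times> UNIV) (snd p, fst p) * q t x (fst (snd p, fst p)) (snd (snd p, fst p)))
      * (if fst (snd p, fst p) \<in> {0..T} then V (fst (snd p, fst p)) (snd (snd p, fst p)) else 0) * g (p, Dead)))
    \<in> borel_measurable (borel \<Otimes>\<^sub>M borel)"
    by measurable
  also have "(\<lambda>p. ennreal ((indicat_real ({t<..T} \<times> UNIV) (snd p, fst p) * q t x (fst (snd p, fst p)) (snd (snd p, fst p)))
      * (if fst (snd p, fst p) \<in> {0..T} then V (fst (snd p, fst p)) (snd (snd p, fst p)) else 0) * g (p, Dead)))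
    = (\<lambda>p. ennreal (q t x (snd p) (fst p) * V (snd p) (fst p) * g (p, Dead)) * indicator {t<..T} (snd p))"
    using t by (auto simp: fun_eq_iff indicator_def)
  finally show ?thesis .
qed

text \<open>With a single integral over positions and times, statements almost everywhere on the
  product apply directly.\<close>

lemma phi_ennreal_altdef: "phi_ennreal T q V g t x =
     (\<integral>\<^sup>+ z. ennreal (q t x T z * g ((z, 0), Active)) \<partial>lborel)
   + (\<integral>\<^sup>+ p. ennreal (q t x (snd p) (fst p) * V (snd p) (fst p) * g (p, Dead)) * indicator {t<..T} (snd p) \<partial>lborel)"
  unfolding phi_ennreal_def lborel_prod[symmetric]
  by (subst lborel.nn_integral_fst[symmetric]) simp_all

text \<open>Since \<open>q\<close> is positive, it drops out of the criterion. The right-hand side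
  is free of \<open>x\<close>, so phi at time \<open>t\<close> vanishes for all \<open>x\<close> or
  for none.\<close>

lemma phi_ennreal_eq_0_iff: "phi_ennreal T q V g t x = 0 \<longleftrightarrow>
    (AE z in lborel. g ((z, 0), Active) = 0)
    \<and> (AE p in lborel. snd p \<in> {t<..T} \<longrightarrow> V (snd p) (fst p) * g (p, Dead) = 0)"
proof -
  have 1: "ennreal (q t x T z * g ((z, 0), Active)) = 0 \<longleftrightarrow> g ((z, 0), Active) = 0" for z
    using q_pos[of T x z] g0[of "((z, 0), Active)"] t
    by (auto simp: ennreal_eq_0_iff mult_le_0_iff)
  have 2: "ennreal (q t x (snd p) (fst p) * V (snd p) (fst p) * g (p, Dead)) * indicator {t<..T} (snd p) = 0
      \<longleftrightarrow> (snd p \<in> {t<..T} \<longrightarrow> V (snd p) (fst p) * g (p, Dead) = 0)" for p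
  proof (cases "snd p \<in> {t<..T}")
    case True
    then have "0 < q t x (snd p) (fst p)" "0 \<le> V (snd p) (fst p) * g (p, Dead)"
      using q_pos V0 g0 t by auto
    moreover have "ennreal (a * w) = 0 \<longleftrightarrow> w = 0" if "0 < a" "0 \<le> w" for a w :: real
      using that by (auto simp: ennreal_eq_0_iff mult_le_0_iff)
    ultimately have "ennreal (q t x (snd p) (fst p) * (V (snd p) (fst p) * g (p, Dead))) = 0
        \<longleftrightarrow> V (snd p) (fst p) * g (p, Dead) = 0" by blast
    then show ?thesis using True by (simp only: mult.assoc) simp
  qed auto
  have m: "(\<lambda>p. ennreal (q t x (snd p) (fst p) * V (snd p) (fst p) * g (p, Dead)) * indicator {t<..T} (snd p))
    \<in> borel_measurable lborel"
    using dead_measurable by (simp add: borel_prod)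
  have m1: "(\<lambda>z. ennreal (q t x T z * g ((z, 0), Active))) \<in> borel_measurable lborel" by simp
  show ?thesis
    unfolding phi_ennreal_altdef add_eq_0_iff_both_eq_0
    by (simp only: nn_integral_0_iff_AE[OF m1] nn_integral_0_iff_AE[OF m] 1 2)
qed

text \<open>The dead part of \<open>g\<close> enters only through its product with \<open>V\<close>,
  so proportionality is needed only where \<open>V\<close> is nonzero.\<close>

lemma phi_ennreal_cmult:
  assumes k: "0 \<le> k"
    and a: "AE z in lborel. g' ((z, 0), Active) = k * g ((z, 0), Active)"
    and d: "AE p in lborel. snd p \<in> {0..T} \<longrightarrow> V (snd p) (fst p) \<noteq> 0 \<longrightarrow> g' (p, Dead) = k * g (p, Dead)"
    and m': "phi_setting T R q V g' t"
  shows "phi_ennreal T q V g' t x = ennreal k * phi_ennreal T q V g t x"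
proof -
  have m: "(\<lambda>p. ennreal (q t x (snd p) (fst p) * V (snd p) (fst p) * g (p, Dead)) * indicator {t<..T} (snd p))
    \<in> borel_measurable lborel"
    using dead_measurable by (simp add: borel_prod)
  have "(\<integral>\<^sup>+ z. ennreal (q t x T z * g' ((z, 0), Active)) \<partial>lborel)
      = (\<integral>\<^sup>+ z. ennreal k * ennreal (q t x T z * g ((z, 0), Active)) \<partial>lborel)"
    using a k by (intro nn_integral_cong_AE) (auto elim!: eventually_mono simp: ennreal_mult'[symmetric] ac_simps)
  also have "\<dots> = ennreal k * (\<integral>\<^sup>+ z. ennreal (q t x T z * g ((z, 0), Active)) \<partial>lborel)"
    by (rule nn_integral_cmult) simp
  finally have 1: "(\<integral>\<^sup>+ z. ennreal (q t x T z * g' ((z, 0), Active)) \<partial>lborel)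
    = ennreal k * (\<integral>\<^sup>+ z. ennreal (q t x T z * g ((z, 0), Active)) \<partial>lborel)" .
  have "(\<integral>\<^sup>+ p. ennreal (q t x (snd p) (fst p) * V (snd p) (fst p) * g' (p, Dead)) * indicator {t<..T} (snd p) \<partial>lborel)
    = (\<integral>\<^sup>+ p. ennreal k * (ennreal (q t x (snd p) (fst p) * V (snd p) (fst p) * g (p, Dead))
        * indicator {t<..T} (snd p)) \<partial>lborel)"
  proof (rule nn_integral_cong_AE, rule eventually_mono[OF d])
    fix p assume p: "snd p \<in> {0..T} \<longrightarrow> V (snd p) (fst p) \<noteq> 0 \<longrightarrow> g' (p, Dead) = k * g (p, Dead)"
    show "ennreal (q t x (snd p) (fst p) * V (snd p) (fst p) * g' (p, Dead)) * indicator {t<..T} (snd p)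
      = ennreal k * (ennreal (q t x (snd p) (fst p) * V (snd p) (fst p) * g (p, Dead)) * indicator {t<..T} (snd p))"
    proof (cases "snd p \<in> {t<..T} \<and> V (snd p) (fst p) \<noteq> 0")
      case True
      then have "g' (p, Dead) = k * g (p, Dead)" using p t by auto
      then show ?thesis using True k by (simp add: ennreal_mult'[symmetric] ac_simps)
    qed auto
  qed
  also have "\<dots> = ennreal k * (\<integral>\<^sup>+ p. ennreal (q t x (snd p) (fst p) * V (snd p) (fst p) * g (p, Dead))
        * indicator {t<..T} (snd p) \<partial>lborel)"
    by (rule nn_integral_cmult[OF m])
  finally show ?thesis
    unfolding phi_ennreal_altdef phi_setting.phi_ennreal_altdef[OF m'] 1
    by (simp add: distrib_left)
qed

text \<open>As \<open>q\<close> is sub-Markovian, the active term is at most \<open>C\<close> and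
  the dead term at most \<open>B * C * (T - t)\<close>, with \<open>B\<close> a bound for
  \<open>V\<close>.\<close>

lemma phi_ennreal_finite:
  assumes C: "0 \<le> C" and a: "AE z in lborel. g ((z, 0), Active) \<le> C"
    and d: "AE p in lborel. snd p \<in> {0..T} \<longrightarrow> V (snd p) (fst p) \<noteq> 0 \<longrightarrow> g (p, Dead) \<le> C"
  shows "phi_ennreal T q V g t x < \<infinity>"
proof -
  obtain B where B: "\<forall>t\<in>{0..T}. \<forall>x. \<bar>V t x\<bar> \<le> B" using V by (auto simp: C_bounded_def)
  have "\<bar>V t 0\<bar> \<le> B" using B t by simp
  then have B0: "0 \<le> B" by linarith
  have sub: "(\<integral>\<^sup>+ z. ennreal (q t x r z) \<partial>lborel) \<le> 1" if "t < r" "r \<le> T" for r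
    using q t that unfolding active_transition_density_def by auto
  have [measurable]: "(\<lambda>z. q t x T z) \<in> borel_measurable borel"
    using measurable_transition_density_section[OF q t(1,2)] by simp
  have "(\<integral>\<^sup>+ z. ennreal (q t x T z * g ((z, 0), Active)) \<partial>lborel)
      \<le> (\<integral>\<^sup>+ z. ennreal C * ennreal (q t x T z) \<partial>lborel)"
  proof (rule nn_integral_mono_AE, rule eventually_mono[OF a])
    fix z assume "g ((z, 0), Active) \<le> C"
    moreover have "0 \<le> q t x T z" using q_pos[of T x z] t by simp
    ultimately have "q t x T z * g ((z, 0), Active) \<le> C * q t x T z"
      by (subst mult.commute) (rule mult_right_mono)
    then show "ennreal (q t x T z * g ((z, 0), Active)) \<le> ennreal C * ennreal (q t x T z)"
      using C by (simp add: ennreal_mult'[symmetric] ennreal_leI)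
  qed
  also have "\<dots> = ennreal C * (\<integral>\<^sup>+ z. ennreal (q t x T z) \<partial>lborel)"
    by (rule nn_integral_cmult) simp
  also have "\<dots> < \<infinity>" using sub[of T] t by (simp add: ennreal_mult_less_top le_less_trans)
  finally have 1: "(\<integral>\<^sup>+ z. ennreal (q t x T z * g ((z, 0), Active)) \<partial>lborel) < \<infinity>" .
  let ?Q = "\<lambda>p. ennreal (indicat_real ({t<..T} \<times> UNIV) p * q t x (fst p) (snd p))"
  have sw: "(\<lambda>p. (snd p, fst p)) \<in> (borel :: (real^'n) measure) \<Otimes>\<^sub>M (borel :: real measure) \<rightarrow>\<^sub>M borel \<Otimes>\<^sub>M borel"
    by measurable
  have Qm[measurable]: "?Q \<in> borel_measurable (borel \<Otimes>\<^sub>M borel)"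
    using measurable_transition_density[OF q t(1), of x] by simp
  have Qs: "(\<lambda>p. ennreal (B * C) * ?Q (snd p, fst p)) \<in> borel_measurable (lborel \<Otimes>\<^sub>M lborel)"
    by (subst measurable_cong_sets[OF sets_pair_measure_cong[OF sets_lborel sets_lborel] refl],
        rule borel_measurable_times_ennreal[OF borel_measurable_const measurable_compose[OF sw Qm]])
  have "(\<integral>\<^sup>+ p. ennreal (q t x (snd p) (fst p) * V (snd p) (fst p) * g (p, Dead)) * indicator {t<..T} (snd p) \<partial>lborel)
      \<le> (\<integral>\<^sup>+ p. ennreal (B * C) * ?Q (snd p, fst p) \<partial>lborel)"
  proof (rule nn_integral_mono_AE, rule eventually_mono[OF d])
    fix p assume p: "snd p \<in> {0..T} \<longrightarrow> V (snd p) (fst p) \<noteq> 0 \<longrightarrow> g (p, Dead) \<le> C"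
    show "ennreal (q t x (snd p) (fst p) * V (snd p) (fst p) * g (p, Dead)) * indicator {t<..T} (snd p)
      \<le> ennreal (B * C) * ?Q (snd p, fst p)"
    proof (cases "snd p \<in> {t<..T} \<and> V (snd p) (fst p) \<noteq> 0")
      case True
      then have g: "g (p, Dead) \<le> C" and r: "snd p \<in> {0..T}" using p t by auto
      have "V (snd p) (fst p) * g (p, Dead) \<le> B * C"
        using B r g g0 B0 by (intro mult_mono) (auto intro: order_trans[OF abs_ge_self])
      moreover have "0 \<le> q t x (snd p) (fst p)" using q_pos True by (simp add: less_imp_le)
      ultimately have "q t x (snd p) (fst p) * (V (snd p) (fst p) * g (p, Dead)) \<le> q t x (snd p) (fst p) * (B * C)"
        by (intro mult_left_mono)
      then show ?thesis using True B0 C by (simp add: ennreal_mult'[symmetric] ac_simps ennreal_leI)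
    qed auto
  qed
  also have "\<dots> = (\<integral>\<^sup>+ p. ennreal (B * C) * ?Q (snd p, fst p) \<partial>(lborel \<Otimes>\<^sub>M lborel))"
    by (simp only: lborel_prod)
  \<comment> \<open>The positions are integrated first, since the sub-Markov bound holds at each
    fixed time.\<close>
  also have "\<dots> = (\<integral>\<^sup>+ r. (\<integral>\<^sup>+ z. ennreal (B * C) * ?Q (r, z) \<partial>lborel) \<partial>lborel)"
    using lborel_pair.nn_integral_snd[OF Qs] by (simp only: fst_conv snd_conv)
  also have "\<dots> \<le> (\<integral>\<^sup>+ r. ennreal (B * C) * indicator {t..T} r \<partial>lborel)"
  proof (rule nn_integral_mono)
    fix r :: real
    show "(\<integral>\<^sup>+ z. ennreal (B * C) * ?Q (r, z) \<partial>lborel) \<le> ennreal (B * C) * indicator {t..T} r"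
    proof (cases "r \<in> {t<..T}")
      case True
      then have [measurable]: "(\<lambda>z. q t x r z) \<in> borel_measurable borel"
        using measurable_transition_density_section[OF q t(1)] by simp
      have "(\<integral>\<^sup>+ z. ennreal (B * C) * ?Q (r, z) \<partial>lborel) = ennreal (B * C) * (\<integral>\<^sup>+ z. ennreal (q t x r z) \<partial>lborel)"
        using True by (subst nn_integral_cmult[symmetric]) simp_all
      also have "\<dots> \<le> ennreal (B * C) * 1" using sub True by (intro mult_left_mono) auto
      finally show ?thesis using True by simp
    qed simp
  qed
  also have "\<dots> = ennreal (B * C) * emeasure lborel {t..T}"
    by (rule nn_integral_cmult_indicator) simp
  also have "\<dots> < \<infinity>" using t by (simp add: ennreal_mult_less_top)
  finally show ?thesis using 1 unfolding phi_ennreal_altdef by simp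
qed

end

section \<open>Admissible measures and uniqueness of the bridge\<close>

lemma distr_pair_measure_fst:
  assumes M: "prob_space M" and N: "prob_space N"
  shows "distr (M \<Otimes>\<^sub>M N) M fst = M"
proof (rule measure_eqI)
  interpret N: prob_space N by fact
  fix A assume A: "A \<in> sets (distr (M \<Otimes>\<^sub>M N) M fst)"
  then have "emeasure (distr (M \<Otimes>\<^sub>M N) M fst) A = emeasure (M \<Otimes>\<^sub>M N) (A \<times> space N)"
    by (subst emeasure_distr) (auto intro!: arg_cong2[where f = emeasure] dest: sets.sets_into_space
        simp: space_pair_measure)
  also have "\<dots> = emeasure M A"
    using A by (subst N.emeasure_pair_measure_Times) (simp_all add: N.emeasure_space_1)
  finally show "emeasure (distr (M \<Otimes>\<^sub>M N) M fst) A = emeasure M A" .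
qed simp

lemma distr_pair_measure_snd:
  assumes M: "prob_space M" and N: "prob_space N"
  shows "distr (M \<Otimes>\<^sub>M N) N snd = N"
proof (rule measure_eqI)
  interpret M: prob_space M by fact
  interpret N: prob_space N by fact
  fix A assume A: "A \<in> sets (distr (M \<Otimes>\<^sub>M N) N snd)"
  then have "emeasure (distr (M \<Otimes>\<^sub>M N) N snd) A = emeasure (M \<Otimes>\<^sub>M N) (space M \<times> A)"
    by (subst emeasure_distr) (auto intro!: arg_cong2[where f = emeasure] dest: sets.sets_into_space
        simp: space_pair_measure)
  also have "\<dots> = emeasure N A"
    using A by (subst N.emeasure_pair_measure_Times) (simp_all add: M.emeasure_space_1)
  finally show "emeasure (distr (M \<Otimes>\<^sub>M N) N snd) A = emeasure N A" .
qed simp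

lemma prob_space_embed_active:
  assumes "prob_space \<rho>" "sets \<rho> = sets borel"
  shows "prob_space (embed_active \<rho>)"
proof -
  have "(\<lambda>x. ((x, 0), Active)) \<in> \<rho> \<rightarrow>\<^sub>M state_space"
    by (intro measurable_stateI) (simp_all add: measurable_cong_sets[OF assms(2) refl])
  then show ?thesis unfolding embed_active_def using assms(1) by (intro prob_space.prob_space_distr)
qed

text \<open>(A) says that the product coupling has finite entropy relative to the endpoint law.
  Reweighting \<open>R\<close> by its density, evaluated at the endpoints, gives a path measure with
  these endpoints and the same entropy. Hence the minimum is finite.\<close>

lemma exists_admissible_finite_KL:
  fixes R :: "('n::finite) path measure"
  assumes R: "prob_space R" and sR: "sets R = sets (path_space T \<psi>)" and T: "0 < T"
    and \<rho>0: "prob_space \<rho>\<^sub>0" "sets \<rho>\<^sub>0 = sets borel"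
    and \<rho>T: "prob_space \<rho>\<^sub>T" "sets \<rho>\<^sub>T = sets state_space"
    and A: "assumption_A T R \<rho>\<^sub>0 \<rho>\<^sub>T"
  shows "\<exists>Q. admissible T \<psi> \<rho>\<^sub>0 \<rho>\<^sub>T Q \<and> KL Q R < \<infinity>"
proof -
  have c0[measurable]: "(\<lambda>\<omega>. \<omega> 0) \<in> R \<rightarrow>\<^sub>M state_space"
    using T by (subst measurable_cong_sets[OF sR refl]) (auto intro: measurable_coordinate)
  have cT[measurable]: "(\<lambda>\<omega>. \<omega> T) \<in> R \<rightarrow>\<^sub>M state_space"
    using T by (subst measurable_cong_sets[OF sR refl]) (auto intro: measurable_coordinate)
  let ?S = "state_space \<Otimes>\<^sub>M state_space :: ('n state \<times> 'n state) measure"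
  let ?Z = "\<lambda>\<omega> :: 'n path. (\<omega> 0, \<omega> T)"
  let ?E = "law_endpoints R T" and ?N = "embed_active \<rho>\<^sub>0 \<Otimes>\<^sub>M \<rho>\<^sub>T"
  have Z: "?Z \<in> R \<rightarrow>\<^sub>M ?S" by measurable
  have E: "?E = distr R ?S ?Z" by (simp add: law_endpoints_def)
  interpret E: prob_space ?E unfolding E using R Z by (rule prob_space.prob_space_distr)
  have e0: "prob_space (embed_active \<rho>\<^sub>0)" by (rule prob_space_embed_active[OF \<rho>0])
  interpret N0: prob_space "embed_active \<rho>\<^sub>0" by fact
  interpret NT: prob_space \<rho>\<^sub>T by fact
  interpret NP: pair_prob_space "embed_active \<rho>\<^sub>0" \<rho>\<^sub>T ..
  have sN: "sets ?N = sets ?S"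
    using \<rho>T(2) by (intro sets_pair_measure_cong) (simp_all add: embed_active_def)
  have fin: "KL ?N ?E < \<infinity>" using A by (simp add: assumption_A_def)
  then have ac: "absolutely_continuous ?E ?N" by (auto simp: KL_def split: if_splits)
  have sNE: "sets ?N = sets ?E" using sN by (simp add: E)
  obtain D where D: "D \<in> borel_measurable ?E" "AE y in ?E. RN_deriv ?E ?N y = ennreal (D y)"
    "\<And>y. 0 \<le> D y"
  proof (rule E.real_RN_deriv[OF _ ac sNE])
    show "finite_measure ?N" by unfold_locales
  qed (rule that)
  have Dm[measurable]: "D \<in> borel_measurable ?S" using D(1) by (simp add: E)
  have dens: "density ?E (\<lambda>y. ennreal (D y)) = ?N"
  proof -
    have "density ?E (\<lambda>y. ennreal (D y)) = density ?E (RN_deriv ?E ?N)"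
    proof (rule density_cong)
      show "(\<lambda>y. ennreal (D y)) \<in> borel_measurable ?E" using D(1) by simp
      show "AE y in ?E. ennreal (D y) = RN_deriv ?E ?N y"
        using D(2) by (rule eventually_mono) simp
    qed simp
    also have "\<dots> = ?N" by (rule E.density_RN_deriv[OF ac sNE])
    finally show ?thesis .
  qed
  \<comment> \<open>The conditional law of the path given its endpoints is kept; only the endpoint
    law is exchanged.\<close>
  let ?Q = "density R (\<lambda>\<omega>. ennreal (D (?Z \<omega>)))"
  have dQ: "distr ?Q ?S ?Z = ?N"
    using density_distr[of "\<lambda>y. ennreal (D y)" ?S ?Z R] Z dens by (simp add: E)
  have ZQ[measurable]: "?Z \<in> ?Q \<rightarrow>\<^sub>M ?S" using Z by simp
  have "emeasure ?Q (space ?Q) = emeasure (distr ?Q ?S ?Z) (space ?S)"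
    by (subst emeasure_distr[OF ZQ]) (auto intro!: arg_cong2[where f = emeasure]
        dest: measurable_space[OF Z])
  also have "\<dots> = emeasure ?N (space ?N)"
    unfolding dQ using sets_eq_imp_space_eq[OF sN] by simp
  also have "\<dots> = 1" by (rule NP.emeasure_space_1)
  finally have pQ: "prob_space ?Q" by (rule prob_spaceI)
  have l0: "law_at ?Q 0 = embed_active \<rho>\<^sub>0"
  proof -
    have "law_at ?Q 0 = distr (distr ?Q ?S ?Z) state_space fst"
      unfolding law_at_def by (subst distr_distr) (simp_all add: comp_def)
    also have "\<dots> = distr ?N (embed_active \<rho>\<^sub>0) fst"
      unfolding dQ by (intro distr_cong) (simp_all add: embed_active_def)
    finally show ?thesis using distr_pair_measure_fst[OF e0 \<rho>T(1)] by simp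
  qed
  have lT: "law_at ?Q T = \<rho>\<^sub>T"
  proof -
    have "law_at ?Q T = distr (distr ?Q ?S ?Z) state_space snd"
      unfolding law_at_def by (subst distr_distr) (simp_all add: comp_def)
    also have "\<dots> = distr ?N \<rho>\<^sub>T snd"
      unfolding dQ using \<rho>T by (intro distr_cong) simp_all
    finally show ?thesis using distr_pair_measure_snd[OF e0 \<rho>T(1)] by simp
  qed
  have "KL ?Q R = KL (density (distr R ?S ?Z) (\<lambda>y. ennreal (D y))) (distr R ?S ?Z)"
    by (rule KL_density_comp[OF R Z Dm D(3)])
  also have "\<dots> = KL ?N ?E" using dens by (simp add: E)
  finally have "KL ?Q R < \<infinity>" using fin by simp
  moreover have "admissible T \<psi> \<rho>\<^sub>0 \<rho>\<^sub>T ?Q"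
    using pQ sR l0 lT by (simp add: admissible_def)
  ultimately show ?thesis by blast
qed

text \<open>The marginal constraints are affine in the density, so they survive the passage to
  midpoints.\<close>

lemma law_at_density_midpoint:
  fixes R :: "('n::finite) path measure"
  assumes sR: "sets R = sets (path_space T \<psi>)" and t: "t \<in> {0..T}"
    and f[measurable]: "f \<in> borel_measurable R" and f0: "\<And>\<omega>. 0 \<le> f \<omega>"
    and g[measurable]: "g \<in> borel_measurable R" and g0: "\<And>\<omega>. (0::real) \<le> g \<omega>"
    and eq: "law_at (density R (\<lambda>\<omega>. ennreal (f \<omega>))) t = law_at (density R (\<lambda>\<omega>. ennreal (g \<omega>))) t"
  shows "law_at (density R (\<lambda>\<omega>. ennreal ((f \<omega> + g \<omega>) / 2))) t = law_at (density R (\<lambda>\<omega>. ennreal (g \<omega>))) t"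
proof (rule measure_eqI)
  have ct[measurable]: "(\<lambda>\<omega>. \<omega> t) \<in> R \<rightarrow>\<^sub>M state_space"
    by (subst measurable_cong_sets[OF sR refl]) (rule measurable_coordinate[OF t])
  fix A assume "A \<in> sets (law_at (density R (\<lambda>\<omega>. ennreal ((f \<omega> + g \<omega>) / 2))) t)"
  then have A: "A \<in> sets state_space" by (simp add: law_at_def)
  let ?B = "(\<lambda>\<omega>. \<omega> t) -` A \<inter> space R"
  have B[measurable]: "?B \<in> sets R" by (rule measurable_sets[OF ct A])
  have em: "emeasure (law_at (density R h) t) A = (\<integral>\<^sup>+\<omega>. h \<omega> * indicator ?B \<omega> \<partial>R)"
    if "h \<in> borel_measurable R" for h
    using that A B unfolding law_at_def by (subst emeasure_distr) (simp_all add: emeasure_density)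
  have half: "ennreal ((f \<omega> + g \<omega>) / 2) = ennreal (1 / 2) * (ennreal (f \<omega>) + ennreal (g \<omega>))" for \<omega>
  proof -
    have "ennreal (1 / 2) * (ennreal (f \<omega>) + ennreal (g \<omega>)) = ennreal (1 / 2) * ennreal (f \<omega> + g \<omega>)"
      using f0[of \<omega>] g0[of \<omega>] by (simp only: ennreal_plus)
    also have "\<dots> = ennreal (1 / 2 * (f \<omega> + g \<omega>))" by (rule ennreal_mult'[symmetric]) simp
    finally show ?thesis by simp
  qed
  have "emeasure (law_at (density R (\<lambda>\<omega>. ennreal ((f \<omega> + g \<omega>) / 2))) t) A
      = (\<integral>\<^sup>+\<omega>. ennreal (1 / 2) * (ennreal (f \<omega>) * indicator ?B \<omega> + ennreal (g \<omega>) * indicator ?B \<omega>) \<partial>R)"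
    by (subst em) (simp_all add: half distrib_right distrib_left mult.assoc)
  also have "\<dots> = ennreal (1 / 2) * ((\<integral>\<^sup>+\<omega>. ennreal (f \<omega>) * indicator ?B \<omega> \<partial>R)
      + (\<integral>\<^sup>+\<omega>. ennreal (g \<omega>) * indicator ?B \<omega> \<partial>R))"
    by (subst nn_integral_cmult, simp, subst nn_integral_add) simp_all
  also have "\<dots> = ennreal (1 / 2) * (emeasure (law_at (density R (\<lambda>\<omega>. ennreal (g \<omega>))) t) A
      + emeasure (law_at (density R (\<lambda>\<omega>. ennreal (g \<omega>))) t) A)"
    using em[of "\<lambda>\<omega>. ennreal (f \<omega>)"] em[of "\<lambda>\<omega>. ennreal (g \<omega>)"] eq by simp
  also have "\<dots> = (ennreal (1 / 2) + ennreal (1 / 2)) * emeasure (law_at (density R (\<lambda>\<omega>. ennreal (g \<omega>))) t) A"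
    by (simp only: distrib_left distrib_right)
  also have "\<dots> = emeasure (law_at (density R (\<lambda>\<omega>. ennreal (g \<omega>))) t) A"
  proof -
    have "ennreal (1 / 2) + ennreal (1 / 2) = ennreal (1 / 2 + 1 / 2)"
      by (rule ennreal_plus[symmetric]) simp_all
    then have "ennreal (1 / 2) + ennreal (1 / 2) = 1" by (simp only: field_sum_of_halves ennreal_1)
    then show ?thesis by (simp only: mult_1_left)
  qed
  finally show "emeasure (law_at (density R (\<lambda>\<omega>. ennreal ((f \<omega> + g \<omega>) / 2))) t) A
      = emeasure (law_at (density R (\<lambda>\<omega>. ennreal (g \<omega>))) t) A" .
qed (simp add: law_at_def)

text \<open>The midpoint of two competitors of the same minimal entropy is admissible, hence cannot
  have smaller entropy; strict convexity then identifies them.\<close>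

lemma schroedinger_bridge_unique:
  fixes R :: "('n::finite) path measure"
  assumes R: "prob_space R" and sR: "sets R = sets (path_space T \<psi>)" and T: "0 < T"
    and f[measurable]: "f \<in> borel_measurable R" and f0: "\<And>\<omega>. 0 \<le> f \<omega>"
    and g[measurable]: "g \<in> borel_measurable R" and g0: "\<And>\<omega>. (0::real) \<le> g \<omega>"
    and P: "admissible T \<psi> \<rho>\<^sub>0 \<rho>\<^sub>T (density R (\<lambda>\<omega>. ennreal (f \<omega>)))"
    and Q: "schroedinger_bridge T \<psi> R \<rho>\<^sub>0 \<rho>\<^sub>T (density R (\<lambda>\<omega>. ennreal (g \<omega>)))"
    and eq: "KL (density R (\<lambda>\<omega>. ennreal (f \<omega>))) R = KL (density R (\<lambda>\<omega>. ennreal (g \<omega>))) R"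
    and fin: "KL (density R (\<lambda>\<omega>. ennreal (g \<omega>))) R < \<infinity>"
  shows "density R (\<lambda>\<omega>. ennreal (f \<omega>)) = density R (\<lambda>\<omega>. ennreal (g \<omega>))"
proof -
  have Q': "admissible T \<psi> \<rho>\<^sub>0 \<rho>\<^sub>T (density R (\<lambda>\<omega>. ennreal (g \<omega>)))"
    and min: "\<And>P. admissible T \<psi> \<rho>\<^sub>0 \<rho>\<^sub>T P \<Longrightarrow> KL (density R (\<lambda>\<omega>. ennreal (g \<omega>))) R \<le> KL P R"
    using Q unfolding schroedinger_bridge_def is_arg_min_linorder by auto
  let ?M = "density R (\<lambda>\<omega>. ennreal ((f \<omega> + g \<omega>) / 2))"
  have lM: "law_at ?M t = law_at (density R (\<lambda>\<omega>. ennreal (g \<omega>))) t" if "t = 0 \<or> t = T" for t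
    using that P Q' T by (intro law_at_density_midpoint[OF sR _ f f0 g g0]) (auto simp: admissible_def)
  have cT: "(\<lambda>\<omega>. \<omega> T) \<in> R \<rightarrow>\<^sub>M state_space"
    using T by (subst measurable_cong_sets[OF sR refl]) (auto intro: measurable_coordinate)
  have total: "emeasure (law_at P T) UNIV = emeasure P (space P)"
    if "sets P = sets R" for P :: "'n path measure"
  proof -
    have "(\<lambda>\<omega>. \<omega> T) \<in> P \<rightarrow>\<^sub>M state_space" using cT that by (simp cong: measurable_cong_sets)
    moreover have "UNIV \<in> sets (state_space :: 'n state measure)"
      using sets.top[of "state_space :: 'n state measure"] by simp
    ultimately show ?thesis unfolding law_at_def by (subst emeasure_distr) simp_all
  qed
  \<comment> \<open>The total mass is read off from the terminal law, which the midpoint shares with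
    the bridge.\<close>
  have "emeasure ?M (space ?M) = 1"
  proof -
    have "emeasure ?M (space ?M) = emeasure (density R (\<lambda>\<omega>. ennreal (g \<omega>))) (space (density R (\<lambda>\<omega>. ennreal (g \<omega>))))"
      by (subst (1 2) total[symmetric]) (simp_all add: lM)
    also have "\<dots> = 1" using Q' unfolding admissible_def by (intro prob_space.emeasure_space_1) blast
    finally show ?thesis .
  qed
  then have "prob_space ?M" by (rule prob_spaceI)
  then have "admissible T \<psi> \<rho>\<^sub>0 \<rho>\<^sub>T ?M"
    using lM Q' sR by (simp add: admissible_def)
  then have "KL (density R (\<lambda>\<omega>. ennreal (g \<omega>))) R \<le> KL ?M R" by (rule min)
  from KL_midpoint_unique[OF R f f0 g g0 eq fin this]
  show ?thesis by (intro density_cong) (auto elim!: eventually_mono)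
qed

section \<open>Comparison of the two scenarios\<close>

text \<open>Proportional terminal functions give proportional phi at every point. The factor
  \<open>k\<close> disappears from the gradient of the logarithm and cancels in the quotient of the
  killing rate. The numerator there is a point value of \<open>g1\<close>, which is controlled only
  outside a null set.\<close>

lemma bridge_coefficients_eq:
  fixes R :: "('n::finite) path measure" and c :: "real^'n"
  assumes R: "prob_space R" and sR: "sets R = sets (path_space T psi1)"
    and act: "AE \<omega> in R. regime_of (\<omega> 0) = Active"
    and sde: "sde_with_killing T b' \<sigma>' V psi1 R" and q: "active_transition_density T R q"
    and V: "C_bounded T V" and T: "0 < T" and V0: "\<And>t x. t \<in> {0..T} \<Longrightarrow> 0 \<le> V t x"
    and g1[measurable]: "g1 \<in> borel_measurable state_space" and g10: "\<And>y. 0 \<le> g1 y"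
    and g2[measurable]: "g2 \<in> borel_measurable state_space" and g20: "\<And>y. 0 \<le> g2 y"
    and k: "0 < k" and eq: "AE y in law_at R T. g1 y = k * g2 (collapse c y)"
    and bd: "AE y in law_at R T. g1 y \<le> C" and C: "0 \<le> C"
  shows "t \<in> {0..<T} \<Longrightarrow> bridge_drift T b \<sigma> q V psi1 g1 t x = bridge_drift T b \<sigma> q V (psi2 c) g2 t x"
    and "AE p in lborel. fst p \<in> {0..<T} \<longrightarrow>
      bridge_killing_rate T q V psi1 g1 (fst p) (snd p) = bridge_killing_rate T q V (psi2 c) g2 (fst p) (snd p)"
proof -
  let ?g = "g2 \<circ> collapse c"
  have gm[measurable]: "?g \<in> borel_measurable state_space"
    unfolding comp_def by measurable
  have eq': "AE y in law_at R T. g1 y = k * ?g y" using eq by simp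
  have s1: "{y. g1 y = k * ?g y} \<in> sets state_space"
  proof -
    have "{y \<in> space state_space. g1 y = k * ?g y} \<in> sets state_space" by measurable
    then show ?thesis by simp
  qed
  have s2: "{y. g1 y \<le> C} \<in> sets state_space"
  proof -
    have "{y \<in> space state_space. g1 y \<le> C} \<in> sets state_space" by measurable
    then show ?thesis by simp
  qed
  have e1: "AE z in lborel. g1 ((z, 0), Active) = k * ?g ((z, 0), Active)"
    and e2: "AE p in lborel. fst p \<in> {0..T} \<longrightarrow> V (fst p) (snd p) \<noteq> 0 \<longrightarrow>
      g1 ((snd p, fst p), Dead) = k * ?g ((snd p, fst p), Dead)"
    by (rule AE_lborel_of_terminal_law[OF R sR act sde q V T V0 s1 eq'], assumption)+
  have b1: "AE z in lborel. g1 ((z, 0), Active) \<le> C"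
    and b2: "AE p in lborel. fst p \<in> {0..T} \<longrightarrow> V (fst p) (snd p) \<noteq> 0 \<longrightarrow> g1 ((snd p, fst p), Dead) \<le> C"
    by (rule AE_lborel_of_terminal_law[OF R sR act sde q V T V0 s2 bd], assumption)+
  have e2': "AE p in lborel. snd p \<in> {0..T} \<longrightarrow> V (snd p) (fst p) \<noteq> 0 \<longrightarrow> g1 (p, Dead) = k * ?g (p, Dead)"
    using AE_lborel_swap[OF e2] by simp
  have b2': "AE p in lborel. snd p \<in> {0..T} \<longrightarrow> V (snd p) (fst p) \<noteq> 0 \<longrightarrow> g1 (p, Dead) \<le> C"
    using AE_lborel_swap[OF b2] by simp
  have S1: "phi_setting T R q V g1 t" if "t \<in> {0..<T}" for t
    using that by unfold_locales (use q V V0 g1 g10 in auto)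
  have S2: "phi_setting T R q V ?g t" if "t \<in> {0..<T}" for t
    using that by unfold_locales (use q V V0 gm g20 in auto)
  have E: "phi_ennreal T q V g1 t x = ennreal k * phi_ennreal T q V ?g t x" if t: "t \<in> {0..<T}" for t x
    by (rule phi_setting.phi_ennreal_cmult[OF S2[OF t] less_imp_le[OF k] e1 e2' S1[OF t]])
  have phi: "phi_active T q V psi1 g1 t x = k * phi_active T q V (psi2 c) g2 t x" if t: "t \<in> {0..<T}" for t x
    unfolding phi_active_psi2 phi_active_psi1 E[OF t] using k by (simp add: enn2real_mult)
  show "bridge_drift T b \<sigma> q V psi1 g1 t x = bridge_drift T b \<sigma> q V (psi2 c) g2 t x" if t: "t \<in> {0..<T}"
  proof -
    \<comment> \<open>An infinite value would become 0 in \<open>phi_active\<close>, and there the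
      two logarithms would coincide instead of differing by \<open>ln k\<close>.\<close>
    have fin: "phi_ennreal T q V ?g t x < \<infinity>" for x
    proof -
      have "ennreal k * phi_ennreal T q V ?g t x < \<infinity>"
        using phi_setting.phi_ennreal_finite[OF S1[OF t] C b1 b2', of x] by (simp only: E[OF t])
      then show ?thesis using k by (auto simp: ennreal_mult_less_top)
    qed
    have "grad (\<lambda>x. ln (phi_active T q V psi1 g1 t x)) = grad (\<lambda>x. ln (phi_active T q V (psi2 c) g2 t x))"
    proof (cases "phi_ennreal T q V ?g t x = 0")
      \<comment> \<open>If phi vanishes at one point, it vanishes at all of them, and both
        logarithms are the same constant \<open>ln 0\<close>.\<close>
      case True
      then have "phi_ennreal T q V ?g t y = 0" for y
        using phi_setting.phi_ennreal_eq_0_iff[OF S2[OF t]] by simp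
      then have "phi_active T q V (psi2 c) g2 t y = 0" for y
        unfolding phi_active_psi2 phi_active_psi1 by simp
      then show ?thesis by (simp add: phi[OF t])
    next
      case False
      then have "phi_ennreal T q V ?g t y \<noteq> 0" for y
        using phi_setting.phi_ennreal_eq_0_iff[OF S2[OF t]] by simp
      then have pos: "0 < phi_active T q V (psi2 c) g2 t y" for y
        unfolding phi_active_psi2 phi_active_psi1
        using fin[of y] by (simp add: enn2real_positive_iff zero_less_iff_neq_zero)
      have "(\<lambda>y. ln (phi_active T q V psi1 g1 t y)) = (\<lambda>y. ln k + ln (phi_active T q V (psi2 c) g2 t y))"
        using k pos[THEN less_imp_neq, symmetric] by (simp add: phi[OF t] ln_mult fun_eq_iff)
      then show ?thesis by (simp only: grad_add_const)
    qed
    then show ?thesis by (simp add: bridge_drift_def)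
  qed
  show "AE p in lborel. fst p \<in> {0..<T} \<longrightarrow>
      bridge_killing_rate T q V psi1 g1 (fst p) (snd p) = bridge_killing_rate T q V (psi2 c) g2 (fst p) (snd p)"
    using e2
  proof (rule eventually_mono, intro impI)
    fix p :: "real \<times> (real^'n)"
    assume a: "fst p \<in> {0..T} \<longrightarrow> V (fst p) (snd p) \<noteq> 0 \<longrightarrow> g1 ((snd p, fst p), Dead) = k * ?g ((snd p, fst p), Dead)"
      and t: "fst p \<in> {0..<T}"
    show "bridge_killing_rate T q V psi1 g1 (fst p) (snd p) = bridge_killing_rate T q V (psi2 c) g2 (fst p) (snd p)"
    \<comment> \<open>Where \<open>V\<close> vanishes, nothing is known about \<open>g1\<close>, but
      the factor \<open>V\<close> makes both rates 0.\<close>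
    proof (cases "V (fst p) (snd p) = 0")
      case False
      then have "g1 ((snd p, fst p), Dead) = k * g2 ((c, fst p), Dead)"
        using a t by (simp add: collapse_def)
      then show ?thesis
        using k by (simp add: bridge_killing_rate_def phi_dead_def psi1_def psi2_def phi[OF t])
    qed (simp add: bridge_killing_rate_def)
  qed
qed

theorem theorem4p1p3:
  fixes T :: real and c :: "real^'n::finite"
    and b :: "real \<Rightarrow> real^'n \<Rightarrow> real^'n" and \<sigma> :: "real \<Rightarrow> real^'n \<Rightarrow> real^'n^'n"
    and V :: "real \<Rightarrow> real^'n \<Rightarrow> real"
    and q :: "real \<Rightarrow> real^'n \<Rightarrow> real \<Rightarrow> real^'n \<Rightarrow> real"
    and \<mu>\<^sub>0 rho0_1 rho0_2 :: "(real^'n) measure"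
    and rhoT_1 rhoT_2 :: "'n state measure"
    and ra1 ra2 :: "real^'n \<Rightarrow> real"
    and rd1 :: "(real^'n) \<times> real \<Rightarrow> real" and rd2 :: "real \<Rightarrow> real"
    and R1 R2 P1 P2 :: "'n path measure"
    and f1 g1 f2 g2 :: "'n state \<Rightarrow> real"
  assumes "0 < T"
    and "assumption_C T b \<sigma> V"
    and "prob_space \<mu>\<^sub>0" "sets \<mu>\<^sub>0 = sets borel"
    and "reference_measure1 T b \<sigma> V \<mu>\<^sub>0 q R1"
    and "R2 = distr R1 (path_space T (psi2 c)) (Phi T c)"
    and "prob_space rho0_1" "sets rho0_1 = sets borel"
    and "prob_space rho0_2" "sets rho0_2 = sets borel"
    and "terminal_law1 T rhoT_1 ra1 rd1"
    and "terminal_law2 T c rhoT_2 ra2 rd2"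
    and "rho0_1 = rho0_2"
    and "\<forall>x. ra1 x = ra2 x"
    and "\<forall>\<tau>\<in>{0..T}. (\<integral>\<^sup>+ x. ennreal (rd1 (x, \<tau>)) \<partial>lborel) = ennreal (rd2 \<tau>)"
    and "assumption_A T R1 rho0_1 rhoT_1" "assumption_A T R2 rho0_2 rhoT_2"
    and "assumption_B T R1 \<mu>\<^sub>0 f1 g1" "assumption_B T R2 \<mu>\<^sub>0 f2 g2"
    and "schroedinger_bridge T psi1 R1 rho0_1 rhoT_1 P1"
    and "schroedinger_bridge T (psi2 c) R2 rho0_2 rhoT_2 P2"
    and "unique_static_solution T R1 rho0_1 rhoT_1 f1 g1"
    and "unique_static_solution T R2 rho0_2 rhoT_2 f2 g2"
    and "P1 = density R1 (\<lambda>\<omega>. ennreal (f1 (\<omega> 0) * g1 (\<omega> T)))"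
    and "P2 = density R2 (\<lambda>\<omega>. ennreal (f2 (\<omega> 0) * g2 (\<omega> T)))"
  shows "KL P1 R1 \<ge> KL P2 R2
    \<and> (let i = (KL P1 R1 = KL P2 R2);
            ii = (distr P1 (path_space T (psi2 c)) (Phi T c) = P2);
            iii = (\<exists>h \<in> borel_measurable borel.
                     AE y in law_at R1 T. regime_of y = Dead \<longrightarrow> g1 y = h (ktime y));
            iv = (AE y in law_at R1 T. regime_of y = Dead \<longrightarrow>
                     RN_deriv (law_at R1 T) rhoT_1 y
                     = ennreal (g2 ((c, ktime y), Dead))
                       * cond_exp_given R1 state_space (\<lambda>\<omega>. \<omega> T) (\<lambda>\<omega>. ennreal (f2 (\<omega> 0))) y)
        in (i \<longleftrightarrow> ii) \<and> (i \<longleftrightarrow> iii) \<and> (i \<longleftrightarrow> iv)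
         \<and> (i \<or> ii \<or> iii \<or> iv \<longrightarrow>
              (\<forall>t\<in>{0..<T}. \<forall>x.
                 bridge_drift T b \<sigma> q V psi1 g1 t x = bridge_drift T b \<sigma> q V (psi2 c) g2 t x)
            \<and> (AE p in lborel. fst p \<in> {0..<T} \<longrightarrow>
                 bridge_killing_rate T q V psi1 g1 (fst p) (snd p)
                 = bridge_killing_rate T q V (psi2 c) g2 (fst p) (snd p))))"
proof -
  note T = assms(1)
  let ?S = "state_space :: 'n state measure"
  let ?W = "path_space T (psi2 c)"
  let ?\<Phi> = "Phi T c"
  have V: "C_bounded T V" and V0: "\<And>t x. t \<in> {0..T} \<Longrightarrow> 0 \<le> V t x"
    using assms(2) unfolding assumption_C_def by blast+
  have R1: "prob_space R1" and sR1: "sets R1 = sets (path_space T psi1)"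
    and l0: "law_at R1 0 = embed_active \<mu>\<^sub>0" and sde: "sde_with_killing T b \<sigma> V psi1 R1"
    and q: "active_transition_density T R1 q"
    using assms(5) unfolding reference_measure1_def by blast+
  interpret R1: prob_space R1 by (rule R1)
  have \<Phi>[measurable]: "?\<Phi> \<in> R1 \<rightarrow>\<^sub>M ?W"
    by (subst measurable_cong_sets[OF sR1 refl]) (rule measurable_Phi)
  have R2: "prob_space R2" unfolding assms(6) by (rule R1.prob_space_distr[OF \<Phi>])
  interpret R2: prob_space R2 by (rule R2)
  have sR2: "sets R2 = sets ?W" by (simp add: assms(6))
  have T0: "0 \<in> {0..T}" and TT: "T \<in> {0..T}" using T by auto
  have w0[measurable]: "(\<lambda>\<omega>. \<omega> 0) \<in> ?W \<rightarrow>\<^sub>M ?S" and wT[measurable]: "(\<lambda>\<omega>. \<omega> T) \<in> ?W \<rightarrow>\<^sub>M ?S"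
    using T by (auto intro: measurable_coordinate)
  have c0[measurable]: "(\<lambda>\<omega>. \<omega> 0) \<in> R1 \<rightarrow>\<^sub>M ?S" and cT[measurable]: "(\<lambda>\<omega>. \<omega> T) \<in> R1 \<rightarrow>\<^sub>M ?S"
    using T by (auto simp: measurable_cong_sets[OF sR1 refl] intro: measurable_coordinate)
  have act: "AE \<omega> in R1. regime_of (\<omega> 0) = Active"
    by (rule AE_start_active[OF sR1 T l0 assms(4)])
  have start: "AE \<omega> in R1. ?\<Phi> \<omega> 0 = \<omega> 0"
    using act by (rule eventually_mono) (simp add: Phi_apply[OF T0] collapse_def)
  have stat1: "static_system T R1 rho0_1 rhoT_1 f1 g1" and stat2: "static_system T R2 rho0_2 rhoT_2 f2 g2"
    using assms(22,23) by (auto simp: unique_static_solution_def)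
  have f1[measurable]: "f1 \<in> borel_measurable ?S" and g1[measurable]: "g1 \<in> borel_measurable ?S"
    and f10: "\<And>y. 0 \<le> f1 y" and g10: "\<And>y. 0 \<le> g1 y"
    using stat1 by (auto simp: static_system_def)
  have f2[measurable]: "f2 \<in> borel_measurable ?S" and g2[measurable]: "g2 \<in> borel_measurable ?S"
    and f20: "\<And>y. 0 \<le> f2 y" and g20: "\<And>y. 0 \<le> g2 y"
    using stat2 by (auto simp: static_system_def)
  have gc[measurable]: "g2 \<circ> collapse c \<in> borel_measurable ?S" unfolding comp_def by measurable
  have gc0: "0 \<le> (g2 \<circ> collapse c) y" for y by (simp add: g20)
  have adm1: "admissible T psi1 rho0_1 rhoT_1 P1"
    using assms(20) by (simp add: schroedinger_bridge_def is_arg_min_def)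
  have adm2: "admissible T (psi2 c) rho0_2 rhoT_2 P2"
    and min2: "\<And>P. admissible T (psi2 c) rho0_2 rhoT_2 P \<Longrightarrow> KL P2 R2 \<le> KL P R2"
    using assms(21) by (simp_all add: schroedinger_bridge_def is_arg_min_linorder)
  have uniq1: "\<exists>k>0. (AE y in law_at R1 0. f y = k * f1 y) \<and> (AE y in law_at R1 T. g y = g1 y / k)"
    if "static_system T R1 rho0_1 rhoT_1 f g" for f g
    using assms(22) that unfolding unique_static_solution_def by blast
  have uniq2: "\<exists>k>0. (AE y in law_at R2 0. f y = k * f2 y) \<and> (AE y in law_at R2 T. g y = g2 y / k)"
    if "static_system T R2 rho0_2 rhoT_2 f g" for f g
    using assms(23) that unfolding unique_static_solution_def by blast
  have rT: "distr rhoT_1 ?S (collapse c) = rhoT_2"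
    by (rule distr_terminal_law_collapse[OF assms(11,12,14,15)])
  have srT1: "sets rhoT_1 = sets ?S" using assms(11) by (simp add: terminal_law1_def)
  have srT2: "sets rhoT_2 = sets ?S" "prob_space rhoT_2" using assms(12) by (simp_all add: terminal_law2_def)

  \<comment> \<open>An active start is fixed by \<open>Phi\<close>, so only the terminal factor has
    to be composed with \<open>collapse\<close>.\<close>
  have push: "distr (density R1 (\<lambda>\<omega>. ennreal (f (\<omega> 0) * (g \<circ> collapse c) (\<omega> T)))) ?W ?\<Phi>
      = density R2 (\<lambda>\<omega>. ennreal (f (\<omega> 0) * g (\<omega> T)))"
    if [measurable]: "f \<in> borel_measurable ?S" "g \<in> borel_measurable ?S" for f g :: "'n state \<Rightarrow> real"
  proof -
    have [measurable]: "g \<circ> collapse c \<in> borel_measurable ?S" unfolding comp_def by measurable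
    have "density R1 (\<lambda>\<omega>. ennreal (f (\<omega> 0) * (g \<circ> collapse c) (\<omega> T)))
        = density R1 (\<lambda>\<omega>. ennreal (f (?\<Phi> \<omega> 0) * g (?\<Phi> \<omega> T)))"
    proof (rule density_cong)
      show "(\<lambda>\<omega>. ennreal (f (\<omega> 0) * (g \<circ> collapse c) (\<omega> T))) \<in> borel_measurable R1" by measurable
      have "(\<lambda>\<omega>. ennreal (f (\<omega> 0) * g (\<omega> T))) \<in> borel_measurable ?W" by measurable
      from measurable_compose[OF \<Phi> this]
      show "(\<lambda>\<omega>. ennreal (f (?\<Phi> \<omega> 0) * g (?\<Phi> \<omega> T))) \<in> borel_measurable R1" .
      show "AE \<omega> in R1. ennreal (f (\<omega> 0) * (g \<circ> collapse c) (\<omega> T)) = ennreal (f (?\<Phi> \<omega> 0) * g (?\<Phi> \<omega> T))"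
        using start by (rule eventually_mono) (simp add: Phi_apply[OF TT])
    qed
    then show ?thesis
      using density_distr[of "\<lambda>\<omega>. ennreal (f (\<omega> 0) * g (\<omega> T))" ?W ?\<Phi> R1] by (simp add: assms(6))
  qed

  \<comment> \<open>The density of \<open>P1\<close> written on collapsed paths: outside the null
    set of paths that start dead, \<open>recover_terminal\<close> restores the terminal state that
    \<open>g1\<close> needs.\<close>
  define F where "F \<omega> = f1 (\<omega> 0) * g1 (recover_terminal T \<omega>)" for \<omega> :: "'n path"
  have F[measurable]: "F \<in> borel_measurable ?W"
    unfolding F_def[abs_def]
    using measurable_compose[OF w0 f1] measurable_compose[OF measurable_recover_terminal[OF T] g1]
    by (intro borel_measurable_times)
  have F0: "0 \<le> F \<omega>" for \<omega> using f10 g10 by (simp add: F_def)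
  have F\<Phi>m: "(\<lambda>\<omega>. F (?\<Phi> \<omega>)) \<in> borel_measurable R1" by (rule measurable_compose[OF \<Phi> F])
  have F\<Phi>: "AE \<omega> in R1. F (?\<Phi> \<omega>) = f1 (\<omega> 0) * g1 (\<omega> T)"
    using start act AE_space
  proof eventually_elim
    fix \<omega> :: "'n path" assume "?\<Phi> \<omega> 0 = \<omega> 0" "regime_of (\<omega> 0) = Active" "\<omega> \<in> space R1"
    moreover from this have "\<omega> \<in> path_set T psi1"
      using sets_eq_imp_space_eq[OF sR1] by (simp add: space_path_space)
    ultimately show "F (?\<Phi> \<omega>) = f1 (\<omega> 0) * g1 (\<omega> T)"
      by (simp add: F_def recover_terminal_Phi T)
  qed
  have P1F: "P1 = density R1 (\<lambda>\<omega>. ennreal (F (?\<Phi> \<omega>)))"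
    unfolding assms(24)
  proof (rule density_cong)
    show "AE \<omega> in R1. ennreal (f1 (\<omega> 0) * g1 (\<omega> T)) = ennreal (F (?\<Phi> \<omega>))"
      using F\<Phi> by (rule eventually_mono) simp
    show "(\<lambda>\<omega>. ennreal (F (?\<Phi> \<omega>))) \<in> borel_measurable R1" using F\<Phi>m by simp
  qed measurable
  define P where "P = distr P1 ?W ?\<Phi>"
  have PF: "P = density R2 (\<lambda>\<omega>. ennreal (F \<omega>))"
    using density_distr[of "\<lambda>\<omega>. ennreal (F \<omega>)" ?W ?\<Phi> R1] by (simp add: P_def P1F assms(6))
  have KLP: "KL P R2 = KL P1 R1"
    unfolding PF P1F assms(6) by (rule KL_density_comp[OF R1 \<Phi> F F0, symmetric])
  have sP1: "sets P1 = sets (path_space T psi1)" using adm1 by (simp add: admissible_def)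
  have admP: "admissible T (psi2 c) rho0_2 rhoT_2 P"
  proof -
    have "?\<Phi> \<in> P1 \<rightarrow>\<^sub>M ?W" by (subst measurable_cong_sets[OF sP1 refl]) (rule measurable_Phi)
    then have "prob_space P"
      unfolding P_def using adm1 by (intro prob_space.prob_space_distr) (auto simp: admissible_def)
    moreover have "law_at P 0 = embed_active rho0_2"
      using law_at_distr_Phi[OF sP1 T0, of c] adm1 distr_embed_active_collapse[OF assms(8), of c] assms(13)
      by (simp add: P_def admissible_def)
    moreover have "law_at P T = rhoT_2"
      using law_at_distr_Phi[OF sP1 TT, of c] adm1 rT by (simp add: P_def admissible_def)
    ultimately show ?thesis by (simp add: admissible_def P_def)
  qed
  have ge: "KL P2 R2 \<le> KL P1 R1" using min2[OF admP] by (simp add: KLP)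
  \<comment> \<open>Needed for (ii): two equal infinite entropies would not identify the
    measures.\<close>
  have fin: "KL P2 R2 < \<infinity>"
  proof -
    obtain Q where "admissible T (psi2 c) rho0_2 rhoT_2 Q" "KL Q R2 < \<infinity>"
      using exists_admissible_finite_KL[OF R2 sR2 T assms(9,10) srT2(2,1) assms(17)] by blast
    then show ?thesis using min2 by (blast intro: le_less_trans)
  qed
  define G where "G \<omega> = f2 (\<omega> 0) * g2 (\<omega> T)" for \<omega> :: "'n path"
  have G[measurable]: "G \<in> borel_measurable ?W" unfolding G_def[abs_def] by measurable
  have G0: "0 \<le> G \<omega>" for \<omega> using f20 g20 by (simp add: G_def)
  have P2G: "P2 = density R2 (\<lambda>\<omega>. ennreal (G \<omega>))" by (simp add: assms(25) G_def)
  have FR2: "F \<in> borel_measurable R2" and GR2: "G \<in> borel_measurable R2"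
    by (simp_all add: measurable_cong_sets[OF sR2 refl])

  \<comment> \<open>Equality of entropies and equality of measures\<close>
  define ii where "ii \<longleftrightarrow> P = P2"
  have i_ii: "KL P1 R1 = KL P2 R2 \<longleftrightarrow> ii"
  proof
    assume e: "KL P1 R1 = KL P2 R2"
    have "density R2 (\<lambda>\<omega>. ennreal (F \<omega>)) = density R2 (\<lambda>\<omega>. ennreal (G \<omega>))"
    proof (rule schroedinger_bridge_unique[OF R2 sR2 T FR2 F0 GR2 G0])
      show "admissible T (psi2 c) rho0_2 rhoT_2 (density R2 (\<lambda>\<omega>. ennreal (F \<omega>)))"
        using admP unfolding PF .
      show "schroedinger_bridge T (psi2 c) R2 rho0_2 rhoT_2 (density R2 (\<lambda>\<omega>. ennreal (G \<omega>)))"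
        using assms(21) unfolding P2G .
      show "KL (density R2 (\<lambda>\<omega>. ennreal (F \<omega>))) R2 = KL (density R2 (\<lambda>\<omega>. ennreal (G \<omega>))) R2"
        using e KLP unfolding PF P2G by simp
      show "KL (density R2 (\<lambda>\<omega>. ennreal (G \<omega>))) R2 < \<infinity>" using fin unfolding P2G .
    qed
    then show ii by (simp add: ii_def PF P2G)
  qed (simp add: ii_def KLP[symmetric])

  \<comment> \<open>(ii), (iii) and (iv) are each equivalent to \<open>P1 = D\<close>.\<close>
  define D where "D = density R1 (\<lambda>\<omega>. ennreal (f2 (\<omega> 0) * (g2 \<circ> collapse c) (\<omega> T)))"
  have DP2: "distr D ?W ?\<Phi> = P2"
    unfolding D_def push[OF f2 g2] assms(25) ..
  have D_stat: "static_system T R1 rho0_1 rhoT_1 f2 (g2 \<circ> collapse c)"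
    if "law_at D 0 = embed_active rho0_1" "law_at D T = rhoT_1"
    using that unfolding D_def by (intro static_system_of_marginals[OF R1 sR1 T f2 f20 gc gc0])
  have D_dens: "P1 = D"
    if k: "0 < k" and f: "AE y in law_at R1 0. f2 y = k * f1 y"
      and g: "AE y in law_at R1 T. (g2 \<circ> collapse c) y = g1 y / k" for k
    unfolding assms(24) D_def
  proof (rule density_cong)
    show "AE \<omega> in R1. ennreal (f1 (\<omega> 0) * g1 (\<omega> T)) = ennreal (f2 (\<omega> 0) * (g2 \<circ> collapse c) (\<omega> T))"
      using AE_distrD[OF c0 f[unfolded law_at_def]] AE_distrD[OF cT g[unfolded law_at_def]]
      by eventually_elim (use k in simp)
  qed measurable
  have star: "\<exists>k>0. (AE y in law_at R1 0. f2 y = k * f1 y) \<and> (AE y in law_at R1 T. (g2 \<circ> collapse c) y = g1 y / k)"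
    if "P1 = D"
    using that adm1 by (intro uniq1 D_stat) (auto simp: admissible_def)
  \<comment> \<open>Push-forward is injective on these measures: \<open>F\<close> and
    \<open>G\<close> are densities over \<open>R2\<close>, and an equality \<open>R2\<close>-almost
    everywhere pulls back along \<open>Phi\<close>, where the two become the densities of
    \<open>P1\<close> and \<open>D\<close>.\<close>
  have ii_D: "ii \<longleftrightarrow> P1 = D"
  proof
    assume ii
    then have "AE \<omega> in R2. ennreal (F \<omega>) = ennreal (G \<omega>)"
      using FR2 GR2 by (subst (asm) ii_def, intro R2.density_unique) (simp_all add: PF P2G)
    then have "AE \<omega> in R1. ennreal (F (?\<Phi> \<omega>)) = ennreal (G (?\<Phi> \<omega>))"
      unfolding assms(6) by (rule AE_distrD[OF \<Phi>])
    moreover note start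
    ultimately have "AE \<omega> in R1. ennreal (F (?\<Phi> \<omega>)) = ennreal (f2 (\<omega> 0) * (g2 \<circ> collapse c) (\<omega> T))"
      by eventually_elim (simp add: G_def Phi_apply[OF TT])
    then show "P1 = D"
      unfolding P1F D_def using F\<Phi>m by (intro density_cong) simp_all
  next
    assume "P1 = D"
    then show ii unfolding ii_def P_def using DP2 by simp
  qed

  \<comment> \<open>Dependence of the dead part of \<open>g1\<close> on the killing time
    alone\<close>
  define iii where "iii \<longleftrightarrow> (\<exists>h \<in> borel_measurable borel.
    AE y in law_at R1 T. regime_of y = Dead \<longrightarrow> g1 y = h (ktime y))"
  have D_iii: "iii" if PD: "P1 = D"
  proof -
    obtain k where k: "0 < k" "AE y in law_at R1 T. (g2 \<circ> collapse c) y = g1 y / k"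
      using star[OF PD] by blast
    have "(\<lambda>\<tau>. ((c, \<tau>), Dead)) \<in> borel \<rightarrow>\<^sub>M ?S" by (intro measurable_stateI) simp_all
    from measurable_compose[OF this g2]
    have "(\<lambda>\<tau>. k * g2 ((c, \<tau>), Dead)) \<in> borel_measurable borel" by simp
    moreover have "AE y in law_at R1 T. regime_of y = Dead \<longrightarrow> g1 y = k * g2 ((c, ktime y), Dead)"
      using k(2) by (rule eventually_mono) (use k(1) in \<open>auto simp: collapse_def\<close>)
    ultimately show ?thesis unfolding iii_def by (intro bexI)
  qed
  \<comment> \<open>Under (iii) \<open>g1\<close> factors through \<open>collapse\<close>, so the
    push-forward of \<open>P1\<close> has a product density over \<open>R2\<close> with the
    marginals of Scenario (2). Uniqueness of the static solution there forces it to be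
    \<open>P2\<close>.\<close>
  have iii_ii: ii if iii: iii
  proof -
    obtain h where [measurable]: "h \<in> borel_measurable borel"
      and h: "AE y in law_at R1 T. regime_of y = Dead \<longrightarrow> g1 y = h (ktime y)"
      using iii unfolding iii_def by blast
    \<comment> \<open>\<open>h\<close> agrees with the nonnegative \<open>g1\<close> only almost
      everywhere, whereas a static solution must be nonnegative everywhere; hence the
      \<open>max 0\<close>.\<close>
    define H where "H y = (if regime_of y = Active then g1 y else max 0 (h (ktime y)))" for y :: "'n state"
    have H[measurable]: "H \<in> borel_measurable ?S" unfolding H_def[abs_def] by measurable
    have H0: "0 \<le> H y" for y by (simp add: H_def g10)
    have "AE y in law_at R1 T. g1 y = (H \<circ> collapse c) y"
      using h
    proof (rule eventually_mono)
      fix y assume hy: "regime_of y = Dead \<longrightarrow> g1 y = h (ktime y)"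
      show "g1 y = (H \<circ> collapse c) y"
      proof (cases "regime_of y")
        case Active then show ?thesis by (simp add: H_def collapse_def)
      next
        case Dead
        then have "g1 y = h (ktime y)" using hy by simp
        then show ?thesis using Dead g10[of y] by (simp add: H_def)
      qed
    qed
    from AE_distrD[OF cT this[unfolded law_at_def]]
    have "P1 = density R1 (\<lambda>\<omega>. ennreal (f1 (\<omega> 0) * (H \<circ> collapse c) (\<omega> T)))"
      unfolding assms(24)
      by (intro density_cong) (auto elim!: eventually_mono simp: comp_def)
    then have PH: "P = density R2 (\<lambda>\<omega>. ennreal (f1 (\<omega> 0) * H (\<omega> T)))"
      unfolding P_def using push[OF f1 H] by simp
    then have "static_system T R2 rho0_2 rhoT_2 f1 H"
      using admP by (intro static_system_of_marginals[OF R2 sR2 T f1 f10 H H0]) (simp_all add: admissible_def)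
    then obtain k where k: "0 < k" "AE y in law_at R2 0. f1 y = k * f2 y" "AE y in law_at R2 T. H y = g2 y / k"
      using uniq2 by blast
    have d0: "(\<lambda>\<omega>. \<omega> 0) \<in> R2 \<rightarrow>\<^sub>M ?S" and dT: "(\<lambda>\<omega>. \<omega> T) \<in> R2 \<rightarrow>\<^sub>M ?S"
      by (simp_all add: measurable_cong_sets[OF sR2 refl])
    have "P = P2"
      unfolding PH assms(25)
    proof (rule density_cong)
      show "AE \<omega> in R2. ennreal (f1 (\<omega> 0) * H (\<omega> T)) = ennreal (f2 (\<omega> 0) * g2 (\<omega> T))"
        using AE_distrD[OF d0 k(2)[unfolded law_at_def]] AE_distrD[OF dT k(3)[unfolded law_at_def]]
        by eventually_elim (use k(1) in simp)
      show "(\<lambda>\<omega>. ennreal (f1 (\<omega> 0) * H (\<omega> T))) \<in> borel_measurable R2"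
        using measurable_compose[OF d0 f1] measurable_compose[OF dT H] by simp
      show "(\<lambda>\<omega>. ennreal (f2 (\<omega> 0) * g2 (\<omega> T))) \<in> borel_measurable R2"
        using measurable_compose[OF d0 f2] measurable_compose[OF dT g2] by simp
    qed
    then show ii by (simp add: ii_def)
  qed

  \<comment> \<open>The terminal equation in the dead regime\<close>
  define iv where "iv \<longleftrightarrow> (AE y in law_at R1 T. regime_of y = Dead \<longrightarrow>
    RN_deriv (law_at R1 T) rhoT_1 y = ennreal (g2 ((c, ktime y), Dead))
      * cond_exp_given R1 state_space (\<lambda>\<omega>. \<omega> T) (\<lambda>\<omega>. ennreal (f2 (\<omega> 0))) y)"
  have D_iv: "iv" if "P1 = D"
  proof -
    have "static_system T R1 rho0_1 rhoT_1 f2 (g2 \<circ> collapse c)"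
      using that adm1 by (intro D_stat) (auto simp: admissible_def)
    then have "AE y in law_at R1 T. ennreal ((g2 \<circ> collapse c) y)
        * cond_exp_given R1 state_space (\<lambda>\<omega>. \<omega> T) (\<lambda>\<omega>. ennreal (f2 (\<omega> 0))) y
        = RN_deriv (law_at R1 T) rhoT_1 y"
      by (simp add: static_system_def)
    then show ?thesis
      unfolding iv_def by (rule eventually_mono) (auto simp: collapse_def)
  qed
  \<comment> \<open>It suffices that \<open>D\<close> has the marginals of Scenario (1), by
    uniqueness there. The push-forward \<open>P2\<close> of \<open>D\<close> already fixes the
    initial law and the active terminal part; (iv) supplies the dead part.\<close>
  have iv_D: "P1 = D" if iv
  proof -
    let ?c = "cond_exp_given R1 state_space (\<lambda>\<omega>. \<omega> T) (\<lambda>\<omega>. ennreal (f2 (\<omega> 0)))"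
    have sD: "sets D = sets (path_space T psi1)" by (simp add: D_def sR1)
    have d0: "(\<lambda>\<omega>. \<omega> 0) \<in> D \<rightarrow>\<^sub>M ?S" and dT: "(\<lambda>\<omega>. \<omega> T) \<in> D \<rightarrow>\<^sub>M ?S"
      using T by (auto simp: measurable_cong_sets[OF sD refl] intro: measurable_coordinate)
    have D0: "law_at D 0 = embed_active rho0_1"
    proof -
      \<comment> \<open>Initial states are active, so collapsing loses nothing and the initial law
        of \<open>D\<close> is that of \<open>P2\<close>.\<close>
      have "AE \<omega> in D. collapse c (\<omega> 0) = \<omega> 0"
        unfolding D_def using start
        by (subst AE_density) (auto elim!: eventually_mono simp: Phi_apply[OF T0])
      then have "law_at D 0 = distr D ?S (\<lambda>\<omega>. collapse c (\<omega> 0))"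
        unfolding law_at_def using d0 measurable_compose[OF d0 measurable_collapse]
        by (intro distr_cong_AE) (auto elim!: eventually_mono)
      also have "\<dots> = law_at (distr D ?W ?\<Phi>) 0"
        unfolding law_at_distr_Phi[OF sD T0] unfolding law_at_def
        by (subst distr_distr[OF measurable_collapse d0]) (simp add: comp_def)
      also have "\<dots> = embed_active rho0_1"
        unfolding DP2 using adm2 assms(13) by (simp add: admissible_def)
      finally show ?thesis .
    qed
    have DT: "law_at D T = rhoT_1"
    proof (rule measure_eqI)
      show "sets (law_at D T) = sets rhoT_1" by (simp add: law_at_def srT1)
      fix A assume "A \<in> sets (law_at D T)"
      then have A[measurable]: "A \<in> sets ?S" by (simp add: law_at_def)
      let ?A = "A \<inter> {y. regime_of y = Active}" and ?B = "A \<inter> {y. regime_of y = Dead}"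
      have sA[measurable]: "?A \<in> sets ?S" and sB[measurable]: "?B \<in> sets ?S" by measurable
      have split: "emeasure M A = emeasure M ?A + emeasure M ?B" if "sets M = sets ?S" for M
      proof -
        have "A = ?A \<union> ?B" by (auto intro: regime.exhaust)
        then show ?thesis
          using that sA sB by (subst plus_emeasure) (auto simp del: Int_iff simp: Int_def)
      qed
      \<comment> \<open>Active sets are their own preimages under \<open>collapse\<close>, so their
        mass is visible after the push-forward.\<close>
      have inv: "collapse c -` ?A = ?A" by (auto simp: collapse_def split: if_splits)
      have "emeasure (law_at D T) ?A = emeasure (distr (law_at D T) ?S (collapse c)) ?A"
        by (subst emeasure_distr) (simp_all add: law_at_def inv del: vimage_Int)
      also have "\<dots> = emeasure rhoT_2 ?A"
        using law_at_distr_Phi[OF sD TT, of c] DP2 adm2 by (simp add: admissible_def)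
      also have "\<dots> = emeasure (distr rhoT_1 ?S (collapse c)) ?A" by (simp only: rT)
      also have "\<dots> = emeasure rhoT_1 ?A"
        using sets_eq_imp_space_eq[OF srT1]
        by (subst emeasure_distr) (simp_all add: inv measurable_cong_sets[OF srT1 refl] del: vimage_Int)
      finally have eA: "emeasure (law_at D T) ?A = emeasure rhoT_1 ?A" .
      interpret L: prob_space "law_at R1 T" unfolding law_at_def by (rule R1.prob_space_distr[OF cT])
      have lD: "law_at D T = density (law_at R1 T) (\<lambda>y. ennreal ((g2 \<circ> collapse c) y) * ?c y)"
      proof -
        have e: "(\<lambda>\<omega>. ennreal (f2 (\<omega> 0) * (g2 \<circ> collapse c) (\<omega> T)))
            = (\<lambda>\<omega>. ennreal ((g2 \<circ> collapse c) (\<omega> T)) * ennreal (f2 (\<omega> 0)))"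
          using f20 g20 by (simp add: fun_eq_iff ennreal_mult mult.commute)
        show ?thesis
          unfolding law_at_def D_def e by (rule distr_density_comp_mult[OF R1 cT]) measurable
      qed
      \<comment> \<open>Only then is the derivative in (iv) a density of the target; it follows
        because the target is the terminal law of \<open>P1\<close>, which has a density over
        \<open>R1\<close>.\<close>
      have ac: "absolutely_continuous (law_at R1 T) rhoT_1"
      proof -
        have "rhoT_1 = distr P1 ?S (\<lambda>\<omega>. \<omega> T)" using adm1 by (simp add: admissible_def law_at_def)
        also have "\<dots> = density (law_at R1 T) (\<lambda>y. ennreal (g1 y)
            * cond_exp_given R1 state_space (\<lambda>\<omega>. \<omega> T) (\<lambda>\<omega>. ennreal (f1 (\<omega> 0))) y)"
        proof -
          have e: "(\<lambda>\<omega>. ennreal (f1 (\<omega> 0) * g1 (\<omega> T))) = (\<lambda>\<omega>. ennreal (g1 (\<omega> T)) * ennreal (f1 (\<omega> 0)))"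
            using f10 g10 by (simp add: fun_eq_iff ennreal_mult mult.commute)
          show ?thesis
            unfolding law_at_def assms(24) e by (rule distr_density_comp_mult[OF R1 cT]) measurable
        qed
        also have "absolutely_continuous (law_at R1 T) \<dots>"
          by (intro absolutely_continuousI_density) (simp add: law_at_def cond_exp_given_def)
        finally show ?thesis .
      qed
      have rd: "rhoT_1 = density (law_at R1 T) (RN_deriv (law_at R1 T) rhoT_1)"
        by (rule L.density_RN_deriv[OF ac, symmetric]) (simp add: srT1 law_at_def)
      have lB: "?B \<in> sets (law_at R1 T)" using sB by (simp add: law_at_def)
      have "emeasure (law_at D T) ?B
          = (\<integral>\<^sup>+y. ennreal ((g2 \<circ> collapse c) y) * ?c y * indicator ?B y \<partial>law_at R1 T)"
        unfolding lD by (rule emeasure_density[OF _ lB]) (simp add: law_at_def cond_exp_given_def)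
      also have "\<dots> = (\<integral>\<^sup>+y. RN_deriv (law_at R1 T) rhoT_1 y * indicator ?B y \<partial>law_at R1 T)"
        using that unfolding iv_def
        by (intro nn_integral_cong_AE) (auto elim!: eventually_mono simp: indicator_def collapse_def)
      also have "\<dots> = emeasure (density (law_at R1 T) (RN_deriv (law_at R1 T) rhoT_1)) ?B"
        by (rule emeasure_density[OF _ lB, symmetric]) simp
      also have "\<dots> = emeasure rhoT_1 ?B" by (simp only: rd[symmetric])
      finally have eB: "emeasure (law_at D T) ?B = emeasure rhoT_1 ?B" .
      show "emeasure (law_at D T) A = emeasure rhoT_1 A"
        using split[of "law_at D T"] split[OF srT1] eA eB by (simp add: law_at_def)
    qed
    obtain k where "0 < k" "AE y in law_at R1 0. f2 y = k * f1 y"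
      "AE y in law_at R1 T. (g2 \<circ> collapse c) y = g1 y / k"
      using uniq1[OF D_stat[OF D0 DT]] by blast
    then show ?thesis by (rule D_dens)
  qed

  \<comment> \<open>Equality of drift and killing rate\<close>
  have coeff: "(\<forall>t\<in>{0..<T}. \<forall>x. bridge_drift T b \<sigma> q V psi1 g1 t x = bridge_drift T b \<sigma> q V (psi2 c) g2 t x)
      \<and> (AE p in lborel. fst p \<in> {0..<T} \<longrightarrow> bridge_killing_rate T q V psi1 g1 (fst p) (snd p)
                 = bridge_killing_rate T q V (psi2 c) g2 (fst p) (snd p))" if PD: "P1 = D"
  proof -
    obtain k where k: "0 < k" "AE y in law_at R1 T. (g2 \<circ> collapse c) y = g1 y / k"
      using star[OF PD] by blast
    have eq: "AE y in law_at R1 T. g1 y = k * g2 (collapse c y)"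
      using k(2) by (rule eventually_mono) (use k(1) in simp)
    obtain C where C: "\<forall>y\<in>state_support (law_at R1 T). g1 y \<le> C"
      using assms(18) unfolding assumption_B_def by blast
    have "sets (law_at R1 T) = sets ?S" by (simp add: law_at_def)
    \<comment> \<open>The constant in (B) may be negative, whereas the estimate of phi takes a
      nonnegative bound; hence \<open>max 0 C\<close>.\<close>
    from AE_state_support[OF this] have bd: "AE y in law_at R1 T. g1 y \<le> max 0 C"
      by (rule eventually_mono) (use C in \<open>simp add: le_max_iff_disj\<close>)
    show ?thesis
      using bridge_coefficients_eq[OF R1 sR1 act sde q V T V0 g1 g10 g2 g20 k(1) eq bd]
      by simp
  qed
  have "(KL P1 R1 = KL P2 R2) = (P1 = D)" using i_ii ii_D by simp
  moreover have "iii = (P1 = D)" using D_iii iii_ii ii_D by blast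
  moreover have "iv = (P1 = D)" using D_iv iv_D by blast
  ultimately show ?thesis
    using ge coeff ii_D unfolding Let_def iii_def[symmetric] iv_def[symmetric] P_def[symmetric] ii_def[symmetric]
    by blast
qed

end
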